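(* Fix $i\in\mathbb{N}$, let Assumption 1 (see context) hold, and run the ZO-Signum algorithm on subproblem $i$ with $\alpha_1=\frac34$, $\alpha_2=\frac12$, $s_1^{i,0}=\frac{1}{n^{3/4}}$, and with $\beta^i\approx 1$ and $s_2^{i,0}\approx1$ (constants of order $1$, $0<s_2^{i,0}<1$). Let $C\in\mathbb{N}$, $C\ge1$, be such that $$\frac{k}{(k+1)^{\alpha_2}}\ge\frac{\ln(s_2^{i,0})+(1+\alpha_2)\ln(k)}{s_2^{i,0}},\qquad \frac{k}{(k+1)^{\alpha_2}}\ge\frac{2\left(\ln(s_2^{i,0})+(1+\alpha_1-\alpha_2)\ln(k)\right)}{s_2^{i,0}}$$ are satisfied by $k=C$, let $K>C$, let $D_f^i$ be such that $f^{\beta^i}(\mathbf{x}^{i,C})-\min_{\mathbf{x}}f^{\beta^i}(\mathbf{x})\le D_f^i$, and let $R$ be picked uniformly at random among the integers of $[C,K]$. Then $$\mathbb{E}\big[\|\nabla f^{\beta^i}(\mathbf{x}^{i,R})\|_2\big]=O\left(\frac{n^{3/2}}{K^{1/4}}\ln(K)\right).$$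
   Context: Let $(\Omega,\mathcal{F},\mathbb{P})$ be a probability space, $\boldsymbol{\xi}:\Omega\to\mathbb{R}^m$ a random vector and $F:\mathbb{R}^n\times\mathbb{R}^m\to\mathbb{R}$. Assumption 1: (a) for all $\mathbf{x}\in\mathbb{R}^n$, $F(\mathbf{x},\boldsymbol{\xi})\in L^1(\Omega,\mathcal{F},\mathbb{P})$ and $f(\mathbf{x}):=\mathbb{E}_{\boldsymbol{\xi}}[F(\mathbf{x},\boldsymbol{\xi})]$; (b) for any $\boldsymbol{\xi}$, $F(\cdot,\boldsymbol{\xi})$ is Lipschitz continuous with constant $L_0(F)>0$. For $\beta>0$, $f^\beta(\mathbf{x}):=\mathbb{E}_{\mathbf{u}}[f(\mathbf{x}+\beta\mathbf{u})]$ with $\mathbf{u}\sim\mathcal{N}(\mathbf{0},I_n)$. ZO-Signum algorithm on subproblem $i$ (minimize $f^{\beta^i}$, $\beta^i>0$): given a starting point $\mathbf{x}^{i,0}\in\mathbb{R}^n$, a batch size $q\ge1$, and step sizes $s_1^{i,k}=s_1^{i,0}/(k+1)^{\alpha_1}$, $s_2^{i,k}=s_2^{i,0}/(k+1)^{\alpha_2}$, for $k=0,1,2,\dots$ draw fresh samples, independent of everything generated before, of directions $\mathbf{u}^1,\dots,\mathbf{u}^q\sim\mathcal{N}(\mathbf{0},I_n)$ and uncertainties $\boldsymbol{\xi}^1,\dots,\boldsymbol{\xi}^q$ (copies of $\boldsymbol{\xi}$), and set $$\tilde{\mathbf{g}}^{i,k}=\frac1q\sum_{j=1}^q\frac{\mathbf{u}^j\big(F(\mathbf{x}^{i,k}+\beta^i\mathbf{u}^j,\boldsymbol{\xi}^j)-F(\mathbf{x}^{i,k},\boldsymbol{\xi}^j)\big)}{\beta^i},$$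 $$\mathbf{m}^{i,k+1}=s_2^{i,k}\tilde{\mathbf{g}}^{i,k}+(1-s_2^{i,k})\mathbf{m}^{i,k},\qquad x_j^{i,k+1}=x_j^{i,k}-s_1^{i,k}\,\mathrm{sign}(m_j^{i,k+1}),\ j=1,\dots,n.$$ The momentum is initialized with a gradient estimate $\mathbf{m}^{i,0}$ of the same form (and distribution) as $\tilde{\mathbf{g}}^{i,0}$, computed at $\mathbf{x}^{i,0}$. In the analysis the stopping test of the algorithm is ignored. The $O$ notation expresses the dependence on $n$ and on $K$ (as $K\to\infty$), with $L_0(F)$ and $D_f^i$ regarded as constants. *)

theory Defs
  imports "HOL-Probability.Probability"
begin

text \<open>The bound in question is uniform in the dimension, so the dimension has to be a number that can
  be quantified inside a formula. Vectors of length \<open>n\<close> are therefore the extensional functions on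
  \<open>{..<n}\<close>, i.e. the points of the product space below; every operation on vectors returns
  extensional functions. The Euclidean norm of \<open>v\<close> is \<open>L2_set v {..<n}\<close>.\<close>

definition Rvec :: "nat \<Rightarrow> (nat \<Rightarrow> real) measure" where
  "Rvec n = (\<Pi>\<^sub>M i\<in>{..<n}. borel)"

definition std_gaussian :: "nat \<Rightarrow> (nat \<Rightarrow> real) measure" where
  "std_gaussian n = (\<Pi>\<^sub>M i\<in>{..<n}. density lborel (\<lambda>t. ennreal (std_normal_density t)))"

definition vec_shift :: "nat \<Rightarrow> (nat \<Rightarrow> real) \<Rightarrow> real \<Rightarrow> (nat \<Rightarrow> real) \<Rightarrow> nat \<Rightarrow> real" where
  "vec_shift n x b u = (\<lambda>j\<in>{..<n}. x j + b * u j)"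

definition gauss_smooth ::
    "nat \<Rightarrow> real \<Rightarrow> ((nat \<Rightarrow> real) \<Rightarrow> real) \<Rightarrow> (nat \<Rightarrow> real) \<Rightarrow> real" where
  "gauss_smooth n b g x = (\<integral>u. g (vec_shift n x b u) \<partial>std_gaussian n)"

definition grad :: "nat \<Rightarrow> ((nat \<Rightarrow> real) \<Rightarrow> real) \<Rightarrow> (nat \<Rightarrow> real) \<Rightarrow> nat \<Rightarrow> real" where
  "grad n g x = (\<lambda>j\<in>{..<n}. deriv (\<lambda>t. g (x(j := t))) (x j))"

definition mean_objective ::
    "'w measure \<Rightarrow> ('w \<Rightarrow> nat \<Rightarrow> real) \<Rightarrow> ((nat \<Rightarrow> real) \<Rightarrow> (nat \<Rightarrow> real) \<Rightarrow> real)
      \<Rightarrow> (nat \<Rightarrow> real) \<Rightarrow> real" where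
  "mean_objective \<Omega> \<xi> F x = (\<integral>\<omega>. F x (\<xi> \<omega>) \<partial>\<Omega>)"

text \<open>Borel measurability of each \<open>F x\<close> is what makes \<open>F\<close> evaluated at copies of \<open>\<xi>\<close> living on
  another space a random variable with the law of \<open>F x \<circ> \<xi>\<close>.\<close>

definition stochastic_lipschitz_objective ::
    "nat \<Rightarrow> nat \<Rightarrow> 'w measure \<Rightarrow> ('w \<Rightarrow> nat \<Rightarrow> real)
      \<Rightarrow> ((nat \<Rightarrow> real) \<Rightarrow> (nat \<Rightarrow> real) \<Rightarrow> real) \<Rightarrow> real \<Rightarrow> bool" where
  "stochastic_lipschitz_objective n m \<Omega> \<xi> F L0 \<longleftrightarrow>
     prob_space \<Omega> \<and> \<xi> \<in> measurable \<Omega> (Rvec m) \<and>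
     (\<forall>x\<in>space (Rvec n). F x \<in> borel_measurable (Rvec m)) \<and>
     (\<forall>x\<in>space (Rvec n). integrable \<Omega> (\<lambda>\<omega>. F x (\<xi> \<omega>))) \<and>
     L0 > 0 \<and>
     (\<forall>z\<in>space (Rvec m). \<forall>x\<in>space (Rvec n). \<forall>y\<in>space (Rvec n).
        \<bar>F x z - F y z\<bar> \<le> L0 * L2_set (\<lambda>j. x j - y j) {..<n})"

definition zo_estimate ::
    "nat \<Rightarrow> nat \<Rightarrow> ((nat \<Rightarrow> real) \<Rightarrow> (nat \<Rightarrow> real) \<Rightarrow> real) \<Rightarrow> real \<Rightarrow> (nat \<Rightarrow> real)
      \<Rightarrow> (nat \<Rightarrow> nat \<Rightarrow> real) \<Rightarrow> (nat \<Rightarrow> nat \<Rightarrow> real) \<Rightarrow> nat \<Rightarrow> real" where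
  "zo_estimate n q F b x u z =
     (\<lambda>i\<in>{..<n}. (1 / real q) *
        (\<Sum>j=1..q. u j i * (F (vec_shift n x b (u j)) (z j) - F x (z j)) / b))"

definition step_size :: "real \<Rightarrow> real \<Rightarrow> nat \<Rightarrow> real" where
  "step_size s a k = s / (real k + 1) powr a"

text \<open>State (iterate, momentum) of ZO-Signum for one realisation of the samples. Batch \<open>0\<close> of
  \<open>u\<close>, \<open>z\<close> produces the initial momentum, batch \<open>Suc k\<close> is the fresh one drawn in iteration \<open>k\<close>.\<close>

primrec zo_signum ::
    "nat \<Rightarrow> nat \<Rightarrow> ((nat \<Rightarrow> real) \<Rightarrow> (nat \<Rightarrow> real) \<Rightarrow> real) \<Rightarrow> real
      \<Rightarrow> (nat \<Rightarrow> real) \<Rightarrow> (nat \<Rightarrow> real) \<Rightarrow> (nat \<Rightarrow> real)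
      \<Rightarrow> (nat \<Rightarrow> nat \<Rightarrow> nat \<Rightarrow> real) \<Rightarrow> (nat \<Rightarrow> nat \<Rightarrow> nat \<Rightarrow> real)
      \<Rightarrow> nat \<Rightarrow> (nat \<Rightarrow> real) \<times> (nat \<Rightarrow> real)" where
  "zo_signum n q F b s1 s2 x0 u z 0 = (x0, zo_estimate n q F b x0 (u 0) (z 0))"
| "zo_signum n q F b s1 s2 x0 u z (Suc k) =
     (let (x, p) = zo_signum n q F b s1 s2 x0 u z k;
          g = zo_estimate n q F b x (u (Suc k)) (z (Suc k));
          p' = (\<lambda>j\<in>{..<n}. s2 k * g j + (1 - s2 k) * p j)
      in (\<lambda>j\<in>{..<n}. x j - s1 k * sgn (p' j), p'))"

text \<open>The pairs (direction, uncertainty) are mutually independent over all batches and all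
  positions in a batch; the product law says in addition that the two components of a pair are
  independent, the first Gaussian and the second a copy of \<open>\<xi>\<close>.\<close>

definition fresh_samples ::
    "'a measure \<Rightarrow> nat \<Rightarrow> nat \<Rightarrow> nat \<Rightarrow> 'w measure \<Rightarrow> ('w \<Rightarrow> nat \<Rightarrow> real)
      \<Rightarrow> (nat \<Rightarrow> nat \<Rightarrow> 'a \<Rightarrow> nat \<Rightarrow> real) \<Rightarrow> (nat \<Rightarrow> nat \<Rightarrow> 'a \<Rightarrow> nat \<Rightarrow> real) \<Rightarrow> bool" where
  "fresh_samples M n m q \<Omega> \<xi> U Z \<longleftrightarrow>
     prob_space M \<and>
     prob_space.indep_vars M (\<lambda>_. Rvec n \<Otimes>\<^sub>M Rvec m) (\<lambda>(k, j) \<omega>. (U k j \<omega>, Z k j \<omega>))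
       (UNIV \<times> {1..q}) \<and>
     (\<forall>k. \<forall>j\<in>{1..q}. distr M (Rvec n \<Otimes>\<^sub>M Rvec m) (\<lambda>\<omega>. (U k j \<omega>, Z k j \<omega>)) =
        std_gaussian n \<Otimes>\<^sub>M distr \<Omega> (Rvec m) \<xi>)"

definition independent_uniform_index ::
    "'a measure \<Rightarrow> nat \<Rightarrow> nat \<Rightarrow> nat
      \<Rightarrow> (nat \<Rightarrow> nat \<Rightarrow> 'a \<Rightarrow> nat \<Rightarrow> real) \<Rightarrow> (nat \<Rightarrow> nat \<Rightarrow> 'a \<Rightarrow> nat \<Rightarrow> real)
      \<Rightarrow> nat set \<Rightarrow> ('a \<Rightarrow> nat) \<Rightarrow> bool" where
  "independent_uniform_index M n m q U Z I R \<longleftrightarrow>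
     distr M (count_space UNIV) R = measure_pmf (pmf_of_set I) \<and>
     prob_space.indep_set M
       (sets (vimage_algebra (space M) R (count_space UNIV)))
       (sets (vimage_algebra (space M) (\<lambda>\<omega>. \<lambda>(k, j)\<in>UNIV \<times> {1..q}. (U k j \<omega>, Z k j \<omega>))
          (\<Pi>\<^sub>M _\<in>UNIV \<times> {1..q}. Rvec n \<Otimes>\<^sub>M Rvec m)))"

definition burn_in_index :: "real \<Rightarrow> real \<Rightarrow> real \<Rightarrow> nat \<Rightarrow> bool" where
  "burn_in_index s a1 a2 k \<longleftrightarrow>
     real k / (real k + 1) powr a2 \<ge> (ln s + (1 + a2) * ln (real k)) / s \<and>
     real k / (real k + 1) powr a2 \<ge> 2 * (ln s + (1 + a1 - a2) * ln (real k)) / s"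

end

(*
  Write g for the gradient of the smoothed objective and e(k) = m(k+1) - g(x(k)) for the momentum
  error. Since |g_j| - g_j sign(m_j) <= 2 |g_j - m_j|, one step decreases the smoothed objective by
  s1(k) |g(x(k))|_1, up to 2 s1(k) |e(k)|_1 and a second-order term of size n s1(k)^2. The fresh
  estimate is conditionally unbiased for g(x(k)) with second moment O(n^2), and g is Lipschitz, so
  V(k) = E |e(k)|^2 obeys V(k+1) <= (1 - s2(k+1)) V(k) + O(n^2 / k), whence V(k) = O(n^2 / sqrt k).
  Summing the descent inequality over [C, K] leaves sum_k s1(k) E |g(x(k))| <= D + O(n^(3/4)) ln K,
  and s1(k) >= s1(K) on that range.

  The smoothed objective is handled through the Cameron-Martin formula: translating the Gaussian
  by v multiplies its density by exp(<v,u> - |v|^2/2), and the first-order part 1 + <v,u> of this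
  factor gives the gradient E[u (f(x + b u) - f(x))] / b.
*)

theory Submission
  imports Defs
begin

section \<open>Gaussian vectors\<close>

text \<open>The mean objective is merely Lipschitz, so derivatives have to fall on the Gaussian
  density. What is left of exp(<v,u> - |v|^2/2) beyond first order has an L2 norm of order |v|^2 for
  small v; paired with the increment of f, at most L b |u|, it gives a Taylor expansion with
  quadratic error although f itself need not be differentiable.

  Conditional expectations are replaced by Fubini: the state after k steps is a measurable function
  of the batches up to k, the next batch is independent of these, so the state can be frozen while
  the batch is integrated. Nonnegative integrals are used throughout, so that finiteness of V(k) is
  a result of the recursion and not a prerequisite.

  The exponents come from a balance. In 2 |e_j| <= theta e_j^2 + 1/theta the weight theta(k) =
  (k+1)^(1/4) / sqrt n makes both sides, summed over j, of order n^(3/2) (k+1)^(-1/4). Times s1(k)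
  this is n^(3/4) / (k+1), whose sum is the logarithm; dividing by s1(K) and by the number of
  indices gives n^(3/2) K^(-1/4) ln K.\<close>

lemma space_Rvec: "space (Rvec n) = {..<n} \<rightarrow>\<^sub>E UNIV"
  by (simp add: Rvec_def space_PiM)

lemma measurable_Rvec_component [measurable (raw)]:
  "f \<in> M \<rightarrow>\<^sub>M Rvec n \<Longrightarrow> i < n \<Longrightarrow> (\<lambda>\<omega>. f \<omega> i) \<in> borel_measurable M"
  unfolding Rvec_def by (rule measurable_compose[OF _ measurable_component_singleton]) auto

lemma measurable_Rvec_lambda:
  "(\<And>i. i < n \<Longrightarrow> (\<lambda>\<omega>. f \<omega> i) \<in> borel_measurable M) \<Longrightarrow> (\<lambda>\<omega>. \<lambda>i\<in>{..<n}. f \<omega> i) \<in> M \<rightarrow>\<^sub>M Rvec n"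
  unfolding Rvec_def by (rule measurable_restrict) auto

lemma sets_std_gaussian [measurable_cong, simp]: "sets (std_gaussian n) = sets (Rvec n)"
  unfolding std_gaussian_def Rvec_def by (rule sets_PiM_cong) auto

lemma space_std_gaussian [simp]: "space (std_gaussian n) = space (Rvec n)"
  by (rule sets_eq_imp_space_eq) simp

lemma prob_space_std_normal_distribution: "prob_space std_normal_distribution"
  by (simp add: prob_space_normal_density)

lemma prob_space_std_gaussian: "prob_space (std_gaussian n)"
  unfolding std_gaussian_def by (intro prob_space_PiM prob_space_std_normal_distribution)

lemma distr_std_gaussian_component:
  "i < n \<Longrightarrow> distr (std_gaussian n) borel (\<lambda>u. u i) = std_normal_distribution"
  using distr_PiM_component[of "{..<n}" "\<lambda>_. std_normal_distribution" i]
  by (simp add: std_gaussian_def prob_space_std_normal_distribution cong: distr_cong)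

lemma vec_shift_in_space: "vec_shift n x b u \<in> space (Rvec n)"
  by (auto simp: vec_shift_def space_Rvec)

lemma measurable_vec_shift [measurable (raw)]:
  assumes [measurable]: "f \<in> M \<rightarrow>\<^sub>M Rvec n" "g \<in> M \<rightarrow>\<^sub>M Rvec n"
  shows "(\<lambda>\<omega>. vec_shift n (f \<omega>) b (g \<omega>)) \<in> M \<rightarrow>\<^sub>M Rvec n"
  unfolding vec_shift_def by (rule measurable_Rvec_lambda) measurable

lemma measurable_vec_shift_const [measurable (raw)]:
  assumes [measurable]: "f \<in> M \<rightarrow>\<^sub>M Rvec n"
  shows "(\<lambda>\<omega>. vec_shift n (f \<omega>) b v) \<in> M \<rightarrow>\<^sub>M Rvec n"
  unfolding vec_shift_def by (rule measurable_Rvec_lambda) measurable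

section \<open>Translation of the Gaussian measure\<close>

text \<open>Completing the square: the density at \<open>t - v\<close> is the density at
  \<open>t\<close> times \<open>exp (v * t - v\<^sup>2 / 2)\<close>.\<close>

lemma distr_std_normal_shift:
  "distr std_normal_distribution borel (\<lambda>t. t + v) =
     density std_normal_distribution (\<lambda>t. ennreal (exp (v * t - v\<^sup>2 / 2)))"
proof (rule measure_eqI)
  fix A assume A: "A \<in> sets (distr std_normal_distribution borel (\<lambda>t. t + v))"
  then have [measurable]: "A \<in> sets borel" by simp
  have "emeasure (distr std_normal_distribution borel (\<lambda>t. t + v)) A =
        (\<integral>\<^sup>+t. ennreal (std_normal_density t) * indicator A (t + v) \<partial>lborel)"
    using measurable_sets_borel[of "\<lambda>t. t + v" borel A]
    by (subst emeasure_distr) (auto simp: emeasure_density intro!: nn_integral_cong split: split_indicator)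
  also have "\<dots> = (\<integral>\<^sup>+t. ennreal (std_normal_density (t - v)) * indicator A t \<partial>lborel)"
    by (subst (2) nn_integral_real_affine[where c=1 and t=v]) (auto simp: add.commute)
  also have "\<dots> = (\<integral>\<^sup>+t. ennreal (std_normal_density t) * (ennreal (exp (v * t - v\<^sup>2 / 2)) * indicator A t) \<partial>lborel)"
    by (intro nn_integral_cong)
       (auto simp: std_normal_density_def ennreal_mult'[symmetric] exp_add[symmetric] power2_eq_square
          field_simps split: split_indicator)
  also have "\<dots> = emeasure (density std_normal_distribution (\<lambda>t. ennreal (exp (v * t - v\<^sup>2 / 2)))) A"
    by (auto simp: emeasure_density nn_integral_density)
  finally show "emeasure (distr std_normal_distribution borel (\<lambda>t. t + v)) A =
    emeasure (density std_normal_distribution (\<lambda>t. ennreal (exp (v * t - v\<^sup>2 / 2)))) A" .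
qed simp

text \<open>Both sides are the product measure with the translated factors \<open>N i\<close>, and a
  product measure is determined by its values on boxes. On a box the exponential splits into one
  factor per coordinate, which leaves the one-dimensional formula.\<close>

lemma distr_std_gaussian_shift:
  "distr (std_gaussian n) (Rvec n) (\<lambda>u. vec_shift n u 1 v) =
     density (std_gaussian n) (\<lambda>u. ennreal (exp ((\<Sum>i<n. v i * u i) - (\<Sum>i<n. (v i)\<^sup>2) / 2)))"
proof -
  define N where "N = (\<lambda>i. distr std_normal_distribution borel (\<lambda>t. t + v i))"
  interpret G: product_sigma_finite "\<lambda>_. std_normal_distribution"
    by (intro product_sigma_finite.intro prob_space_imp_sigma_finite prob_space_std_normal_distribution)
  have pN: "prob_space (N i)" for i
    unfolding N_def by (intro prob_space.prob_space_distr prob_space_std_normal_distribution) auto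
  interpret N: product_sigma_finite N
    by (intro product_sigma_finite.intro prob_space_imp_sigma_finite pN)
  have sN: "sets (PiM {..<n} N) = sets (Rvec n)"
    unfolding Rvec_def by (rule sets_PiM_cong) (auto simp: N_def)
  have "distr (std_gaussian n) (Rvec n) (\<lambda>u. vec_shift n u 1 v) = PiM {..<n} N"
  proof (rule N.PiM_eqI)
    fix A assume "\<And>i. i \<in> {..<n} \<Longrightarrow> A i \<in> sets (N i)"
    then have A [measurable]: "i < n \<Longrightarrow> A i \<in> sets borel" for i by (auto simp: N_def)
    have "Pi\<^sub>E {..<n} A \<in> sets (Rvec n)"
      unfolding Rvec_def by (intro sets_PiM_I_finite) auto
    then have "emeasure (distr (std_gaussian n) (Rvec n) (\<lambda>u. vec_shift n u 1 v)) (Pi\<^sub>E {..<n} A) =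
        emeasure (std_gaussian n) ((\<lambda>u. vec_shift n u 1 v) -` Pi\<^sub>E {..<n} A \<inter> space (std_gaussian n))"
      by (intro emeasure_distr) measurable
    also have "(\<lambda>u. vec_shift n u 1 v) -` Pi\<^sub>E {..<n} A \<inter> space (std_gaussian n) =
        (\<Pi>\<^sub>E i\<in>{..<n}. (\<lambda>t. t + v i) -` A i)"
      by (auto simp: vec_shift_def space_Rvec PiE_iff)
    also have "emeasure (std_gaussian n) \<dots> = (\<Prod>i<n. emeasure std_normal_distribution ((\<lambda>t. t + v i) -` A i))"
      unfolding std_gaussian_def
      by (subst G.emeasure_PiM) (auto intro!: measurable_sets_borel[OF _ A])
    also have "\<dots> = (\<Prod>i<n. emeasure (N i) (A i))"
      unfolding N_def by (intro prod.cong refl) (auto simp: emeasure_distr)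
    finally show "emeasure (distr (std_gaussian n) (Rvec n) (\<lambda>u. vec_shift n u 1 v)) (Pi\<^sub>E {..<n} A) =
      (\<Prod>i<n. emeasure (N i) (A i))" .
  qed (auto simp: sN)
  also have "PiM {..<n} N =
      density (std_gaussian n) (\<lambda>u. ennreal (exp ((\<Sum>i<n. v i * u i) - (\<Sum>i<n. (v i)\<^sup>2) / 2)))"
  proof (rule N.PiM_eqI[symmetric])
    fix A assume "\<And>i. i \<in> {..<n} \<Longrightarrow> A i \<in> sets (N i)"
    then have A [measurable]: "i < n \<Longrightarrow> A i \<in> sets borel" for i by (auto simp: N_def)
    \<comment> \<open>Only for points of the space: membership in the box includes extensionality of
      \<open>u\<close>.\<close>
    have *: "indicator (Pi\<^sub>E {..<n} A) u = (\<Prod>i<n. indicator (A i) (u i) :: ennreal)"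
      if "u \<in> space (Rvec n)" for u
      using that by (auto simp: indicator_def space_Rvec PiE_iff intro!: prod_zero)
    have E: "Pi\<^sub>E {..<n} A \<in> sets (Rvec n)"
      unfolding Rvec_def by (intro sets_PiM_I_finite) auto
    have "emeasure (density (std_gaussian n) (\<lambda>u. ennreal (exp ((\<Sum>i<n. v i * u i) - (\<Sum>i<n. (v i)\<^sup>2) / 2)))) (Pi\<^sub>E {..<n} A)
       = (\<integral>\<^sup>+u. ennreal (exp ((\<Sum>i<n. v i * u i) - (\<Sum>i<n. (v i)\<^sup>2) / 2)) * indicator (Pi\<^sub>E {..<n} A) u \<partial>std_gaussian n)"
      using E by (intro emeasure_density) (measurable, auto)
    also have "\<dots> = (\<integral>\<^sup>+u. (\<Prod>i<n. ennreal (exp (v i * u i - (v i)\<^sup>2 / 2)) * indicator (A i) (u i)) \<partial>std_gaussian n)"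
      by (intro nn_integral_cong)
         (auto simp: * prod.distrib prod_ennreal exp_sum[symmetric] sum_subtractf sum_divide_distrib)
    also have "\<dots> = (\<Prod>i<n. \<integral>\<^sup>+t. ennreal (exp (v i * t - (v i)\<^sup>2 / 2)) * indicator (A i) t \<partial>std_normal_distribution)"
      unfolding std_gaussian_def by (rule G.product_nn_integral_prod) auto
    also have "\<dots> = (\<Prod>i<n. emeasure (N i) (A i))"
      unfolding N_def distr_std_normal_shift
      by (intro prod.cong refl) (auto simp: emeasure_density)
    finally show "emeasure (density (std_gaussian n) (\<lambda>u. ennreal (exp ((\<Sum>i<n. v i * u i) - (\<Sum>i<n. (v i)\<^sup>2) / 2)))) (Pi\<^sub>E {..<n} A)
       = (\<Prod>i<n. emeasure (N i) (A i))" .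
  qed (auto simp: sN)
  finally show ?thesis .
qed


text \<open>The integrability half carries integrability from the translated function, where a
  growth bound is at hand, to the product with the exponential.\<close>

lemma std_gaussian_shift:
  fixes h :: "(nat \<Rightarrow> real) \<Rightarrow> real"
  assumes [measurable]: "h \<in> borel_measurable (Rvec n)"
  shows integrable_std_gaussian_shift_iff: "integrable (std_gaussian n) (\<lambda>u. h (vec_shift n u 1 v)) \<longleftrightarrow>
      integrable (std_gaussian n) (\<lambda>u. exp ((\<Sum>i<n. v i * u i) - (\<Sum>i<n. (v i)\<^sup>2) / 2) * h u)"
    and integral_std_gaussian_shift: "(\<integral>u. h (vec_shift n u 1 v) \<partial>std_gaussian n) =
      (\<integral>u. exp ((\<Sum>i<n. v i * u i) - (\<Sum>i<n. (v i)\<^sup>2) / 2) * h u \<partial>std_gaussian n)"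
proof -
  have "integrable (std_gaussian n) (\<lambda>u. h (vec_shift n u 1 v)) \<longleftrightarrow>
      integrable (distr (std_gaussian n) (Rvec n) (\<lambda>u. vec_shift n u 1 v)) h"
    by (rule integrable_distr_eq[symmetric]) measurable
  then show "integrable (std_gaussian n) (\<lambda>u. h (vec_shift n u 1 v)) \<longleftrightarrow>
      integrable (std_gaussian n) (\<lambda>u. exp ((\<Sum>i<n. v i * u i) - (\<Sum>i<n. (v i)\<^sup>2) / 2) * h u)"
    by (simp add: distr_std_gaussian_shift integrable_density)
  have "(\<integral>u. h (vec_shift n u 1 v) \<partial>std_gaussian n) =
      integral\<^sup>L (distr (std_gaussian n) (Rvec n) (\<lambda>u. vec_shift n u 1 v)) h"
    by (rule integral_distr[symmetric]) measurable
  then show "(\<integral>u. h (vec_shift n u 1 v) \<partial>std_gaussian n) =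
      (\<integral>u. exp ((\<Sum>i<n. v i * u i) - (\<Sum>i<n. (v i)\<^sup>2) / 2) * h u \<partial>std_gaussian n)"
    by (simp add: distr_std_gaussian_shift integral_density)
qed

section \<open>Moments of the Gaussian vector\<close>

lemma std_gaussian_component:
  fixes h :: "real \<Rightarrow> real"
  assumes [measurable]: "h \<in> borel_measurable borel" and i [measurable]: "i < n"
  shows integrable_std_gaussian_component: "integrable (std_gaussian n) (\<lambda>u. h (u i)) \<longleftrightarrow>
      integrable lborel (\<lambda>t. std_normal_density t * h t)"
    and integral_std_gaussian_component: "(\<integral>u. h (u i) \<partial>std_gaussian n) =
      (\<integral>t. std_normal_density t * h t \<partial>lborel)"
proof -
  have "integrable (std_gaussian n) (\<lambda>u. h (u i)) \<longleftrightarrow>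
      integrable (distr (std_gaussian n) borel (\<lambda>u. u i)) h"
    by (rule integrable_distr_eq[symmetric]) (use i in measurable)
  then show "integrable (std_gaussian n) (\<lambda>u. h (u i)) \<longleftrightarrow>
      integrable lborel (\<lambda>t. std_normal_density t * h t)"
    by (simp add: distr_std_gaussian_component[OF i] integrable_density)
  have "(\<integral>u. h (u i) \<partial>std_gaussian n) = integral\<^sup>L (distr (std_gaussian n) borel (\<lambda>u. u i)) h"
    by (rule integral_distr[symmetric]) (use i in measurable)
  then show "(\<integral>u. h (u i) \<partial>std_gaussian n) = (\<integral>t. std_normal_density t * h t \<partial>lborel)"
    by (simp add: distr_std_gaussian_component[OF i] integral_density)
qed

lemma integrable_std_gaussian_power: "i < n \<Longrightarrow> integrable (std_gaussian n) (\<lambda>u. u i ^ k)"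
  using integrable_std_gaussian_component[of "\<lambda>t. t ^ k"] integrable_std_normal_moment by simp

lemma std_gaussian_moments:
  assumes "i < n"
  shows "(\<integral>u. u i \<partial>std_gaussian n) = 0" "(\<integral>u. (u i)\<^sup>2 \<partial>std_gaussian n) = 1"
    "(\<integral>u. u i ^ 4 \<partial>std_gaussian n) = 3"
  using assms integral_std_gaussian_component[of "\<lambda>t. t" i n] integral_std_normal_moment_odd[of 0]
    integral_std_gaussian_component[of "\<lambda>t. t\<^sup>2" i n] integral_std_normal_moment_even[of 1]
    integral_std_gaussian_component[of "\<lambda>t. t ^ 4" i n] integral_std_normal_moment_even[of 2]
  by (simp_all add: fact_numeral)

lemma std_gaussian_uncorrelated:
  assumes "i < n" "j < n" "i \<noteq> j"
  shows "has_bochner_integral (std_gaussian n) (\<lambda>u. u i * u j) 0"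
proof -
  interpret G: product_sigma_finite "\<lambda>_. std_normal_distribution"
    by (intro product_sigma_finite.intro prob_space_imp_sigma_finite prob_space_std_normal_distribution)
  interpret N: prob_space std_normal_distribution
    by (rule prob_space_std_normal_distribution)
  define f where "f = (\<lambda>k t. if k = i \<or> k = j then t else 1 :: real)"
  have f: "integrable std_normal_distribution (f k)" for k
    using integrable_std_normal_moment[of 1] integrable_std_normal_moment[of 0]
    by (cases "k = i \<or> k = j") (auto simp: f_def integrable_density)
  have z: "integral\<^sup>L std_normal_distribution (f i) = 0"
    using integral_std_normal_moment_odd[of 0] by (simp add: f_def integral_density)
  have *: "(\<Prod>k<n. f k (u k)) = u i * u j" for u
  proof -
    have "(\<Prod>k<n. f k (u k)) = (\<Prod>k\<in>{i, j}. f k (u k))"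
      using assms by (intro prod.mono_neutral_right) (auto simp: f_def)
    then show ?thesis using assms by (simp add: f_def)
  qed
  have "integrable (std_gaussian n) (\<lambda>u. \<Prod>k<n. f k (u k))"
    unfolding std_gaussian_def by (rule G.product_integrable_prod) (auto intro: f)
  moreover have "(\<integral>u. (\<Prod>k<n. f k (u k)) \<partial>std_gaussian n) = (\<Prod>k<n. integral\<^sup>L std_normal_distribution (f k))"
    unfolding std_gaussian_def by (rule G.product_integral_prod) (auto intro: f)
  moreover have "(\<Prod>k<n. integral\<^sup>L std_normal_distribution (f k)) = 0"
    using assms z by (intro prod_zero) auto
  ultimately show ?thesis
    by (simp add: * has_bochner_integral_iff)
qed

text \<open>The coordinates are orthonormal, so expanding the square leaves only the
  diagonal.\<close>

lemma std_gaussian_inner: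
  fixes v :: "nat \<Rightarrow> real"
  shows integrable_std_gaussian_inner: "integrable (std_gaussian n) (\<lambda>u. \<Sum>i<n. v i * u i)"
    and integral_std_gaussian_inner: "(\<integral>u. (\<Sum>i<n. v i * u i) \<partial>std_gaussian n) = 0"
    and integrable_std_gaussian_inner_square: "integrable (std_gaussian n) (\<lambda>u. (\<Sum>i<n. v i * u i)\<^sup>2)"
    and integral_std_gaussian_inner_square:
      "(\<integral>u. (\<Sum>i<n. v i * u i)\<^sup>2 \<partial>std_gaussian n) = (\<Sum>i<n. (v i)\<^sup>2)"
proof -
  have i1: "integrable (std_gaussian n) (\<lambda>u. u i)" if "i < n" for i
    using integrable_std_gaussian_power[OF that, of 1] by simp
  then show "integrable (std_gaussian n) (\<lambda>u. \<Sum>i<n. v i * u i)" by auto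
  show "(\<integral>u. (\<Sum>i<n. v i * u i) \<partial>std_gaussian n) = 0"
    using i1 by (simp add: std_gaussian_moments)
  have b: "has_bochner_integral (std_gaussian n) (\<lambda>u. u i * u j) (if i = j then 1 else 0)"
    if "i < n" "j < n" for i j
    using std_gaussian_uncorrelated[OF that] integrable_std_gaussian_power[OF that(1), of 2]
      std_gaussian_moments(2)[OF that(1)] by (auto simp: has_bochner_integral_iff power2_eq_square)
  have "has_bochner_integral (std_gaussian n) (\<lambda>u. \<Sum>i<n. \<Sum>j<n. v i * v j * (u i * u j))
     (\<Sum>i<n. \<Sum>j<n. v i * v j * (if i = j then 1 else 0))"
    by (intro has_bochner_integral_sum has_bochner_integral_mult_right b) auto
  moreover have "(\<Sum>i<n. v i * u i)\<^sup>2 = (\<Sum>i<n. \<Sum>j<n. v i * v j * (u i * u j))" for u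
    by (simp add: power2_eq_square sum_product mult_ac)
  moreover have "(\<Sum>i<n. \<Sum>j<n. v i * v j * (if i = j then 1 else 0)) = (\<Sum>i<n. (v i)\<^sup>2)"
    by (simp add: power2_eq_square if_distrib cong: if_cong)
  ultimately show "integrable (std_gaussian n) (\<lambda>u. (\<Sum>i<n. v i * u i)\<^sup>2)"
    "(\<integral>u. (\<Sum>i<n. v i * u i)\<^sup>2 \<partial>std_gaussian n) = (\<Sum>i<n. (v i)\<^sup>2)"
    by (simp_all add: has_bochner_integral_iff)
qed

lemma std_gaussian_norm:
  shows integrable_std_gaussian_square_norm: "integrable (std_gaussian n) (\<lambda>u. (L2_set u {..<n})\<^sup>2)"
    and integral_std_gaussian_square_norm: "(\<integral>u. (L2_set u {..<n})\<^sup>2 \<partial>std_gaussian n) = n"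
    and integrable_std_gaussian_norm_power4: "integrable (std_gaussian n) (\<lambda>u. (L2_set u {..<n}) ^ 4)"
    and integral_std_gaussian_norm_power4_le: "(\<integral>u. (L2_set u {..<n}) ^ 4 \<partial>std_gaussian n) \<le> 3 * (real n)\<^sup>2"
proof -
  have sq: "(L2_set u {..<n})\<^sup>2 = (\<Sum>i<n. (u i)\<^sup>2)" for u
    by (simp add: L2_set_def sum_nonneg)
  have "integrable (std_gaussian n) (\<lambda>u. \<Sum>i<n. (u i)\<^sup>2)"
    by (intro Bochner_Integration.integrable_sum) (auto simp: integrable_std_gaussian_power)
  then show "integrable (std_gaussian n) (\<lambda>u. (L2_set u {..<n})\<^sup>2)"
    "(\<integral>u. (L2_set u {..<n})\<^sup>2 \<partial>std_gaussian n) = n"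
    by (simp_all add: sq integrable_std_gaussian_power std_gaussian_moments)
  \<comment> \<open>Cauchy-Schwarz against the constant 1. It keeps the order in \<open>n\<close>:
    the exact fourth moment of the norm is n^2 + 2 n.\<close>
  have le: "(L2_set u {..<n}) ^ 4 \<le> n * (\<Sum>i<n. u i ^ 4)" for u :: "nat \<Rightarrow> real"
  proof -
    have "(L2_set u {..<n}) ^ 4 = (\<Sum>i<n. (u i)\<^sup>2)\<^sup>2"
      by (simp flip: sq)
    also have "\<dots> \<le> (\<Sum>i<n. ((u i)\<^sup>2)\<^sup>2) * n"
      using sum_squared_le_sum_of_squares[where I = "{..<n}" and f = "\<lambda>i. (u i)\<^sup>2"] by simp
    finally show ?thesis by (simp add: mult.commute)
  qed
  have i: "integrable (std_gaussian n) (\<lambda>u. n * (\<Sum>i<n. u i ^ 4))"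
    by (auto intro: integrable_std_gaussian_power)
  have [measurable]: "(\<lambda>u. L2_set u {..<n}) \<in> borel_measurable (Rvec n)"
    unfolding L2_set_def by measurable
  show i4: "integrable (std_gaussian n) (\<lambda>u. (L2_set u {..<n}) ^ 4)"
  proof (rule Bochner_Integration.integrable_bound[OF i])
    show "AE u in std_gaussian n. norm ((L2_set u {..<n}) ^ 4) \<le> norm (real n * (\<Sum>i<n. u i ^ 4))"
      using le by (intro AE_I2) (simp add: sum_nonneg)
  qed measurable
  have "(\<integral>u. (L2_set u {..<n}) ^ 4 \<partial>std_gaussian n) \<le> (\<integral>u. n * (\<Sum>i<n. u i ^ 4) \<partial>std_gaussian n)"
    by (rule integral_mono[OF i4 i]) (rule le)
  also have "\<dots> = 3 * (real n)\<^sup>2"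
    by (simp add: integrable_std_gaussian_power std_gaussian_moments power2_eq_square)
  finally show "(\<integral>u. (L2_set u {..<n}) ^ 4 \<partial>std_gaussian n) \<le> 3 * (real n)\<^sup>2" .
qed

text \<open>This is the squared norm of the part of order at least two in the Hermite expansion of
  the exponential.\<close>

lemma std_gaussian_exp_remainder:
  fixes v :: "nat \<Rightarrow> real" and n :: nat
  defines "s \<equiv> \<Sum>i<n. (v i)\<^sup>2"
  defines "W \<equiv> \<lambda>u. \<Sum>i<n. v i * u i"
  shows "has_bochner_integral (std_gaussian n) (\<lambda>u. (exp (W u - s / 2) - 1 - W u)\<^sup>2) (exp s - 1 - s)"
proof -
  interpret prob_space "std_gaussian n" by (rule prob_space_std_gaussian)
  note prob_space = prob_space[simplified]
  have [measurable]: "W \<in> borel_measurable (Rvec n)" unfolding W_def by measurable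
  have "integrable (std_gaussian n) (\<lambda>u. exp (W u - s / 2) * 1)"
    unfolding W_def s_def by (subst integrable_std_gaussian_shift_iff[symmetric]) auto
  moreover have "(\<integral>u. exp (W u - s / 2) * 1 \<partial>std_gaussian n) = 1"
    unfolding W_def s_def by (subst integral_std_gaussian_shift[symmetric]) (auto simp: prob_space)
  ultimately have E: "has_bochner_integral (std_gaussian n) (\<lambda>u. exp (W u - s / 2)) 1"
    by (simp add: has_bochner_integral_iff)
  have Wu: "(\<Sum>i<n. v i * u i) = W u" for u by (simp add: W_def)
  \<comment> \<open>Translation by \<open>v\<close> raises \<open>W\<close> by \<open>s\<close>, so
    integrals against the exponential become moments of \<open>W + s\<close>.\<close>
  have Wsh: "W (vec_shift n u 1 v) = W u + s" for u
    by (simp add: W_def vec_shift_def s_def power2_eq_square algebra_simps sum.distrib)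
  have Wi: "integrable (std_gaussian n) W" "integral\<^sup>L (std_gaussian n) W = 0"
    unfolding W_def by (rule std_gaussian_inner)+
  have "integrable (std_gaussian n) (\<lambda>u. exp (W u - s / 2) * W u)"
    using integrable_std_gaussian_shift_iff[of W n v] Wi by (simp add: Wsh Wu s_def[symmetric])
  moreover have "(\<integral>u. exp (W u - s / 2) * W u \<partial>std_gaussian n) = s"
    using integral_std_gaussian_shift[of W n v] Wi by (simp add: Wsh Wu s_def[symmetric] prob_space)
  ultimately have EW: "has_bochner_integral (std_gaussian n) (\<lambda>u. exp (W u - s / 2) * W u) s"
    by (simp add: has_bochner_integral_iff)
  \<comment> \<open>The square of the exponential is \<open>exp (2 * W u - 2 * s) * exp s\<close>,
    and its first factor is the density of the translation by \<open>2 v\<close>, of total mass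
    1.\<close>
  let ?v2 = "\<lambda>i. 2 * v i"
  have W2: "(\<Sum>i<n. ?v2 i * u i) - (\<Sum>i<n. (?v2 i)\<^sup>2) / 2 = 2 * W u - 2 * s" for u
    by (simp add: W_def s_def sum_distrib_left power_mult_distrib mult.assoc sum_divide_distrib)
  have "integrable (std_gaussian n) (\<lambda>u. exp (2 * W u - 2 * s) * exp s)"
    unfolding W2[symmetric] by (subst integrable_std_gaussian_shift_iff[symmetric]) auto
  moreover have "(\<integral>u. exp (2 * W u - 2 * s) * exp s \<partial>std_gaussian n) = exp s"
    unfolding W2[symmetric] by (subst integral_std_gaussian_shift[symmetric]) (auto simp: prob_space)
  moreover have "exp (2 * W u - 2 * s) * exp s = (exp (W u - s / 2))\<^sup>2" for u
    by (simp add: exp_add[symmetric] power2_eq_square)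
  ultimately have E2: "has_bochner_integral (std_gaussian n) (\<lambda>u. (exp (W u - s / 2))\<^sup>2) (exp s)"
    by (simp add: has_bochner_integral_iff)
  have W1: "has_bochner_integral (std_gaussian n) W 0"
    using Wi by (simp add: has_bochner_integral_iff)
  have Wsq: "has_bochner_integral (std_gaussian n) (\<lambda>u. (W u)\<^sup>2) s"
    using integrable_std_gaussian_inner_square integral_std_gaussian_inner_square
    unfolding W_def s_def by (simp add: has_bochner_integral_iff)
  have c: "has_bochner_integral (std_gaussian n) (\<lambda>u. 1) (1::real)"
    by (simp add: has_bochner_integral_iff prob_space)
  have "has_bochner_integral (std_gaussian n)
      (\<lambda>u. (exp (W u - s / 2))\<^sup>2 + 1 + (W u)\<^sup>2 - 2 * exp (W u - s / 2) - 2 * (exp (W u - s / 2) * W u) + 2 * W u)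
      (exp s + 1 + s - 2 * 1 - 2 * s + 2 * 0)"
    by (intro has_bochner_integral_add has_bochner_integral_diff has_bochner_integral_mult_right E E2 EW W1 Wsq c) 
  then show ?thesis
    by (simp add: power2_eq_square algebra_simps)
qed

section \<open>Gaussian smoothing of a Lipschitz function\<close>

text \<open>The comparison is made between extended nonnegative integrals. Integrability of the
  product is settled beforehand from
  \<open>2 * \<bar>a * b\<bar> \<le> a\<^sup>2 + b\<^sup>2\<close>; without it the real integral
  could be the default value 0.\<close>

lemma Cauchy_Schwarz_integral:
  fixes f g :: "'a \<Rightarrow> real"
  assumes [measurable]: "f \<in> borel_measurable M" "g \<in> borel_measurable M"
    and f: "integrable M (\<lambda>x. (f x)\<^sup>2)" and g: "integrable M (\<lambda>x. (g x)\<^sup>2)"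
  shows "integrable M (\<lambda>x. f x * g x)"
    and "(\<integral>x. \<bar>f x * g x\<bar> \<partial>M) \<le> sqrt (\<integral>x. (f x)\<^sup>2 \<partial>M) * sqrt (\<integral>x. (g x)\<^sup>2 \<partial>M)"
proof -
  have "2 * \<bar>f x * g x\<bar> \<le> (f x)\<^sup>2 + (g x)\<^sup>2" for x
    using sum_squares_bound[of "\<bar>f x\<bar>" "\<bar>g x\<bar>"] by (simp add: abs_mult mult.assoc)
  then have "\<bar>f x * g x\<bar> \<le> (f x)\<^sup>2 + (g x)\<^sup>2" for x
    by (smt (verit) abs_ge_zero)
  then show i: "integrable M (\<lambda>x. f x * g x)"
    by (intro Bochner_Integration.integrable_bound[OF Bochner_Integration.integrable_add[OF f g]]) auto
  have "(ennreal (\<integral>x. \<bar>f x * g x\<bar> \<partial>M))\<^sup>2 = (\<integral>\<^sup>+x. ennreal (abs (f x)) * ennreal (abs (g x)) \<partial>M)\<^sup>2"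
    using integrable_abs[OF i] by (subst nn_integral_eq_integral[symmetric]) (auto simp: ennreal_mult abs_mult)
  also have "\<dots> \<le> (\<integral>\<^sup>+x. (ennreal (abs (f x)))\<^sup>2 \<partial>M) * (\<integral>\<^sup>+x. (ennreal (abs (g x)))\<^sup>2 \<partial>M)"
    by (rule Cauchy_Schwarz_nn_integral) auto
  also have "\<dots> = ennreal ((\<integral>x. (f x)\<^sup>2 \<partial>M) * (\<integral>x. (g x)\<^sup>2 \<partial>M))"
    using f g by (simp add: ennreal_power nn_integral_eq_integral ennreal_mult)
  finally have "(\<integral>x. \<bar>f x * g x\<bar> \<partial>M)\<^sup>2 \<le> (\<integral>x. (f x)\<^sup>2 \<partial>M) * (\<integral>x. (g x)\<^sup>2 \<partial>M)"
    by (simp add: ennreal_power)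
  then show "(\<integral>x. \<bar>f x * g x\<bar> \<partial>M) \<le> sqrt (\<integral>x. (f x)\<^sup>2 \<partial>M) * sqrt (\<integral>x. (g x)\<^sup>2 \<partial>M)"
    by (simp add: real_sqrt_mult[symmetric] real_le_rsqrt)
qed

text \<open>A consequence of \<open>1 - s \<le> exp (- s)\<close>, used twice. The square on the
  right survives the root in Cauchy-Schwarz and makes the remainder quadratic in the
  displacement.\<close>

lemma exp_remainder_le:
  assumes "0 \<le> (s::real)" shows "exp s - 1 - s \<le> s\<^sup>2 * exp s"
proof -
  have "(1 - s) * exp s \<le> exp (- s) * exp s"
    using exp_ge_add_one_self[of "- s"] by (intro mult_right_mono) auto
  then have 1: "exp s - 1 \<le> s * exp s" by (simp add: algebra_simps flip: exp_add)
  have "exp s - 1 - s \<le> s * (exp s - 1)" using 1 by (simp add: algebra_simps)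
  also have "\<dots> \<le> s * (s * exp s)" using 1 assms by (intro mult_left_mono)
  finally show ?thesis by (simp add: power2_eq_square)
qed

text \<open>The gradient formula in which the density has been differentiated instead of
  \<open>f\<close>. Subtracting \<open>f x\<close> leaves the integral as it is, the coordinates
  being centred, but for Lipschitz \<open>f\<close> it bounds the integrand by a multiple of the
  squared norm of \<open>u\<close>, and it gives the shape of the two-point estimator.\<close>

definition smooth_grad ::
    "nat \<Rightarrow> real \<Rightarrow> ((nat \<Rightarrow> real) \<Rightarrow> real) \<Rightarrow> (nat \<Rightarrow> real) \<Rightarrow> nat \<Rightarrow> real" where
  "smooth_grad n b f x =
     (\<lambda>i\<in>{..<n}. \<integral>u. u i * (f (vec_shift n x b u) - f x) / b \<partial>std_gaussian n)"

lemma component_le_L2_set: "i < n \<Longrightarrow> \<bar>u i\<bar> \<le> L2_set u {..<n}" for u :: "nat \<Rightarrow> real"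
  using member_le_L2_set[of "{..<n}" i "\<lambda>i. \<bar>u i\<bar>"] by (simp add: L2_set_def)

lemma L2_set_square: "(L2_set u {..<n})\<^sup>2 = (\<Sum>i<n. (u i)\<^sup>2)" for u :: "nat \<Rightarrow> real"
  by (simp add: L2_set_def sum_nonneg)

lemma measurable_L2_set [measurable (raw)]:
  assumes [measurable]: "f \<in> M \<rightarrow>\<^sub>M Rvec n"
  shows "(\<lambda>\<omega>. L2_set (f \<omega>) {..<n}) \<in> borel_measurable M"
  unfolding L2_set_def by measurable

locale lipschitz_vec =
  fixes n :: nat and f :: "(nat \<Rightarrow> real) \<Rightarrow> real" and L b :: real
  assumes measurable_f [measurable]: "f \<in> borel_measurable (Rvec n)"
    and lipschitz: "x \<in> space (Rvec n) \<Longrightarrow> y \<in> space (Rvec n) \<Longrightarrow>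
      \<bar>f x - f y\<bar> \<le> L * L2_set (\<lambda>j. x j - y j) {..<n}"
    and L_nonneg: "0 \<le> L" and b_pos: "0 < b"
begin

sublocale G: prob_space "std_gaussian n" by (rule prob_space_std_gaussian)

lemma lipschitz_shift:
  assumes "x \<in> space (Rvec n)"
  shows "\<bar>f (vec_shift n x b u) - f x\<bar> \<le> L * b * L2_set u {..<n}"
proof -
  have "\<bar>f (vec_shift n x b u) - f x\<bar> \<le> L * L2_set (\<lambda>j. vec_shift n x b u j - x j) {..<n}"
    by (intro lipschitz assms vec_shift_in_space)
  also have "L2_set (\<lambda>j. vec_shift n x b u j - x j) {..<n} = L2_set (\<lambda>j. b * u j) {..<n}"
    by (intro L2_set_cong) (auto simp: vec_shift_def)
  also have "\<dots> = b * L2_set u {..<n}" using b_pos by (simp add: L2_set_right_distrib)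
  finally show ?thesis by simp
qed

lemma integrable_shift_square:
  assumes x [measurable]: "x \<in> space (Rvec n)"
  shows "integrable (std_gaussian n) (\<lambda>u. (f (vec_shift n x b u) - f x)\<^sup>2)"
proof (rule Bochner_Integration.integrable_bound)
  show "integrable (std_gaussian n) (\<lambda>u. (L * b)\<^sup>2 * (L2_set u {..<n})\<^sup>2)"
    by (intro integrable_mult_right integrable_std_gaussian_square_norm)
  show "AE u in std_gaussian n. norm ((f (vec_shift n x b u) - f x)\<^sup>2)
      \<le> norm ((L * b)\<^sup>2 * (L2_set u {..<n})\<^sup>2)"
    using order_trans[OF lipschitz_shift[OF x] abs_ge_self]
    by (intro AE_I2) (simp add: abs_le_square_iff[symmetric] flip: power_mult_distrib)
qed measurable

lemma integrable_shift:
  assumes x [measurable]: "x \<in> space (Rvec n)"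
  shows "integrable (std_gaussian n) (\<lambda>u. f (vec_shift n x b u) - f x)"
  by (rule G.square_integrable_imp_integrable[OF _ integrable_shift_square[OF x]]) measurable

lemma integrable_f_shift:
  "x \<in> space (Rvec n) \<Longrightarrow> integrable (std_gaussian n) (\<lambda>u. f (vec_shift n x b u))"
  using Bochner_Integration.integrable_add[OF integrable_shift, of x "\<lambda>_. f x"] by simp

lemma integrable_inner_shift:
  assumes x [measurable]: "x \<in> space (Rvec n)"
  shows "integrable (std_gaussian n) (\<lambda>u. (\<Sum>i<n. v i * u i) * (f (vec_shift n x b u) - f x))"
  by (rule Cauchy_Schwarz_integral(1)[OF _ _ integrable_std_gaussian_inner_square integrable_shift_square[OF x]])
     measurable

lemma integrable_smooth_grad:
  assumes "x \<in> space (Rvec n)" "i < n"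
  shows "integrable (std_gaussian n) (\<lambda>u. u i * (f (vec_shift n x b u) - f x) / b)"
proof -
  \<comment> \<open>A coordinate is the inner product with a unit vector.\<close>
  have "(\<Sum>j<n. (if j = i then 1 else 0) * u j) = u i" for u :: "nat \<Rightarrow> real"
    using assms(2) by (simp add: if_distrib[of "\<lambda>c. c * _"] cong: if_cong)
  then show ?thesis
    using integrable_inner_shift[OF assms(1), of "\<lambda>j. if j = i then 1 else 0"] by simp
qed

text \<open>A crude bound from |u_i| <= |u| and E |u|^2 = n. It only serves to make the gradient
  norm along the run integrable, so its size does not enter the rate.\<close>

lemma smooth_grad_bounded:
  assumes x [measurable]: "x \<in> space (Rvec n)" and i: "i < n"
  shows "\<bar>smooth_grad n b f x i\<bar> \<le> L * n"
proof -
  have "\<bar>smooth_grad n b f x i\<bar> = \<bar>\<integral>u. u i * (f (vec_shift n x b u) - f x) / b \<partial>std_gaussian n\<bar>"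
    using i by (simp add: smooth_grad_def)
  also have "\<dots> \<le> (\<integral>u. \<bar>u i * (f (vec_shift n x b u) - f x) / b\<bar> \<partial>std_gaussian n)"
    by (rule integral_abs_bound)
  also have "\<dots> \<le> (\<integral>u. L * (L2_set u {..<n})\<^sup>2 \<partial>std_gaussian n)"
  proof (rule integral_mono)
    show "integrable (std_gaussian n) (\<lambda>u. \<bar>u i * (f (vec_shift n x b u) - f x) / b\<bar>)"
      by (intro integrable_abs integrable_smooth_grad x i)
    show "integrable (std_gaussian n) (\<lambda>u. L * (L2_set u {..<n})\<^sup>2)"
      by (intro integrable_mult_right integrable_std_gaussian_square_norm)
    fix u :: "nat \<Rightarrow> real"
    have "\<bar>u i\<bar> * \<bar>f (vec_shift n x b u) - f x\<bar> \<le> L2_set u {..<n} * (L * b * L2_set u {..<n})"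
      by (intro mult_mono component_le_L2_set lipschitz_shift x i) auto
    then show "\<bar>u i * (f (vec_shift n x b u) - f x) / b\<bar> \<le> L * (L2_set u {..<n})\<^sup>2"
      using b_pos by (simp add: abs_mult abs_divide divide_le_eq power2_eq_square mult_ac)
  qed
  also have "\<dots> = L * n" by (simp add: integral_std_gaussian_square_norm)
  finally show ?thesis .
qed

text \<open>With \<open>v = \<Delta> / b\<close> the left side is the integral of the second-order
  part of the exponential times the increment \<open>h\<close>. Cauchy-Schwarz bounds it by
  \<open>sqrt (exp t - 1 - t) \<le> t * exp (t / 2)\<close>, where \<open>t = s / b\<^sup>2\<close>,
  times the L2 norm of \<open>h\<close>, which is at most \<open>L * b * sqrt n\<close>.\<close>

lemma gauss_smooth_second_order:
  fixes \<Delta> :: "nat \<Rightarrow> real"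
  assumes x [measurable]: "x \<in> space (Rvec n)"
  defines "s \<equiv> \<Sum>i<n. (\<Delta> i)\<^sup>2"
  shows "\<bar>gauss_smooth n b f (vec_shift n x 1 \<Delta>) - gauss_smooth n b f x
      - (\<Sum>i<n. \<Delta> i * smooth_grad n b f x i)\<bar> \<le> L * sqrt n / b * s * exp (s / (2 * b\<^sup>2))"
proof -
  define v where "v = (\<lambda>i. \<Delta> i / b)"
  define t where "t = s / b\<^sup>2"
  define W where "W = (\<lambda>u. \<Sum>i<n. v i * u i)"
  define h where "h = (\<lambda>u. f (vec_shift n x b u) - f x)"
  have t: "(\<Sum>i<n. (v i)\<^sup>2) = t"
    by (simp add: v_def t_def s_def power_divide sum_divide_distrib)
  have [simp]: "0 \<le> s" "0 \<le> t" by (auto simp: s_def t_def intro!: sum_nonneg divide_nonneg_nonneg)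
  have [measurable]: "W \<in> borel_measurable (Rvec n)" "h \<in> borel_measurable (Rvec n)"
    unfolding W_def h_def by measurable
  let ?e = "\<lambda>u. exp (W u - t / 2)"
  \<comment> \<open>Moving the centre by \<open>\<Delta>\<close> is the same as translating the
    Gaussian sample by \<open>\<Delta> / b\<close>.\<close>
  have sh: "vec_shift n (vec_shift n x 1 \<Delta>) b u = vec_shift n x b (vec_shift n u 1 v)" for u
    using b_pos by (auto simp: vec_shift_def v_def algebra_simps fun_eq_iff restrict_def)
  have ih: "integrable (std_gaussian n) h"
    unfolding h_def by (rule integrable_shift[OF x])
  have ish: "integrable (std_gaussian n) (\<lambda>u. h (vec_shift n u 1 v))"
    using integrable_f_shift[OF vec_shift_in_space, of x 1 \<Delta>] by (simp add: h_def sh)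
  have ieh: "integrable (std_gaussian n) (\<lambda>u. ?e u * h u)"
    using integrable_std_gaussian_shift_iff[of h n v] ish by (simp add: t W_def)
  have iWh: "integrable (std_gaussian n) (\<lambda>u. W u * h u)"
    unfolding W_def h_def by (rule integrable_inner_shift[OF x])
  have 1: "gauss_smooth n b f (vec_shift n x 1 \<Delta>) = (\<integral>u. ?e u * h u \<partial>std_gaussian n) + f x"
  proof -
    have "gauss_smooth n b f (vec_shift n x 1 \<Delta>) = (\<integral>u. h (vec_shift n u 1 v) + f x \<partial>std_gaussian n)"
      by (simp add: gauss_smooth_def h_def sh)
    also have "\<dots> = (\<integral>u. h (vec_shift n u 1 v) \<partial>std_gaussian n) + f x"
      using ish G.prob_space by simp
    also have "(\<integral>u. h (vec_shift n u 1 v) \<partial>std_gaussian n) = (\<integral>u. ?e u * h u \<partial>std_gaussian n)"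
      using integral_std_gaussian_shift[of h n v] by (simp add: t W_def)
    finally show ?thesis .
  qed
  have 2: "gauss_smooth n b f x = (\<integral>u. h u \<partial>std_gaussian n) + f x"
  proof -
    have "gauss_smooth n b f x = (\<integral>u. h u + f x \<partial>std_gaussian n)"
      by (simp add: gauss_smooth_def h_def)
    then show ?thesis using ih G.prob_space by simp
  qed
  have 3: "(\<Sum>i<n. \<Delta> i * smooth_grad n b f x i) = (\<integral>u. W u * h u \<partial>std_gaussian n)"
  proof -
    have "(\<Sum>i<n. \<Delta> i * smooth_grad n b f x i) =
        (\<Sum>i<n. \<integral>u. \<Delta> i * (u i * (f (vec_shift n x b u) - f x) / b) \<partial>std_gaussian n)"
      by (intro sum.cong) (auto simp: smooth_grad_def)
    also have "\<dots> = (\<integral>u. (\<Sum>i<n. \<Delta> i * (u i * (f (vec_shift n x b u) - f x) / b)) \<partial>std_gaussian n)"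
      using integrable_smooth_grad[OF x]
      by (intro Bochner_Integration.integral_sum[symmetric] integrable_mult_right) auto
    also have "(\<lambda>u. \<Sum>i<n. \<Delta> i * (u i * (f (vec_shift n x b u) - f x) / b)) = (\<lambda>u. W u * h u)"
      by (auto simp: W_def h_def v_def sum_distrib_right fun_eq_iff intro!: sum.cong)
    finally show ?thesis .
  qed
  have hle: "\<bar>h u\<bar> \<le> L * b * L2_set u {..<n}" for u
    unfolding h_def by (rule lipschitz_shift[OF x])
  have R: "integrable (std_gaussian n) (\<lambda>u. (?e u - 1 - W u)\<^sup>2)"
    "(\<integral>u. (?e u - 1 - W u)\<^sup>2 \<partial>std_gaussian n) = exp t - 1 - t"
    using std_gaussian_exp_remainder[of n v] by (auto simp: has_bochner_integral_iff W_def t)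
  have CS: "integrable (std_gaussian n) (\<lambda>u. (?e u - 1 - W u) * L2_set u {..<n})"
    "(\<integral>u. \<bar>(?e u - 1 - W u) * L2_set u {..<n}\<bar> \<partial>std_gaussian n) \<le> sqrt (exp t - 1 - t) * sqrt n"
    using Cauchy_Schwarz_integral[of "\<lambda>u. ?e u - 1 - W u" "std_gaussian n" "\<lambda>u. L2_set u {..<n}"] R
      integrable_std_gaussian_square_norm[of n] integral_std_gaussian_square_norm[of n] by auto
  have "\<bar>gauss_smooth n b f (vec_shift n x 1 \<Delta>) - gauss_smooth n b f x
      - (\<Sum>i<n. \<Delta> i * smooth_grad n b f x i)\<bar> = \<bar>\<integral>u. (?e u - 1 - W u) * h u \<partial>std_gaussian n\<bar>"
    using ieh ih iWh by (simp add: 1 2 3 algebra_simps)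
  also have "\<dots> \<le> (\<integral>u. \<bar>(?e u - 1 - W u) * h u\<bar> \<partial>std_gaussian n)"
    by (rule integral_abs_bound)
  also have "\<dots> \<le> (\<integral>u. L * b * \<bar>(?e u - 1 - W u) * L2_set u {..<n}\<bar> \<partial>std_gaussian n)"
  proof (rule integral_mono)
    show "integrable (std_gaussian n) (\<lambda>u. \<bar>(?e u - 1 - W u) * h u\<bar>)"
      using ieh ih iWh by (auto simp: algebra_simps)
    show "\<bar>(?e u - 1 - W u) * h u\<bar> \<le> L * b * \<bar>(?e u - 1 - W u) * L2_set u {..<n}\<bar>" for u
      using mult_left_mono[OF hle, of "\<bar>?e u - 1 - W u\<bar>" u] by (simp add: abs_mult mult_ac)
  qed (use CS in auto)
  also have "\<dots> \<le> L * b * (sqrt (exp t - 1 - t) * sqrt n)"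
    using CS L_nonneg b_pos by (auto intro!: mult_left_mono)
  also have "sqrt (exp t - 1 - t) \<le> t * exp (t / 2)"
  proof (rule real_le_lsqrt)
    have "(t * exp (t / 2))\<^sup>2 = t\<^sup>2 * exp t"
      by (simp add: power_mult_distrib power2_eq_square flip: exp_add)
    then show "exp t - 1 - t \<le> (t * exp (t / 2))\<^sup>2" using exp_remainder_le[of t] by simp
  qed simp
  also have "L * b * (t * exp (t / 2) * sqrt n) = L * sqrt n / b * s * exp (s / (2 * b\<^sup>2))"
    using b_pos by (simp add: t_def power2_eq_square field_simps)
  finally show ?thesis using L_nonneg b_pos by (simp add: mult_left_mono mult_right_mono)
qed

text \<open>\<open>deriv\<close> is a choice operator, so the derivative must be shown to exist
  before it can be identified. The expansion along one coordinate bounds the error of the difference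
  quotient by \<open>?B t\<close>, which tends to 0.\<close>

lemma grad_gauss_smooth:
  assumes x: "x \<in> space (Rvec n)"
  shows "grad n (gauss_smooth n b f) x = smooth_grad n b f x"
proof
  fix i
  show "grad n (gauss_smooth n b f) x i = smooth_grad n b f x i"
  proof (cases "i < n")
    case i: True
    let ?g = "\<lambda>t. gauss_smooth n b f (x(i := t))" and ?D = "smooth_grad n b f x i"
    let ?B = "\<lambda>t. L * sqrt n / b * \<bar>t - x i\<bar> * exp ((t - x i)\<^sup>2 / (2 * b\<^sup>2))"
    have *: "\<bar>?g t - ?g (x i) - (t - x i) * ?D\<bar> \<le> \<bar>t - x i\<bar> * ?B t" for t
    proof -
      let ?\<Delta> = "\<lambda>j. if j = i then t - x i else 0"
      have "x(i := t) = vec_shift n x 1 ?\<Delta>"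
        using x i by (auto simp: vec_shift_def space_Rvec PiE_iff extensional_def fun_eq_iff)
      moreover have "(\<Sum>j<n. (?\<Delta> j)\<^sup>2) = (t - x i)\<^sup>2" "(\<Sum>j<n. ?\<Delta> j * smooth_grad n b f x j) = (t - x i) * ?D"
        using i by (simp_all add: if_distrib[of "\<lambda>c. c * _"] if_distrib[of "\<lambda>c. c\<^sup>2"] cong: if_cong)
      ultimately show ?thesis
        using gauss_smooth_second_order[OF x, of ?\<Delta>]
        by (simp add: power2_eq_square abs_mult[symmetric] mult_ac)
    qed
    have "((\<lambda>t. (?g t - ?g (x i)) / (t - x i) - ?D) \<longlongrightarrow> 0) (at (x i))"
    proof (rule Lim_null_comparison)
      show "\<forall>\<^sub>F t in at (x i). norm ((?g t - ?g (x i)) / (t - x i) - ?D) \<le> ?B t"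
      proof (rule eventually_mono[OF eventually_at_filter[THEN iffD2, OF eventually_True[THEN eventually_mono]]])
        fix t assume "t \<noteq> x i"
        then have "norm ((?g t - ?g (x i)) / (t - x i) - ?D) = \<bar>?g t - ?g (x i) - (t - x i) * ?D\<bar> / \<bar>t - x i\<bar>"
          by (simp add: abs_divide[symmetric] diff_divide_distrib)
        also have "\<dots> \<le> ?B t"
          using *[of t] \<open>t \<noteq> x i\<close> by (simp add: divide_le_eq mult_ac)
        finally show "norm ((?g t - ?g (x i)) / (t - x i) - ?D) \<le> ?B t" .
      qed auto
      have "(?B \<longlongrightarrow> ?B (x i)) (at (x i))"
        using b_pos by (intro tendsto_intros) auto
      then show "(?B \<longlongrightarrow> 0) (at (x i))" by simp
    qed
    then have "(?g has_field_derivative ?D) (at (x i))"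
      by (simp add: has_field_derivative_iff LIM_zero_iff)
    then show ?thesis using i by (simp add: grad_def DERIV_imp_deriv)
  qed (simp add: grad_def smooth_grad_def)
qed

text \<open>The coordinates being centred, the value of \<open>f\<close> at the centre drops out of
  the gradient. What remains is the integral of \<open>u i\<close> times an increment of
  \<open>f\<close> between two points whose distance does not depend on \<open>u\<close>.\<close>

lemma smooth_grad_lipschitz:
  assumes x: "x \<in> space (Rvec n)" and y: "y \<in> space (Rvec n)" and i: "i < n"
  shows "\<bar>smooth_grad n b f x i - smooth_grad n b f y i\<bar> \<le> L / b * L2_set (\<lambda>j. x j - y j) {..<n}"
proof -
  let ?d = "L2_set (\<lambda>j. x j - y j) {..<n}"
  have [measurable]: "x \<in> space (Rvec n)" "y \<in> space (Rvec n)" by fact+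
  have iu: "integrable (std_gaussian n) (\<lambda>u. u i)"
    using integrable_std_gaussian_power[OF i, of 1] by simp
  have uf: "integrable (std_gaussian n) (\<lambda>u. u i * f (vec_shift n z b u) / b)"
    and gz: "smooth_grad n b f z i = (\<integral>u. u i * f (vec_shift n z b u) / b \<partial>std_gaussian n)"
    if z: "z \<in> space (Rvec n)" for z
  proof -
    have "u i * f (vec_shift n z b u) / b = u i * (f (vec_shift n z b u) - f z) / b + u i * (f z / b)" for u
      by (simp add: diff_divide_distrib algebra_simps)
    then show "integrable (std_gaussian n) (\<lambda>u. u i * f (vec_shift n z b u) / b)"
      "smooth_grad n b f z i = (\<integral>u. u i * f (vec_shift n z b u) / b \<partial>std_gaussian n)"
      using integrable_smooth_grad[OF z i] iu std_gaussian_moments(1)[OF i] i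
      by (simp_all add: smooth_grad_def)
  qed
  have "\<bar>smooth_grad n b f x i - smooth_grad n b f y i\<bar> =
      \<bar>\<integral>u. u i * f (vec_shift n x b u) / b - u i * f (vec_shift n y b u) / b \<partial>std_gaussian n\<bar>"
    using uf[OF x] uf[OF y] by (simp add: gz x y)
  also have "\<dots> \<le> (\<integral>u. \<bar>u i * f (vec_shift n x b u) / b - u i * f (vec_shift n y b u) / b\<bar> \<partial>std_gaussian n)"
    by (rule integral_abs_bound)
  \<comment> \<open>|u_i| <= (1 + u_i^2) / 2, whose mean is 1; no absolute moment has to be
    computed.\<close>
  also have "\<dots> \<le> (\<integral>u. (1 + (u i)\<^sup>2) / 2 * (L / b * ?d) \<partial>std_gaussian n)"
  proof (rule integral_mono)
    show "integrable (std_gaussian n) (\<lambda>u. \<bar>u i * f (vec_shift n x b u) / b - u i * f (vec_shift n y b u) / b\<bar>)"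
      using uf[OF x] uf[OF y] by auto
    show "integrable (std_gaussian n) (\<lambda>u. (1 + (u i)\<^sup>2) / 2 * (L / b * ?d))"
      using integrable_std_gaussian_power[OF i, of 2] by (auto simp: add_divide_distrib)
    fix u :: "nat \<Rightarrow> real"
    have "\<bar>f (vec_shift n x b u) - f (vec_shift n y b u)\<bar> \<le>
        L * L2_set (\<lambda>j. vec_shift n x b u j - vec_shift n y b u j) {..<n}"
      by (intro lipschitz vec_shift_in_space)
    also have "L2_set (\<lambda>j. vec_shift n x b u j - vec_shift n y b u j) {..<n} = ?d"
      by (intro L2_set_cong) (auto simp: vec_shift_def)
    finally have "\<bar>u i\<bar> * (\<bar>f (vec_shift n x b u) - f (vec_shift n y b u)\<bar> / b) \<le>
        (1 + (u i)\<^sup>2) / 2 * (L * ?d / b)"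
      using sum_squares_bound[of 1 "\<bar>u i\<bar>"] b_pos
      by (intro mult_mono divide_right_mono) auto
    then show "\<bar>u i * f (vec_shift n x b u) / b - u i * f (vec_shift n y b u) / b\<bar> \<le>
        (1 + (u i)\<^sup>2) / 2 * (L / b * ?d)"
      using b_pos by (simp add: abs_mult[symmetric] diff_divide_distrib[symmetric] right_diff_distrib[symmetric] abs_divide)
  qed
  also have "\<dots> = L / b * ?d"
    using integrable_std_gaussian_power[OF i, of 2] std_gaussian_moments(2)[OF i] G.prob_space
    by (simp add: add_divide_distrib)
  finally show ?thesis .
qed

end

section \<open>The two-point gradient estimator\<close>

text \<open>Rounding \<open>x\<close> to a finer and finer grid writes \<open>F\<close> as a limit of functions that depend on \<open>x\<close>
  only through a countably-valued measurable map.\<close>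

lemma measurable_lipschitz_pair:
  fixes F :: "(nat \<Rightarrow> real) \<Rightarrow> 'a \<Rightarrow> real"
  assumes meas: "\<And>x. x \<in> space (Rvec n) \<Longrightarrow> F x \<in> borel_measurable N"
    and lip: "\<And>x y z. x \<in> space (Rvec n) \<Longrightarrow> y \<in> space (Rvec n) \<Longrightarrow> z \<in> space N \<Longrightarrow>
      \<bar>F x z - F y z\<bar> \<le> L * L2_set (\<lambda>j. x j - y j) {..<n}"
    and L: "0 \<le> L"
  shows "(\<lambda>p. F (fst p) (snd p)) \<in> borel_measurable (Rvec n \<Otimes>\<^sub>M N)"
proof -
  let ?r = "\<lambda>k x. \<lambda>i\<in>{..<n}. real_of_int \<lfloor>real (Suc k) * x i\<rfloor> / real (Suc k)"
  have r_space: "?r k x \<in> space (Rvec n)" for k x by (simp add: space_Rvec)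
  show ?thesis
  proof (rule borel_measurable_LIMSEQ_real)
    fix p assume "p \<in> space (Rvec n \<Otimes>\<^sub>M N)"
    then have x: "fst p \<in> space (Rvec n)" and z: "snd p \<in> space N"
      by (auto simp: space_pair_measure)
    \<comment> \<open>Each coordinate is rounded by at most 1/(k+1), and the l1 norm dominates the
      Euclidean one.\<close>
    have le: "\<bar>F (?r k (fst p)) (snd p) - F (fst p) (snd p)\<bar> \<le> L * n * (1 / real (Suc k))" for k
    proof -
      have "\<bar>?r k (fst p) j - fst p j\<bar> \<le> 1 / real (Suc k)" if "j < n" for j
      proof -
        have "?r k (fst p) j - fst p j =
            (real_of_int \<lfloor>real (Suc k) * fst p j\<rfloor> - real (Suc k) * fst p j) / real (Suc k)"
          using that by (simp add: diff_divide_distrib del: of_nat_Suc)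
        then have "\<bar>?r k (fst p) j - fst p j\<bar> =
            \<bar>real_of_int \<lfloor>real (Suc k) * fst p j\<rfloor> - real (Suc k) * fst p j\<bar> / real (Suc k)"
          by (simp only: abs_divide abs_of_nat)
        also have "\<dots> \<le> 1 / real (Suc k)"
          by (rule divide_right_mono, linarith, simp)
        finally show ?thesis .
      qed
      then have "(\<Sum>j<n. \<bar>?r k (fst p) j - fst p j\<bar>) \<le> (\<Sum>j<n. 1 / real (Suc k))"
        by (intro sum_mono) auto
      moreover have "L2_set (\<lambda>j. ?r k (fst p) j - fst p j) {..<n} \<le> (\<Sum>j<n. \<bar>?r k (fst p) j - fst p j\<bar>)"
        by (rule L2_set_le_sum_abs)
      ultimately have "L2_set (\<lambda>j. ?r k (fst p) j - fst p j) {..<n} \<le> n * (1 / real (Suc k))" by simp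
      from mult_left_mono[OF this L] lip[OF r_space[of k "fst p"] x z] show ?thesis by (simp add: mult.assoc)
    qed
    have "(\<lambda>k. F (?r k (fst p)) (snd p) - F (fst p) (snd p)) \<longlonglongrightarrow> 0"
    proof (rule Lim_null_comparison)
      show "\<forall>\<^sub>F k in sequentially. norm (F (?r k (fst p)) (snd p) - F (fst p) (snd p)) \<le> L * n * (1 / real (Suc k))"
        unfolding real_norm_def by (intro always_eventually allI le)
      have "(\<lambda>k. L * n * (1 / real (Suc k))) \<longlonglongrightarrow> L * n * 0"
        by (intro tendsto_mult tendsto_const LIMSEQ_inverse_real_of_nat[unfolded inverse_eq_divide])
      then show "(\<lambda>k. L * n * (1 / real (Suc k))) \<longlonglongrightarrow> 0"
        by (simp only: mult_zero_right)
    qed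
    then show "(\<lambda>k. F (?r k (fst p)) (snd p)) \<longlonglongrightarrow> F (fst p) (snd p)"
      by (simp add: LIM_zero_iff)
  next
    fix k
    let ?I = "{..<n} \<rightarrow>\<^sub>E (UNIV :: int set)"
    let ?g = "\<lambda>p. \<lambda>i\<in>{..<n}. \<lfloor>real (Suc k) * fst p i\<rfloor>"
    have "(\<lambda>p. F (\<lambda>i\<in>{..<n}. real_of_int (?g p i) / real (Suc k)) (snd p)) \<in> borel_measurable (Rvec n \<Otimes>\<^sub>M N)"
    proof (rule measurable_compose_countable'[where g = ?g and I = ?I and
          f = "\<lambda>d p. F (\<lambda>i\<in>{..<n}. real_of_int (d i) / real (Suc k)) (snd p)"])
      show "(\<lambda>p. F (\<lambda>i\<in>{..<n}. real_of_int (d i) / real (Suc k)) (snd p)) \<in> borel_measurable (Rvec n \<Otimes>\<^sub>M N)" for d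
        by (rule measurable_compose[OF measurable_snd meas]) (simp add: space_Rvec)
      have "?g \<in> Rvec n \<Otimes>\<^sub>M N \<rightarrow>\<^sub>M PiM {..<n} (\<lambda>_. count_space UNIV)"
        by (rule measurable_restrict) measurable
      then show "?g \<in> Rvec n \<Otimes>\<^sub>M N \<rightarrow>\<^sub>M count_space ?I"
        by (subst count_space_PiM_finite[symmetric]) auto
      show "countable ?I" by (intro countable_PiE) auto
    qed
    then show "(\<lambda>p. F (?r k (fst p)) (snd p)) \<in> borel_measurable (Rvec n \<Otimes>\<^sub>M N)"
      by (simp cong: restrict_cong)
  qed
qed

locale zo_objective =
  fixes n m q :: nat and \<Omega> :: "'w measure" and \<xi> :: "'w \<Rightarrow> nat \<Rightarrow> real"
    and F :: "(nat \<Rightarrow> real) \<Rightarrow> (nat \<Rightarrow> real) \<Rightarrow> real" and L0 b :: real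
  assumes objective: "stochastic_lipschitz_objective n m \<Omega> \<xi> F L0"
    and b_gt_0: "0 < b" and q_ge_1: "1 \<le> q"
begin

text \<open>The samples may live on another space than \<open>\<xi>\<close>; against this measure
  both expectations become the same integral.\<close>

definition law :: "(nat \<Rightarrow> real) measure" where "law = distr \<Omega> (Rvec m) \<xi>"

abbreviation mean :: "(nat \<Rightarrow> real) \<Rightarrow> real" where "mean \<equiv> mean_objective \<Omega> \<xi> F"

abbreviation g :: "(nat \<Rightarrow> real) \<Rightarrow> nat \<Rightarrow> real" where "g \<equiv> smooth_grad n b mean"

lemma measurable_xi [measurable]: "\<xi> \<in> \<Omega> \<rightarrow>\<^sub>M Rvec m"
  and measurable_F: "x \<in> space (Rvec n) \<Longrightarrow> F x \<in> borel_measurable (Rvec m)"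
  and L0_pos: "0 < L0"
  and F_lipschitz: "x \<in> space (Rvec n) \<Longrightarrow> y \<in> space (Rvec n) \<Longrightarrow> z \<in> space (Rvec m) \<Longrightarrow>
    \<bar>F x z - F y z\<bar> \<le> L0 * L2_set (\<lambda>j. x j - y j) {..<n}"
  using objective by (auto simp: stochastic_lipschitz_objective_def)

sublocale law: prob_space law
  unfolding law_def
  using objective by (intro prob_space.prob_space_distr) (auto simp: stochastic_lipschitz_objective_def)

lemma sets_law [measurable_cong, simp]: "sets law = sets (Rvec m)"
  by (simp add: law_def)

lemma space_law [simp]: "space law = space (Rvec m)"
  by (simp add: law_def)

text \<open>\<open>F\<close> is going to be evaluated at random points, which takes joint
  measurability. The assumptions give measurability of each section \<open>F x\<close>, and the
  Lipschitz condition supplies the rest.\<close>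

lemma measurable_F_pair [measurable (raw)]:
  assumes "f \<in> N \<rightarrow>\<^sub>M Rvec n" "h \<in> N \<rightarrow>\<^sub>M Rvec m"
  shows "(\<lambda>\<omega>. F (f \<omega>) (h \<omega>)) \<in> borel_measurable N"
proof -
  have "(\<lambda>p. F (fst p) (snd p)) \<in> borel_measurable (Rvec n \<Otimes>\<^sub>M Rvec m)"
    using L0_pos by (intro measurable_lipschitz_pair[where L = L0] measurable_F F_lipschitz) auto
  from measurable_compose[OF measurable_Pair[OF assms] this] show ?thesis by simp
qed

lemma integrable_F: "x \<in> space (Rvec n) \<Longrightarrow> integrable law (F x)"
  using objective measurable_F[of x]
  by (auto simp: law_def integrable_distr_eq stochastic_lipschitz_objective_def)

lemma mean_eq: "x \<in> space (Rvec n) \<Longrightarrow> mean x = (\<integral>z. F x z \<partial>law)"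
  using measurable_F[of x] by (simp add: law_def mean_objective_def integral_distr)

sublocale lipschitz_vec n mean L0 b
proof
  have "(\<lambda>x. \<integral>z. F x z \<partial>law) \<in> borel_measurable (Rvec n)" by measurable
  then show "mean \<in> borel_measurable (Rvec n)"
    by (simp add: mean_eq cong: measurable_cong)
  fix x y assume xy: "x \<in> space (Rvec n)" "y \<in> space (Rvec n)"
  have "\<bar>mean x - mean y\<bar> = \<bar>\<integral>z. F x z - F y z \<partial>law\<bar>"
    using integrable_F xy by (simp add: mean_eq)
  also have "\<dots> \<le> (\<integral>z. \<bar>F x z - F y z\<bar> \<partial>law)"
    by (rule integral_abs_bound)
  also have "\<dots> \<le> (\<integral>z. L0 * L2_set (\<lambda>j. x j - y j) {..<n} \<partial>law)"
    using integrable_F xy by (intro integral_mono_AE AE_I2) (auto intro!: F_lipschitz)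
  also have "\<dots> = L0 * L2_set (\<lambda>j. x j - y j) {..<n}"
    using law.prob_space by simp
  finally show "\<bar>mean x - mean y\<bar> \<le> L0 * L2_set (\<lambda>j. x j - y j) {..<n}" .
qed (use L0_pos b_gt_0 in auto)

sublocale pair: pair_prob_space "std_gaussian n" law ..

text \<open>One summand of the estimator as a function on the space of pairs, so that its moments
  are computed once, under the product law.\<close>

definition zo_term :: "(nat \<Rightarrow> real) \<Rightarrow> (nat \<Rightarrow> real) \<times> (nat \<Rightarrow> real) \<Rightarrow> nat \<Rightarrow> real" where
  "zo_term x p i = fst p i * (F (vec_shift n x b (fst p)) (snd p) - F x (snd p)) / b"

lemma measurable_zo_term [measurable]:
  "x \<in> space (Rvec n) \<Longrightarrow> i < n \<Longrightarrow> (\<lambda>p. zo_term x p i) \<in> borel_measurable (Rvec n \<Otimes>\<^sub>M Rvec m)"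
  unfolding zo_term_def by measurable

text \<open>The difference quotient is a scalar common to all coordinates, so the sum of squares is
  its square times the squared norm of \<open>u\<close>; the \<open>b\<close> in the increment
  cancels the division by \<open>b\<close>.\<close>

lemma zo_term_square_le:
  assumes x: "x \<in> space (Rvec n)" and p: "p \<in> space (Rvec n \<Otimes>\<^sub>M Rvec m)"
  shows "(\<Sum>i<n. (zo_term x p i)\<^sup>2) \<le> L0\<^sup>2 * L2_set (fst p) {..<n} ^ 4"
proof -
  let ?u = "fst p" and ?z = "snd p"
  have "\<bar>F (vec_shift n x b ?u) ?z - F x ?z\<bar> \<le> L0 * L2_set (\<lambda>j. vec_shift n x b ?u j - x j) {..<n}"
    using p by (intro F_lipschitz x vec_shift_in_space) (auto simp: space_pair_measure)
  also have "L2_set (\<lambda>j. vec_shift n x b ?u j - x j) {..<n} = L2_set (\<lambda>j. b * ?u j) {..<n}"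
    by (intro L2_set_cong) (auto simp: vec_shift_def)
  also have "\<dots> = b * L2_set ?u {..<n}" using b_gt_0 by (simp add: L2_set_right_distrib)
  finally have "\<bar>(F (vec_shift n x b ?u) ?z - F x ?z) / b\<bar> \<le> L0 * L2_set ?u {..<n}"
    using b_gt_0 by (simp add: abs_divide field_simps)
  then have "((F (vec_shift n x b ?u) ?z - F x ?z) / b)\<^sup>2 \<le> (L0 * L2_set ?u {..<n})\<^sup>2"
    by (metis abs_ge_zero power2_abs power_mono)
  then have "(L2_set ?u {..<n})\<^sup>2 * ((F (vec_shift n x b ?u) ?z - F x ?z) / b)\<^sup>2
      \<le> (L2_set ?u {..<n})\<^sup>2 * (L0 * L2_set ?u {..<n})\<^sup>2"
    by (intro mult_left_mono) auto
  moreover have "(\<Sum>i<n. (zo_term x p i)\<^sup>2) =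
      (L2_set ?u {..<n})\<^sup>2 * ((F (vec_shift n x b ?u) ?z - F x ?z) / b)\<^sup>2"
    by (simp add: L2_set_square zo_term_def power_mult_distrib sum_distrib_right power_divide sum_divide_distrib)
  ultimately show ?thesis
    by (simp add: power_mult_distrib mult_ac flip: power_add)
qed

lemma integrable_fst_norm_power4:
  "integrable (std_gaussian n \<Otimes>\<^sub>M law) (\<lambda>p. L2_set (fst p) {..<n} ^ 4)"
  by (rule integrable_distr[OF measurable_fst])
     (simp add: law.distr_pair_fst integrable_std_gaussian_norm_power4)

text \<open>Square integrability comes first and implies integrability on a probability space.
  Integrating out the uncertainty before the direction turns \<open>F\<close> into the mean
  objective, whence unbiasedness.\<close>

lemma zo_term_moments:
  assumes x [measurable]: "x \<in> space (Rvec n)" and i [measurable]: "i < n"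
  shows integrable_zo_term_square: "integrable (std_gaussian n \<Otimes>\<^sub>M law) (\<lambda>p. (zo_term x p i)\<^sup>2)"
    and integrable_zo_term: "integrable (std_gaussian n \<Otimes>\<^sub>M law) (\<lambda>p. zo_term x p i)"
    and integral_zo_term: "(\<integral>p. zo_term x p i \<partial>(std_gaussian n \<Otimes>\<^sub>M law)) = g x i"
proof -
  have sp: "space (std_gaussian n \<Otimes>\<^sub>M law) = space (Rvec n \<Otimes>\<^sub>M Rvec m)"
    by (simp add: space_pair_measure)
  show sq: "integrable (std_gaussian n \<Otimes>\<^sub>M law) (\<lambda>p. (zo_term x p i)\<^sup>2)"
  proof (rule Bochner_Integration.integrable_bound)
    show "integrable (std_gaussian n \<Otimes>\<^sub>M law) (\<lambda>p. L0\<^sup>2 * L2_set (fst p) {..<n} ^ 4)"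
      using integrable_fst_norm_power4 by simp
    show "AE p in std_gaussian n \<Otimes>\<^sub>M law. norm ((zo_term x p i)\<^sup>2) \<le> norm (L0\<^sup>2 * L2_set (fst p) {..<n} ^ 4)"
    proof (rule AE_I2)
      fix p assume "p \<in> space (std_gaussian n \<Otimes>\<^sub>M law)"
      then have "(\<Sum>i<n. (zo_term x p i)\<^sup>2) \<le> L0\<^sup>2 * L2_set (fst p) {..<n} ^ 4"
        using zo_term_square_le[OF x] sp by auto
      moreover have "(zo_term x p i)\<^sup>2 \<le> (\<Sum>i<n. (zo_term x p i)\<^sup>2)"
        using i by (intro member_le_sum) auto
      ultimately show "norm ((zo_term x p i)\<^sup>2) \<le> norm (L0\<^sup>2 * L2_set (fst p) {..<n} ^ 4)" by simp
    qed
  qed measurable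
  show int: "integrable (std_gaussian n \<Otimes>\<^sub>M law) (\<lambda>p. zo_term x p i)"
    by (rule pair.square_integrable_imp_integrable[OF _ sq]) measurable
  have "(\<integral>p. zo_term x p i \<partial>(std_gaussian n \<Otimes>\<^sub>M law)) =
      (\<integral>u. \<integral>z. zo_term x (u, z) i \<partial>law \<partial>std_gaussian n)"
    by (rule pair.integral_fst'[OF int, symmetric])
  also have "\<dots> = (\<integral>u. u i * (mean (vec_shift n x b u) - mean x) / b \<partial>std_gaussian n)"
    using integrable_F by (intro Bochner_Integration.integral_cong refl)
      (simp add: zo_term_def mean_eq x vec_shift_in_space)
  finally show "(\<integral>p. zo_term x p i \<partial>(std_gaussian n \<Otimes>\<^sub>M law)) = g x i"
    using i by (simp add: smooth_grad_def)
qed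

lemma integral_zo_term_square_le:
  assumes x [measurable]: "x \<in> space (Rvec n)"
  shows "(\<Sum>i<n. \<integral>p. (zo_term x p i)\<^sup>2 \<partial>(std_gaussian n \<Otimes>\<^sub>M law)) \<le> 3 * L0\<^sup>2 * (real n)\<^sup>2"
proof -
  have "(\<Sum>i<n. \<integral>p. (zo_term x p i)\<^sup>2 \<partial>(std_gaussian n \<Otimes>\<^sub>M law)) =
      (\<integral>p. (\<Sum>i<n. (zo_term x p i)\<^sup>2) \<partial>(std_gaussian n \<Otimes>\<^sub>M law))"
    by (rule Bochner_Integration.integral_sum[symmetric]) (auto intro: integrable_zo_term_square[OF x])
  also have "\<dots> \<le> (\<integral>p. L0\<^sup>2 * L2_set (fst p) {..<n} ^ 4 \<partial>(std_gaussian n \<Otimes>\<^sub>M law))"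
  proof (rule integral_mono)
    show "integrable (std_gaussian n \<Otimes>\<^sub>M law) (\<lambda>p. \<Sum>i<n. (zo_term x p i)\<^sup>2)"
      by (intro Bochner_Integration.integrable_sum) (auto intro: integrable_zo_term_square[OF x])
    show "integrable (std_gaussian n \<Otimes>\<^sub>M law) (\<lambda>p. L0\<^sup>2 * L2_set (fst p) {..<n} ^ 4)"
      using integrable_fst_norm_power4 by simp
  qed (use zo_term_square_le[OF x] in \<open>auto simp: space_pair_measure\<close>)
  also have "\<dots> = L0\<^sup>2 * (\<integral>u. L2_set u {..<n} ^ 4 \<partial>distr (std_gaussian n \<Otimes>\<^sub>M law) (std_gaussian n) fst)"
    by (subst integral_distr) auto
  also have "\<dots> = L0\<^sup>2 * (\<integral>u. L2_set u {..<n} ^ 4 \<partial>std_gaussian n)"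
    by (simp add: law.distr_pair_fst)
  also have "\<dots> \<le> L0\<^sup>2 * (3 * (real n)\<^sup>2)"
    by (intro mult_left_mono integral_std_gaussian_norm_power4_le) auto
  finally show ?thesis by simp
qed

lemma measurable_zo_estimate:
  assumes [measurable]: "X \<in> N \<rightarrow>\<^sub>M Rvec n"
    and U [measurable]: "\<And>j. j \<in> {1..q} \<Longrightarrow> U j \<in> N \<rightarrow>\<^sub>M Rvec n"
    and Z [measurable]: "\<And>j. j \<in> {1..q} \<Longrightarrow> Z j \<in> N \<rightarrow>\<^sub>M Rvec m"
  shows "(\<lambda>\<omega>. zo_estimate n q F b (X \<omega>) (\<lambda>j. U j \<omega>) (\<lambda>j. Z j \<omega>)) \<in> N \<rightarrow>\<^sub>M Rvec n"
  unfolding zo_estimate_def by (rule measurable_Rvec_lambda) measurable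

lemma measurable_g [measurable]: "g \<in> Rvec n \<rightarrow>\<^sub>M Rvec n"
  unfolding smooth_grad_def by (rule measurable_Rvec_lambda) measurable

text \<open>Convexity of the square reduces the second moment of the batch average to that of one
  summand, so only the law of each single pair enters and the bound is uniform in
  \<open>q\<close>.\<close>

lemma zo_estimate_moments:
  fixes M :: "'a measure"
  assumes M: "prob_space M"
    and U: "\<And>j. j \<in> {1..q} \<Longrightarrow> U j \<in> M \<rightarrow>\<^sub>M Rvec n"
    and Z: "\<And>j. j \<in> {1..q} \<Longrightarrow> Z j \<in> M \<rightarrow>\<^sub>M Rvec m"
    and law: "\<And>j. j \<in> {1..q} \<Longrightarrow>
      distr M (Rvec n \<Otimes>\<^sub>M Rvec m) (\<lambda>\<omega>. (U j \<omega>, Z j \<omega>)) = std_gaussian n \<Otimes>\<^sub>M law"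
    and x: "x \<in> space (Rvec n)"
  defines "G \<equiv> \<lambda>\<omega>. zo_estimate n q F b x (\<lambda>j. U j \<omega>) (\<lambda>j. Z j \<omega>)"
  shows integrable_zo_estimate: "\<And>i. i < n \<Longrightarrow> integrable M (\<lambda>\<omega>. G \<omega> i)"
    and integral_zo_estimate: "\<And>i. i < n \<Longrightarrow> (\<integral>\<omega>. G \<omega> i \<partial>M) = g x i"
    and integrable_zo_estimate_square: "\<And>i. i < n \<Longrightarrow> integrable M (\<lambda>\<omega>. (G \<omega> i)\<^sup>2)"
    and integral_zo_estimate_square_le: "(\<Sum>i<n. \<integral>\<omega>. (G \<omega> i)\<^sup>2 \<partial>M) \<le> 3 * L0\<^sup>2 * (real n)\<^sup>2"
proof -
  interpret M: prob_space M by fact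
  define T where "T = (\<lambda>j i \<omega>. zo_term x (U j \<omega>, Z j \<omega>) i)"
  have UZ: "(\<lambda>\<omega>. (U j \<omega>, Z j \<omega>)) \<in> M \<rightarrow>\<^sub>M Rvec n \<Otimes>\<^sub>M Rvec m" if "j \<in> {1..q}" for j
    using U[OF that] Z[OF that] by measurable
  have T: "integrable M (T j i)" "(\<integral>\<omega>. T j i \<omega> \<partial>M) = g x i" "integrable M (\<lambda>\<omega>. (T j i \<omega>)\<^sup>2)"
    "(\<integral>\<omega>. (T j i \<omega>)\<^sup>2 \<partial>M) = (\<integral>p. (zo_term x p i)\<^sup>2 \<partial>(std_gaussian n \<Otimes>\<^sub>M law))"
    if j: "j \<in> {1..q}" and i: "i < n" for i j
    unfolding T_def
    using integrable_distr_eq[OF UZ[OF j], of "\<lambda>p. zo_term x p i"]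
      integrable_distr_eq[OF UZ[OF j], of "\<lambda>p. (zo_term x p i)\<^sup>2"]
      integral_distr[OF UZ[OF j], of "\<lambda>p. zo_term x p i"]
      integral_distr[OF UZ[OF j], of "\<lambda>p. (zo_term x p i)\<^sup>2"]
      zo_term_moments[OF x i] measurable_zo_term[OF x i] law[OF j]
    by (simp_all add: borel_measurable_power)
  have G: "G \<omega> i = (\<Sum>j=1..q. T j i \<omega>) / q" if "i < n" for i \<omega>
    using that by (simp add: G_def zo_estimate_def T_def zo_term_def)
  show "integrable M (\<lambda>\<omega>. G \<omega> i)" if i: "i < n" for i
    unfolding G[OF i] by (intro integrable_divide_zero Bochner_Integration.integrable_sum T(1)[OF _ i])
  show "(\<integral>\<omega>. G \<omega> i \<partial>M) = g x i" if i: "i < n" for i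
    unfolding G[OF i] using T(1,2)[OF _ i] q_ge_1 by simp
  have sq_le: "(G \<omega> i)\<^sup>2 \<le> (\<Sum>j=1..q. (T j i \<omega>)\<^sup>2) / q" if "i < n" for i \<omega>
  proof -
    have "(\<Sum>j=1..q. T j i \<omega>)\<^sup>2 \<le> (\<Sum>j=1..q. (T j i \<omega>)\<^sup>2) * q"
      using sum_squared_le_sum_of_squares[where I = "{1..q}" and f = "\<lambda>j. T j i \<omega>"] by simp
    then show ?thesis
      using q_ge_1 by (simp add: G[OF that] power_divide power2_eq_square field_simps)
  qed
  have T2: "integrable M (\<lambda>\<omega>. (\<Sum>j=1..q. (T j i \<omega>)\<^sup>2) / q)" if i: "i < n" for i
    by (intro integrable_divide_zero Bochner_Integration.integrable_sum T(3)[OF _ i])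
  show sq: "integrable M (\<lambda>\<omega>. (G \<omega> i)\<^sup>2)" if i: "i < n" for i
  proof (rule Bochner_Integration.integrable_bound[OF T2[OF i]])
    show "(\<lambda>\<omega>. (G \<omega> i)\<^sup>2) \<in> borel_measurable M"
      using T(1)[OF _ i] unfolding G[OF i] by (auto intro!: borel_measurable_power borel_measurable_divide borel_measurable_sum)
    show "AE \<omega> in M. norm ((G \<omega> i)\<^sup>2) \<le> norm ((\<Sum>j=1..q. (T j i \<omega>)\<^sup>2) / q)"
      using sq_le[OF i] by (auto simp: sum_nonneg)
  qed
  have "(\<Sum>i<n. \<integral>\<omega>. (G \<omega> i)\<^sup>2 \<partial>M) \<le> (\<Sum>i<n. \<integral>\<omega>. (\<Sum>j=1..q. (T j i \<omega>)\<^sup>2) / q \<partial>M)"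
    by (intro sum_mono integral_mono sq_le sq T2) auto
  also have "\<dots> = (\<Sum>i<n. \<integral>p. (zo_term x p i)\<^sup>2 \<partial>(std_gaussian n \<Otimes>\<^sub>M law))"
    using T(3,4) q_ge_1 by (intro sum.cong) auto
  also have "\<dots> \<le> 3 * L0\<^sup>2 * (real n)\<^sup>2" by (rule integral_zo_term_square_le[OF x])
  finally show "(\<Sum>i<n. \<integral>\<omega>. (G \<omega> i)\<^sup>2 \<partial>M) \<le> 3 * L0\<^sup>2 * (real n)\<^sup>2" .
qed

text \<open>\<open>s * (G \<omega> i - g x i) + w i\<close> is the shape of an updated momentum
  error. Unbiasedness removes the cross term, and the variance is at most the second moment. The
  integral is a nonnegative one because \<open>x\<close> and \<open>w\<close> become random
  afterwards.\<close>

lemma zo_estimate_error: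
  fixes M :: "'a measure" and w :: "nat \<Rightarrow> real"
  assumes M: "prob_space M"
    and U: "\<And>j. j \<in> {1..q} \<Longrightarrow> U j \<in> M \<rightarrow>\<^sub>M Rvec n"
    and Z: "\<And>j. j \<in> {1..q} \<Longrightarrow> Z j \<in> M \<rightarrow>\<^sub>M Rvec m"
    and law: "\<And>j. j \<in> {1..q} \<Longrightarrow>
      distr M (Rvec n \<Otimes>\<^sub>M Rvec m) (\<lambda>\<omega>. (U j \<omega>, Z j \<omega>)) = std_gaussian n \<Otimes>\<^sub>M law"
    and x: "x \<in> space (Rvec n)"
  defines "G \<equiv> \<lambda>\<omega>. zo_estimate n q F b x (\<lambda>j. U j \<omega>) (\<lambda>j. Z j \<omega>)"
  shows "(\<integral>\<^sup>+\<omega>. ennreal (\<Sum>i<n. (s * (G \<omega> i - g x i) + w i)\<^sup>2) \<partial>M) \<le>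
    ennreal (s\<^sup>2 * (3 * L0\<^sup>2 * (real n)\<^sup>2) + (\<Sum>i<n. (w i)\<^sup>2))"
proof -
  interpret M: prob_space M by fact
  have mom: "integrable M (\<lambda>\<omega>. G \<omega> i)" "(\<integral>\<omega>. G \<omega> i \<partial>M) = g x i"
    "integrable M (\<lambda>\<omega>. (G \<omega> i)\<^sup>2)" if "i < n" for i
    using that zo_estimate_moments(1-3)[where U = U and Z = Z, OF M U Z law x] unfolding G_def by simp_all
  have mom4: "(\<Sum>i<n. \<integral>\<omega>. (G \<omega> i)\<^sup>2 \<partial>M) \<le> 3 * L0\<^sup>2 * (real n)\<^sup>2"
    using zo_estimate_moments(4)[where U = U and Z = Z, OF M U Z law x] unfolding G_def by simp
  \<comment> \<open>\<open>c i\<close> collects what does not depend on the sample, so the square is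
    a quadratic polynomial in the estimate.\<close>
  define c where "c = (\<lambda>i. w i - s * g x i)"
  have e: "(s * (G \<omega> i - g x i) + w i)\<^sup>2 = s\<^sup>2 * (G \<omega> i)\<^sup>2 + 2 * s * c i * G \<omega> i + (c i)\<^sup>2" for \<omega> i
    by (simp add: c_def power2_eq_square algebra_simps)
  have int: "integrable M (\<lambda>\<omega>. (s * (G \<omega> i - g x i) + w i)\<^sup>2)"
    and eq: "(\<integral>\<omega>. (s * (G \<omega> i - g x i) + w i)\<^sup>2 \<partial>M) \<le> s\<^sup>2 * (\<integral>\<omega>. (G \<omega> i)\<^sup>2 \<partial>M) + (w i)\<^sup>2"
    if i: "i < n" for i
  proof -
    show "integrable M (\<lambda>\<omega>. (s * (G \<omega> i - g x i) + w i)\<^sup>2)"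
      unfolding e using mom(1,3)[OF i] by (intro Bochner_Integration.integrable_add integrable_mult_right) auto
    have "(\<integral>\<omega>. (s * (G \<omega> i - g x i) + w i)\<^sup>2 \<partial>M) =
        s\<^sup>2 * (\<integral>\<omega>. (G \<omega> i)\<^sup>2 \<partial>M) + 2 * s * c i * g x i + (c i)\<^sup>2"
      unfolding e using mom(1,2,3)[OF i] M.prob_space by simp
    moreover have "2 * s * c i * g x i + (c i)\<^sup>2 = (w i)\<^sup>2 - (s * g x i)\<^sup>2"
      by (simp add: c_def power2_eq_square algebra_simps)
    ultimately show "(\<integral>\<omega>. (s * (G \<omega> i - g x i) + w i)\<^sup>2 \<partial>M) \<le> s\<^sup>2 * (\<integral>\<omega>. (G \<omega> i)\<^sup>2 \<partial>M) + (w i)\<^sup>2"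
      using zero_le_power2[of "s * g x i"] by linarith
  qed
  have "(\<integral>\<^sup>+\<omega>. ennreal (\<Sum>i<n. (s * (G \<omega> i - g x i) + w i)\<^sup>2) \<partial>M) =
      ennreal (\<integral>\<omega>. (\<Sum>i<n. (s * (G \<omega> i - g x i) + w i)\<^sup>2) \<partial>M)"
    using int by (intro nn_integral_eq_integral) (auto simp: sum_nonneg)
  also have "(\<integral>\<omega>. (\<Sum>i<n. (s * (G \<omega> i - g x i) + w i)\<^sup>2) \<partial>M) =
      (\<Sum>i<n. \<integral>\<omega>. (s * (G \<omega> i - g x i) + w i)\<^sup>2 \<partial>M)"
    using int by (intro Bochner_Integration.integral_sum) auto
  also have "\<dots> \<le> (\<Sum>i<n. s\<^sup>2 * (\<integral>\<omega>. (G \<omega> i)\<^sup>2 \<partial>M) + (w i)\<^sup>2)"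
    using eq by (intro sum_mono) auto
  also have "\<dots> \<le> s\<^sup>2 * (3 * L0\<^sup>2 * (real n)\<^sup>2) + (\<Sum>i<n. (w i)\<^sup>2)"
    using mult_left_mono[OF mom4, of "s\<^sup>2"] by (simp add: sum.distrib sum_distrib_left)
  finally show ?thesis by (simp add: ennreal_leI)
qed

end

section \<open>The iteration\<close>

text \<open>Fubini on the product of the two laws. It takes the place of conditioning on
  \<open>X\<close>: the inner integral sees \<open>X \<omega>\<close> as a constant.\<close>

lemma (in prob_space) nn_integral_indep_var:
  assumes indep: "indep_var S X T Y" and H [measurable]: "H \<in> borel_measurable (S \<Otimes>\<^sub>M T)"
  shows "(\<integral>\<^sup>+\<omega>. H (X \<omega>, Y \<omega>) \<partial>M) = (\<integral>\<^sup>+\<omega>. \<integral>\<^sup>+\<omega>'. H (X \<omega>, Y \<omega>') \<partial>M \<partial>M)"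
proof -
  have [measurable]: "X \<in> M \<rightarrow>\<^sub>M S" "Y \<in> M \<rightarrow>\<^sub>M T"
    and eq: "distr M S X \<Otimes>\<^sub>M distr M T Y = distr M (S \<Otimes>\<^sub>M T) (\<lambda>\<omega>. (X \<omega>, Y \<omega>))"
    using indep by (simp_all add: indep_var_distribution_eq)
  interpret Y: prob_space "distr M T Y" by (rule prob_space_distr) measurable
  have "(\<integral>\<^sup>+\<omega>. H (X \<omega>, Y \<omega>) \<partial>M) = (\<integral>\<^sup>+p. H p \<partial>(distr M S X \<Otimes>\<^sub>M distr M T Y))"
    unfolding eq by (subst nn_integral_distr) auto
  also have "\<dots> = (\<integral>\<^sup>+x. \<integral>\<^sup>+y. H (x, y) \<partial>distr M T Y \<partial>distr M S X)"
    by (rule Y.nn_integral_fst[symmetric]) simp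
  also have "\<dots> = (\<integral>\<^sup>+\<omega>. \<integral>\<^sup>+y. H (X \<omega>, y) \<partial>distr M T Y \<partial>M)"
    by (subst nn_integral_distr) auto
  also have "\<dots> = (\<integral>\<^sup>+\<omega>. \<integral>\<^sup>+\<omega>'. H (X \<omega>, Y \<omega>') \<partial>M \<partial>M)"
    by (intro nn_integral_cong, subst nn_integral_distr) auto
  finally show ?thesis .
qed

text \<open>Splitting over the values of \<open>R\<close>, each summand is a product of two
  independent factors, one of them an indicator of mean \<open>1 / card I\<close>. Values of
  \<open>R\<close> outside \<open>I\<close> form a null event.\<close>

lemma (in prob_space) integral_indep_index:
  fixes H :: "nat \<Rightarrow> 'a \<Rightarrow> real"
  assumes I: "finite I" "I \<noteq> {}"
    and R [measurable]: "R \<in> M \<rightarrow>\<^sub>M count_space UNIV"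
    and distr_R: "distr M (count_space UNIV) R = measure_pmf (pmf_of_set I)"
    and indep: "\<And>i. indep_var borel (\<lambda>\<omega>. indicator {i} (R \<omega>)) borel (H i)"
    and int: "\<And>i. integrable M (H i)"
  shows "(\<integral>\<omega>. H (R \<omega>) \<omega> \<partial>M) = (\<Sum>i\<in>I. \<integral>\<omega>. H i \<omega> \<partial>M) / card I"
proof -
  have [measurable]: "(\<lambda>\<omega>. indicator {i} (R \<omega>) :: real) \<in> borel_measurable M" for i
    by (rule measurable_compose[OF R]) auto
  have ind: "integrable M (\<lambda>\<omega>. indicator {i} (R \<omega>) :: real)" for i
    by (intro integrable_const_bound[of _ 1]) (auto split: split_indicator)
  have p: "(\<integral>\<omega>. (indicator {i} (R \<omega>) :: real) \<partial>M) = 1 / card I" if "i \<in> I" for i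
  proof -
    have "(\<integral>\<omega>. (indicator {i} (R \<omega>) :: real) \<partial>M) = (\<integral>r. indicator {i} r \<partial>distr M (count_space UNIV) R)"
      by (rule integral_distr[symmetric]) auto
    also have "\<dots> = pmf (pmf_of_set I) i"
      unfolding distr_R by (simp add: pmf.rep_eq)
    finally show ?thesis using I that by simp
  qed
  have AE: "AE \<omega> in M. R \<omega> \<in> I"
  proof -
    have "AE r in distr M (count_space UNIV) R. r \<in> I"
      unfolding distr_R using I by (simp add: AE_measure_pmf_iff)
    then show ?thesis by (subst (asm) AE_distr_iff) auto
  qed
  have [measurable]: "H i \<in> borel_measurable M" for i
    using int by auto
  have int': "integrable M (\<lambda>\<omega>. indicator {i} (R \<omega>) * H i \<omega>)" for i
    by (rule indep_var_integrable[OF indep ind int])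
  have sum: "H (R \<omega>) \<omega> = (\<Sum>i\<in>I. indicator {i} (R \<omega>) * H i \<omega>)" if "R \<omega> \<in> I" for \<omega>
  proof -
    have "(\<Sum>i\<in>I. indicator {i} (R \<omega>) * H i \<omega>) = (\<Sum>i\<in>{R \<omega>}. indicator {i} (R \<omega>) * H i \<omega>)"
      using that I by (intro sum.mono_neutral_right) auto
    then show ?thesis by simp
  qed
  have "(\<integral>\<omega>. H (R \<omega>) \<omega> \<partial>M) = (\<integral>\<omega>. (\<Sum>i\<in>I. indicator {i} (R \<omega>) * H i \<omega>) \<partial>M)"
  proof (rule integral_cong_AE)
    show "(\<lambda>\<omega>. H (R \<omega>) \<omega>) \<in> borel_measurable M"
      by (rule measurable_compose_countable[where f = H and g = R]) auto
    show "AE \<omega> in M. H (R \<omega>) \<omega> = (\<Sum>i\<in>I. indicator {i} (R \<omega>) * H i \<omega>)"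
      using AE by eventually_elim (rule sum)
  qed measurable
  also have "\<dots> = (\<Sum>i\<in>I. \<integral>\<omega>. indicator {i} (R \<omega>) * H i \<omega> \<partial>M)"
    by (rule Bochner_Integration.integral_sum) (rule int')
  also have "\<dots> = (\<Sum>i\<in>I. 1 / card I * (\<integral>\<omega>. H i \<omega> \<partial>M))"
    by (intro sum.cong refl) (simp add: indep_var_lebesgue_integral[OF indep ind int] p)
  finally show ?thesis by (simp add: sum_divide_distrib)
qed

section \<open>Pathwise properties of the recursion\<close>

lemma zo_estimate_cong:
  "x = y \<Longrightarrow> (\<And>j. j \<in> {1..q} \<Longrightarrow> u j = u' j) \<Longrightarrow> (\<And>j. j \<in> {1..q} \<Longrightarrow> z j = z' j) \<Longrightarrow>
    zo_estimate n q F b x u z = zo_estimate n q F b y u' z'"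
  unfolding zo_estimate_def by (intro restrict_ext arg_cong2[where f = "(*)"] refl sum.cong) auto

text \<open>Adaptedness in pathwise form: state \<open>k\<close> reads no batch beyond
  \<open>k\<close>. This is what makes it independent of batch \<open>Suc k\<close>.\<close>

lemma zo_signum_cong:
  assumes "\<And>l j. l \<le> k \<Longrightarrow> j \<in> {1..q} \<Longrightarrow> u l j = u' l j" "\<And>l j. l \<le> k \<Longrightarrow> j \<in> {1..q} \<Longrightarrow> z l j = z' l j"
  shows "zo_signum n q F b s1 s2 x0 u z k = zo_signum n q F b s1 s2 x0 u' z' k"
  using assms
proof (induction k)
  case 0
  then show ?case by (auto intro!: zo_estimate_cong)
next
  case (Suc k)
  have "zo_signum n q F b s1 s2 x0 u z k = zo_signum n q F b s1 s2 x0 u' z' k"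
    using Suc.prems by (intro Suc.IH) auto
  moreover have "zo_estimate n q F b x (u (Suc k)) (z (Suc k)) = zo_estimate n q F b x (u' (Suc k)) (z' (Suc k))" for x
    using Suc.prems by (intro zo_estimate_cong) auto
  ultimately show ?case by simp
qed

text \<open>Convexity of the square, the left side being the square of a convex combination of
  \<open>e\<close> and \<open>c\<close> with weights \<open>1 - s\<close> and \<open>s\<close>. The
  error \<open>e\<close> keeps the factor \<open>1 - s\<close>, and the drift \<open>d\<close> pays
  \<open>1 / s\<close>.\<close>

lemma contraction_square_le:
  fixes s e d :: real
  assumes "0 < s" "s < 1"
  shows "((1 - s) * (e + d))\<^sup>2 \<le> (1 - s) * e\<^sup>2 + d\<^sup>2 / s"
proof -
  define c where "c = (1 - s) * d / s"
  have "(1 - s) * (e + d) = (1 - s) * e + s * c"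
    using assms by (simp add: c_def distrib_left)
  moreover have "(1 - s) * e\<^sup>2 + s * c\<^sup>2 - ((1 - s) * e + s * c)\<^sup>2 = s * (1 - s) * (e - c)\<^sup>2"
    by (simp add: power2_eq_square algebra_simps)
  moreover have "0 \<le> s * (1 - s) * (e - c)\<^sup>2" using assms by simp
  moreover have "s * c\<^sup>2 = (1 - s)\<^sup>2 * d\<^sup>2 / s"
    using assms by (simp add: c_def power2_eq_square)
  moreover have "(1 - s)\<^sup>2 * d\<^sup>2 / s \<le> d\<^sup>2 / s"
    using assms by (intro divide_right_mono mult_left_le_one_le power_le_one) auto
  ultimately show ?thesis by simp
qed

lemma measurable_signum_step:
  assumes [measurable]: "x \<in> N \<rightarrow>\<^sub>M Rvec n" "p \<in> N \<rightarrow>\<^sub>M Rvec n" "e \<in> N \<rightarrow>\<^sub>M Rvec n"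
  shows "(\<lambda>\<omega>. let p' = (\<lambda>j\<in>{..<n}. a * e \<omega> j + c * p \<omega> j) in (\<lambda>j\<in>{..<n}. x \<omega> j - d * sgn (p' j), p'))
    \<in> N \<rightarrow>\<^sub>M Rvec n \<Otimes>\<^sub>M Rvec n"
proof -
  define p' where "p' = (\<lambda>\<omega>. \<lambda>j\<in>{..<n}. a * e \<omega> j + c * p \<omega> j)"
  have [measurable]: "p' \<in> N \<rightarrow>\<^sub>M Rvec n"
    unfolding p'_def by (rule measurable_Rvec_lambda) measurable
  have "(\<lambda>\<omega>. (\<lambda>j\<in>{..<n}. x \<omega> j - d * sgn (p' \<omega> j))) \<in> N \<rightarrow>\<^sub>M Rvec n"
    by (rule measurable_Rvec_lambda) measurable
  from measurable_Pair[OF this \<open>p' \<in> N \<rightarrow>\<^sub>M Rvec n\<close>] show ?thesis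
    by (simp add: p'_def Let_def)
qed

section \<open>The run as a random process\<close>

text \<open>The step sizes stay abstract: the error recursion and the descent inequality use only
  their signs and \<open>s2 k < 1\<close>. The concrete exponents enter with the rates.\<close>

locale zo_run = zo_objective n m q \<Omega> \<xi> F L0 b
  for n m q :: nat and \<Omega> :: "'w measure" and \<xi> F L0 b +
  fixes M :: "'a measure" and U Z :: "nat \<Rightarrow> nat \<Rightarrow> 'a \<Rightarrow> nat \<Rightarrow> real"
    and x0 :: "nat \<Rightarrow> real" and s1 s2 :: "nat \<Rightarrow> real"
  assumes samples: "fresh_samples M n m q \<Omega> \<xi> U Z"
    and x0: "x0 \<in> space (Rvec n)"
    and s1_nonneg: "0 \<le> s1 k" and s2_pos: "0 < s2 k" and s2_less_1: "s2 k < 1"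
begin

sublocale M: prob_space M
  using samples by (simp add: fresh_samples_def)

abbreviation W :: "nat \<times> nat \<Rightarrow> 'a \<Rightarrow> (nat \<Rightarrow> real) \<times> (nat \<Rightarrow> real)" where
  "W \<equiv> \<lambda>(k, j) \<omega>. (U k j \<omega>, Z k j \<omega>)"

lemma indep_W: "M.indep_vars (\<lambda>_. Rvec n \<Otimes>\<^sub>M Rvec m) W (UNIV \<times> {1..q})"
  and distr_W: "j \<in> {1..q} \<Longrightarrow>
    distr M (Rvec n \<Otimes>\<^sub>M Rvec m) (\<lambda>\<omega>. (U k j \<omega>, Z k j \<omega>)) = std_gaussian n \<Otimes>\<^sub>M law"
  using samples by (simp_all add: fresh_samples_def law_def)

lemma measurable_U: "j \<in> {1..q} \<Longrightarrow> U k j \<in> M \<rightarrow>\<^sub>M Rvec n"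
  and measurable_Z: "j \<in> {1..q} \<Longrightarrow> Z k j \<in> M \<rightarrow>\<^sub>M Rvec m"
proof -
  assume "j \<in> {1..q}"
  then have "(\<lambda>\<omega>. (U k j \<omega>, Z k j \<omega>)) \<in> M \<rightarrow>\<^sub>M Rvec n \<Otimes>\<^sub>M Rvec m"
    using indep_W unfolding M.indep_vars_def by fastforce
  from measurable_compose[OF this measurable_fst] measurable_compose[OF this measurable_snd]
  show "U k j \<in> M \<rightarrow>\<^sub>M Rvec n" "Z k j \<in> M \<rightarrow>\<^sub>M Rvec m" by simp_all
qed

abbreviation run where "run \<equiv> zo_signum n q F b s1 s2 x0"

definition X :: "nat \<Rightarrow> 'a \<Rightarrow> nat \<Rightarrow> real" where
  "X k \<omega> = fst (run (\<lambda>l j. U l j \<omega>) (\<lambda>l j. Z l j \<omega>) k)"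

definition P :: "nat \<Rightarrow> 'a \<Rightarrow> nat \<Rightarrow> real" where
  "P k \<omega> = snd (run (\<lambda>l j. U l j \<omega>) (\<lambda>l j. Z l j \<omega>) k)"

definition G :: "nat \<Rightarrow> 'a \<Rightarrow> nat \<Rightarrow> real" where
  "G k \<omega> = zo_estimate n q F b (X k \<omega>) (\<lambda>j. U (Suc k) j \<omega>) (\<lambda>j. Z (Suc k) j \<omega>)"

lemma X_0: "X 0 \<omega> = x0"
  and P_0: "P 0 \<omega> = zo_estimate n q F b x0 (\<lambda>j. U 0 j \<omega>) (\<lambda>j. Z 0 j \<omega>)"
  by (simp_all add: X_def P_def)

lemma P_Suc: "i < n \<Longrightarrow> P (Suc k) \<omega> i = s2 k * G k \<omega> i + (1 - s2 k) * P k \<omega> i"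
  by (simp add: P_def G_def X_def Let_def split_beta)

text \<open>Written as a \<open>vec_shift\<close> so that the second-order expansion applies with
  the signed step as displacement.\<close>

lemma X_Suc: "X (Suc k) \<omega> = vec_shift n (X k \<omega>) 1 (\<lambda>i. - s1 k * sgn (P (Suc k) \<omega> i))"
  by (auto simp: X_def P_def vec_shift_def Let_def split_beta intro!: restrict_ext)

text \<open>The source \<open>N\<close> is arbitrary because it is instantiated twice: by the
  probability space and by a product space of sample families.\<close>

lemma measurable_run:
  fixes N :: "'b measure"
  assumes u: "\<And>l j. l \<le> k \<Longrightarrow> j \<in> {1..q} \<Longrightarrow> u l j \<in> N \<rightarrow>\<^sub>M Rvec n"
    and z: "\<And>l j. l \<le> k \<Longrightarrow> j \<in> {1..q} \<Longrightarrow> z l j \<in> N \<rightarrow>\<^sub>M Rvec m"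
  shows "(\<lambda>\<omega>. run (\<lambda>l j. u l j \<omega>) (\<lambda>l j. z l j \<omega>) k) \<in> N \<rightarrow>\<^sub>M Rvec n \<Otimes>\<^sub>M Rvec n"
  using assms
proof (induction k)
  case 0
  have "(\<lambda>\<omega>. zo_estimate n q F b x0 (\<lambda>j. u 0 j \<omega>) (\<lambda>j. z 0 j \<omega>)) \<in> N \<rightarrow>\<^sub>M Rvec n"
    using 0 x0 by (intro measurable_zo_estimate) auto
  then show ?case using x0 by simp
next
  case (Suc k)
  let ?r = "\<lambda>\<omega>. run (\<lambda>l j. u l j \<omega>) (\<lambda>l j. z l j \<omega>) k"
  have IH: "?r \<in> N \<rightarrow>\<^sub>M Rvec n \<Otimes>\<^sub>M Rvec n"
    using Suc.prems by (intro Suc.IH) auto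
  have x: "(\<lambda>\<omega>. fst (?r \<omega>)) \<in> N \<rightarrow>\<^sub>M Rvec n" and p: "(\<lambda>\<omega>. snd (?r \<omega>)) \<in> N \<rightarrow>\<^sub>M Rvec n"
    using measurable_compose[OF IH measurable_fst] measurable_compose[OF IH measurable_snd] by simp_all
  have e: "(\<lambda>\<omega>. zo_estimate n q F b (fst (?r \<omega>)) (\<lambda>j. u (Suc k) j \<omega>) (\<lambda>j. z (Suc k) j \<omega>)) \<in> N \<rightarrow>\<^sub>M Rvec n"
    using Suc.prems x by (intro measurable_zo_estimate) auto
  from measurable_signum_step[OF x p e] show ?case
    by (simp add: Let_def split_beta)
qed

lemma measurable_X [measurable]: "X k \<in> M \<rightarrow>\<^sub>M Rvec n"
  and measurable_P [measurable]: "P k \<in> M \<rightarrow>\<^sub>M Rvec n"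
proof -
  have "(\<lambda>\<omega>. run (\<lambda>l j. U l j \<omega>) (\<lambda>l j. Z l j \<omega>) k) \<in> M \<rightarrow>\<^sub>M Rvec n \<Otimes>\<^sub>M Rvec n"
    by (intro measurable_run measurable_U measurable_Z) auto
  from measurable_compose[OF this measurable_fst] measurable_compose[OF this measurable_snd]
  show "X k \<in> M \<rightarrow>\<^sub>M Rvec n" "P k \<in> M \<rightarrow>\<^sub>M Rvec n" by (simp_all add: X_def[abs_def] P_def[abs_def])
qed

lemma X_in_space: "\<omega> \<in> space M \<Longrightarrow> X k \<omega> \<in> space (Rvec n)"
  using measurable_space[OF measurable_X] .

text \<open>The state as a function of the samples with index in \<open>J\<close>. The batches up to
  \<open>k\<close> as \<open>J\<close> give independence of the next batch, the full index set gives
  independence of the random index.\<close>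

lemma measurable_run_family:
  assumes "{..k} \<times> {1..q} \<subseteq> J"
  shows "(\<lambda>y. run (\<lambda>l j. fst (y (l, j))) (\<lambda>l j. snd (y (l, j))) k)
    \<in> PiM J (\<lambda>_. Rvec n \<Otimes>\<^sub>M Rvec m) \<rightarrow>\<^sub>M Rvec n \<Otimes>\<^sub>M Rvec n"
proof (rule measurable_run)
  fix l j assume "l \<le> k" "j \<in> {1..q}"
  then have "(\<lambda>y. y (l, j)) \<in> PiM J (\<lambda>_. Rvec n \<Otimes>\<^sub>M Rvec m) \<rightarrow>\<^sub>M Rvec n \<Otimes>\<^sub>M Rvec m"
    using assms by (intro measurable_component_singleton) auto
  from measurable_compose[OF this measurable_fst] measurable_compose[OF this measurable_snd]
  show "(\<lambda>y. fst (y (l, j))) \<in> PiM J (\<lambda>_. Rvec n \<Otimes>\<^sub>M Rvec m) \<rightarrow>\<^sub>M Rvec n"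
    "(\<lambda>y. snd (y (l, j))) \<in> PiM J (\<lambda>_. Rvec n \<Otimes>\<^sub>M Rvec m) \<rightarrow>\<^sub>M Rvec m" .
qed

lemma state_eq:
  assumes "{..k} \<times> {1..q} \<subseteq> J"
  shows "run (\<lambda>l j. fst ((\<lambda>i\<in>J. W i \<omega>) (l, j))) (\<lambda>l j. snd ((\<lambda>i\<in>J. W i \<omega>) (l, j))) k = (X k \<omega>, P k \<omega>)"
proof -
  have "run (\<lambda>l j. fst ((\<lambda>i\<in>J. W i \<omega>) (l, j))) (\<lambda>l j. snd ((\<lambda>i\<in>J. W i \<omega>) (l, j))) k =
      run (\<lambda>l j. U l j \<omega>) (\<lambda>l j. Z l j \<omega>) k"
  proof (rule zo_signum_cong)
    fix l j assume "l \<le> k" "j \<in> {1..q}"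
    then have "(l, j) \<in> J" by (intro subsetD[OF assms]) simp
    then show "fst ((\<lambda>i\<in>J. W i \<omega>) (l, j)) = U l j \<omega>" "snd ((\<lambda>i\<in>J. W i \<omega>) (l, j)) = Z l j \<omega>" by simp_all
  qed
  then show ?thesis by (simp add: X_def P_def)
qed

section \<open>Conditioning on the past\<close>

lemma nn_integral_state_batch:
  assumes H: "H \<in> borel_measurable
    ((Rvec n \<Otimes>\<^sub>M Rvec n) \<Otimes>\<^sub>M PiM ({Suc k} \<times> {1..q}) (\<lambda>_. Rvec n \<Otimes>\<^sub>M Rvec m))"
  shows "(\<integral>\<^sup>+\<omega>. H ((X k \<omega>, P k \<omega>), \<lambda>i\<in>{Suc k} \<times> {1..q}. W i \<omega>) \<partial>M) =
    (\<integral>\<^sup>+\<omega>. \<integral>\<^sup>+\<omega>'. H ((X k \<omega>, P k \<omega>), \<lambda>i\<in>{Suc k} \<times> {1..q}. W i \<omega>') \<partial>M \<partial>M)"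
proof -
  let ?A = "{..k} \<times> {1..q}" and ?B = "{Suc k} \<times> {1..q}" and ?N = "\<lambda>_::nat \<times> nat. Rvec n \<Otimes>\<^sub>M Rvec m"
  let ?S = "\<lambda>y. run (\<lambda>l j. fst (y (l, j))) (\<lambda>l j. snd (y (l, j))) k"
  \<comment> \<open>The past and the new batch occupy disjoint blocks of indices.\<close>
  have indep: "M.indep_var (PiM ?A ?N) (\<lambda>\<omega>. \<lambda>i\<in>?A. W i \<omega>) (PiM ?B ?N) (\<lambda>\<omega>. \<lambda>i\<in>?B. W i \<omega>)"
    by (rule M.indep_var_restrict[OF indep_W]) auto
  have S: "(\<lambda>p. ?S (fst p)) \<in> PiM ?A ?N \<Otimes>\<^sub>M PiM ?B ?N \<rightarrow>\<^sub>M Rvec n \<Otimes>\<^sub>M Rvec n"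
    by (rule measurable_compose[OF measurable_fst measurable_run_family]) auto
  have "(\<lambda>p. H (?S (fst p), snd p)) \<in> borel_measurable (PiM ?A ?N \<Otimes>\<^sub>M PiM ?B ?N)"
    by (rule measurable_compose[OF measurable_Pair[OF S measurable_snd] H])
  from M.nn_integral_indep_var[OF indep this] show ?thesis
    unfolding fst_conv snd_conv state_eq[OF order_refl] .
qed

text \<open>In the inner integral over the new batch the state is frozen, so \<open>w\<close> is a
  constant vector there and the bound at a fixed point applies.\<close>

lemma estimate_error_le:
  assumes w: "\<And>i. i < n \<Longrightarrow> (\<lambda>p. w (fst p) (snd p) i) \<in> borel_measurable (Rvec n \<Otimes>\<^sub>M Rvec n)"
  shows "(\<integral>\<^sup>+\<omega>. ennreal (\<Sum>i<n. (s * (G k \<omega> i - g (X k \<omega>) i) + w (X k \<omega>) (P k \<omega>) i)\<^sup>2) \<partial>M) \<le>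
    (\<integral>\<^sup>+\<omega>. ennreal (s\<^sup>2 * (3 * L0\<^sup>2 * (real n)\<^sup>2) + (\<Sum>i<n. (w (X k \<omega>) (P k \<omega>) i)\<^sup>2)) \<partial>M)"
proof -
  let ?B = "{Suc k} \<times> {1..q}"
  let ?PB = "PiM ?B (\<lambda>_. Rvec n \<Otimes>\<^sub>M Rvec m)"
  let ?e = "\<lambda>x y. zo_estimate n q F b x (\<lambda>j. fst (y (Suc k, j))) (\<lambda>j. snd (y (Suc k, j)))"
  let ?H = "\<lambda>p. ennreal (\<Sum>i<n. (s * (?e (fst (fst p)) (snd p) i - g (fst (fst p)) i)
      + w (fst (fst p)) (snd (fst p)) i)\<^sup>2)"
  have [measurable]: "(\<lambda>p. ?e (fst (fst p)) (snd p)) \<in> (Rvec n \<Otimes>\<^sub>M Rvec n) \<Otimes>\<^sub>M ?PB \<rightarrow>\<^sub>M Rvec n"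
  proof (rule measurable_zo_estimate)
    fix j assume j: "j \<in> {1..q}"
    then have c: "(\<lambda>y. y (Suc k, j)) \<in> ?PB \<rightarrow>\<^sub>M Rvec n \<Otimes>\<^sub>M Rvec m"
      by (intro measurable_component_singleton) auto
    from measurable_compose[OF measurable_compose[OF measurable_snd c] measurable_fst]
      measurable_compose[OF measurable_compose[OF measurable_snd c] measurable_snd]
    show "(\<lambda>p. fst (snd p (Suc k, j))) \<in> (Rvec n \<Otimes>\<^sub>M Rvec n) \<Otimes>\<^sub>M ?PB \<rightarrow>\<^sub>M Rvec n"
      "(\<lambda>p. snd (snd p (Suc k, j))) \<in> (Rvec n \<Otimes>\<^sub>M Rvec n) \<Otimes>\<^sub>M ?PB \<rightarrow>\<^sub>M Rvec m" .
  qed measurable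
  have w' [measurable]: "(\<lambda>p. w (fst (fst p)) (snd (fst p)) i) \<in> borel_measurable ((Rvec n \<Otimes>\<^sub>M Rvec n) \<Otimes>\<^sub>M ?PB)" if "i < n" for i
    using measurable_compose[OF measurable_fst w[OF that]] .
  have H: "?H \<in> borel_measurable ((Rvec n \<Otimes>\<^sub>M Rvec n) \<Otimes>\<^sub>M ?PB)"
    by measurable
  have e: "?e x (\<lambda>i\<in>?B. W i \<omega>) = zo_estimate n q F b x (\<lambda>j. U (Suc k) j \<omega>) (\<lambda>j. Z (Suc k) j \<omega>)" for x \<omega>
    by (rule zo_estimate_cong) auto
  have "(\<integral>\<^sup>+\<omega>. ennreal (\<Sum>i<n. (s * (G k \<omega> i - g (X k \<omega>) i) + w (X k \<omega>) (P k \<omega>) i)\<^sup>2) \<partial>M) =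
      (\<integral>\<^sup>+\<omega>. ?H ((X k \<omega>, P k \<omega>), \<lambda>i\<in>?B. W i \<omega>) \<partial>M)"
    unfolding fst_conv snd_conv e G_def ..
  also have "\<dots> = (\<integral>\<^sup>+\<omega>. \<integral>\<^sup>+\<omega>'. ?H ((X k \<omega>, P k \<omega>), \<lambda>i\<in>?B. W i \<omega>') \<partial>M \<partial>M)"
    by (rule nn_integral_state_batch[OF H])
  also have "\<dots> \<le> (\<integral>\<^sup>+\<omega>. ennreal (s\<^sup>2 * (3 * L0\<^sup>2 * (real n)\<^sup>2) + (\<Sum>i<n. (w (X k \<omega>) (P k \<omega>) i)\<^sup>2)) \<partial>M)"
  proof (rule nn_integral_mono)
    fix \<omega> assume "\<omega> \<in> space M"
    then show "(\<integral>\<^sup>+\<omega>'. ?H ((X k \<omega>, P k \<omega>), \<lambda>i\<in>?B. W i \<omega>') \<partial>M) \<le>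
        ennreal (s\<^sup>2 * (3 * L0\<^sup>2 * (real n)\<^sup>2) + (\<Sum>i<n. (w (X k \<omega>) (P k \<omega>) i)\<^sup>2))"
      unfolding fst_conv snd_conv e
      by (intro zo_estimate_error M.prob_space_axioms measurable_U measurable_Z distr_W X_in_space)
  qed
  finally show ?thesis .
qed

section \<open>Recursion for the momentum error\<close>

definition err :: "nat \<Rightarrow> 'a \<Rightarrow> real" where
  "err k \<omega> = (\<Sum>i<n. (P (Suc k) \<omega> i - g (X k \<omega>) i)\<^sup>2)"

lemma err_nonneg: "0 \<le> err k \<omega>"
  by (simp add: err_def sum_nonneg)

lemma measurable_g_X [measurable]: "(\<lambda>\<omega>. g (X k \<omega>)) \<in> M \<rightarrow>\<^sub>M Rvec n"
  by (rule measurable_compose[OF measurable_X measurable_g])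

lemma measurable_err [measurable]: "err k \<in> borel_measurable M"
  unfolding err_def[abs_def] by measurable

text \<open>The error splits into \<open>s2 k\<close> times the sampling noise and
  \<open>1 - s2 k\<close> times the old momentum's deviation from the gradient at
  \<open>X k\<close>; the latter is a function of the state and takes the role of
  \<open>w\<close>.\<close>

lemma nn_integral_err_le:
  "(\<integral>\<^sup>+\<omega>. ennreal (err k \<omega>) \<partial>M) \<le> (\<integral>\<^sup>+\<omega>. ennreal ((s2 k)\<^sup>2 * (3 * L0\<^sup>2 * (real n)\<^sup>2) +
     (\<Sum>i<n. ((1 - s2 k) * (P k \<omega> i - g (X k \<omega>) i))\<^sup>2)) \<partial>M)"
proof -
  have "err k \<omega> = (\<Sum>i<n. (s2 k * (G k \<omega> i - g (X k \<omega>) i) + (1 - s2 k) * (P k \<omega> i - g (X k \<omega>) i))\<^sup>2)" for \<omega>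
    unfolding err_def by (intro sum.cong refl) (simp add: P_Suc algebra_simps)
  moreover have "(\<lambda>p. (1 - s2 k) * (snd p i - g (fst p) i)) \<in> borel_measurable (Rvec n \<Otimes>\<^sub>M Rvec n)" if "i < n" for i
    using that by measurable
  ultimately show ?thesis
    using estimate_error_le[of "\<lambda>x p i. (1 - s2 k) * (p i - g x i)" "s2 k" k] by simp
qed

text \<open>The initial momentum is itself an estimate at \<open>x0\<close>, so its error and the
  noise of the first update contribute at most \<open>3 * L0\<^sup>2 * (real n)\<^sup>2\<close>
  each.\<close>

lemma nn_integral_err_0: "(\<integral>\<^sup>+\<omega>. ennreal (err 0 \<omega>) \<partial>M) \<le> ennreal (6 * L0\<^sup>2 * (real n)\<^sup>2)"
proof -
  let ?S = "3 * L0\<^sup>2 * (real n)\<^sup>2"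
  have s: "(s2 0)\<^sup>2 \<le> 1" "(1 - s2 0)\<^sup>2 \<le> 1"
    using s2_pos[of 0] s2_less_1[of 0] by (auto intro!: power_le_one)
  have "(\<integral>\<^sup>+\<omega>. ennreal (err 0 \<omega>) \<partial>M) \<le> (\<integral>\<^sup>+\<omega>. ennreal ((s2 0)\<^sup>2 * ?S +
      (\<Sum>i<n. ((1 - s2 0) * (P 0 \<omega> i - g (X 0 \<omega>) i))\<^sup>2)) \<partial>M)"
    by (rule nn_integral_err_le)
  \<comment> \<open>\<open>1 * _ + 0\<close> is the form of \<open>zo_estimate_error\<close> with
    \<open>s = 1\<close> and \<open>w = 0\<close>.\<close>
  also have "\<dots> \<le> (\<integral>\<^sup>+\<omega>. ennreal ?S + ennreal (\<Sum>i<n. (1 * (P 0 \<omega> i - g x0 i) + 0)\<^sup>2) \<partial>M)"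
  proof (rule nn_integral_mono)
    fix \<omega>
    have "(\<Sum>i<n. ((1 - s2 0) * (P 0 \<omega> i - g x0 i))\<^sup>2) \<le> (\<Sum>i<n. (P 0 \<omega> i - g x0 i)\<^sup>2)"
      unfolding power_mult_distrib using s by (intro sum_mono mult_left_le_one_le) auto
    moreover have "(s2 0)\<^sup>2 * ?S \<le> ?S"
      using s by (intro mult_left_le_one_le) auto
    ultimately show "ennreal ((s2 0)\<^sup>2 * ?S + (\<Sum>i<n. ((1 - s2 0) * (P 0 \<omega> i - g (X 0 \<omega>) i))\<^sup>2)) \<le>
        ennreal ?S + ennreal (\<Sum>i<n. (1 * (P 0 \<omega> i - g x0 i) + 0)\<^sup>2)"
      by (simp add: X_0 sum_nonneg ennreal_leI flip: ennreal_plus)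
  qed
  also have "\<dots> = ennreal ?S + (\<integral>\<^sup>+\<omega>. ennreal (\<Sum>i<n. (1 * (P 0 \<omega> i - g x0 i) + 0)\<^sup>2) \<partial>M)"
    by (subst nn_integral_add) (auto simp: M.emeasure_space_1)
  also have "\<dots> \<le> ennreal ?S + ennreal (1\<^sup>2 * ?S + (\<Sum>i<n. 0\<^sup>2))"
    unfolding P_0
    by (intro add_left_mono zo_estimate_error M.prob_space_axioms measurable_U measurable_Z distr_W x0)
  also have "\<dots> = ennreal (6 * L0\<^sup>2 * (real n)\<^sup>2)"
    by (simp flip: ennreal_plus)
  finally show ?thesis .
qed

text \<open>Every coordinate moves by exactly \<open>s1 k\<close>, or not at all where the sign is
  0.\<close>

lemma step_square_le: "(L2_set (\<lambda>i. X k \<omega> i - X (Suc k) \<omega> i) {..<n})\<^sup>2 \<le> n * (s1 k)\<^sup>2"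
proof -
  have "(X k \<omega> i - X (Suc k) \<omega> i)\<^sup>2 \<le> (s1 k)\<^sup>2" if "i < n" for i
    using that by (simp add: X_Suc vec_shift_def power_mult_distrib sgn_if)
  then have "(\<Sum>i<n. (X k \<omega> i - X (Suc k) \<omega> i)\<^sup>2) \<le> (\<Sum>i<n. (s1 k)\<^sup>2)"
    by (intro sum_mono) auto
  then show ?thesis by (simp add: L2_set_square)
qed

text \<open>The gradient at the new point is exchanged for the one at the old point, at the price of
  a drift. Each coordinate of the drift is at most \<open>L0 / b\<close> times the step length, so
  the number of coordinates and the squared step length contribute one factor \<open>n\<close>
  each.\<close>

lemma nn_integral_err_Suc:
  defines "s \<equiv> \<lambda>k. s2 (Suc k)"
  shows "(\<integral>\<^sup>+\<omega>. ennreal (err (Suc k) \<omega>) \<partial>M) \<le>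
    ennreal ((s k)\<^sup>2 * (3 * L0\<^sup>2 * (real n)\<^sup>2) + real n * ((L0 / b)\<^sup>2 * (n * (s1 k)\<^sup>2)) / s k) +
    ennreal (1 - s k) * (\<integral>\<^sup>+\<omega>. ennreal (err k \<omega>) \<partial>M)"
proof -
  let ?S = "(s k)\<^sup>2 * (3 * L0\<^sup>2 * (real n)\<^sup>2)" and ?d = "(L0 / b)\<^sup>2 * (n * (s1 k)\<^sup>2)"
  have s: "0 < s k" "s k < 1" using s2_pos s2_less_1 by (auto simp: s_def)
  have "(\<integral>\<^sup>+\<omega>. ennreal (err (Suc k) \<omega>) \<partial>M) \<le> (\<integral>\<^sup>+\<omega>. ennreal (?S +
      (\<Sum>i<n. ((1 - s k) * (P (Suc k) \<omega> i - g (X (Suc k) \<omega>) i))\<^sup>2)) \<partial>M)"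
    unfolding s_def by (rule nn_integral_err_le)
  also have "\<dots> \<le> (\<integral>\<^sup>+\<omega>. ennreal (?S + real n * ?d / s k) + ennreal (1 - s k) * ennreal (err k \<omega>) \<partial>M)"
  proof (rule nn_integral_mono)
    fix \<omega> assume \<omega>: "\<omega> \<in> space M"
    let ?D = "L2_set (\<lambda>i. X k \<omega> i - X (Suc k) \<omega> i) {..<n}"
    have "((1 - s k) * (P (Suc k) \<omega> i - g (X (Suc k) \<omega>) i))\<^sup>2 \<le>
        (1 - s k) * (P (Suc k) \<omega> i - g (X k \<omega>) i)\<^sup>2 + ?d / s k" if i: "i < n" for i
    proof -
      let ?e = "P (Suc k) \<omega> i - g (X k \<omega>) i" and ?\<delta> = "g (X k \<omega>) i - g (X (Suc k) \<omega>) i"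
      have "\<bar>?\<delta>\<bar> \<le> L0 / b * ?D"
        by (intro smooth_grad_lipschitz X_in_space \<omega> i)
      from power_mono[OF this abs_ge_zero, of 2] have "?\<delta>\<^sup>2 \<le> (L0 / b * ?D)\<^sup>2"
        by (simp only: power2_abs)
      also have "\<dots> \<le> ?d"
        unfolding power_mult_distrib by (intro mult_left_mono step_square_le) auto
      finally have "?\<delta>\<^sup>2 / s k \<le> ?d / s k"
        using s by (intro divide_right_mono) auto
      with contraction_square_le[OF s, of ?e ?\<delta>] show ?thesis by simp
    qed
    then have "(\<Sum>i<n. ((1 - s k) * (P (Suc k) \<omega> i - g (X (Suc k) \<omega>) i))\<^sup>2) \<le>
        (\<Sum>i<n. (1 - s k) * (P (Suc k) \<omega> i - g (X k \<omega>) i)\<^sup>2 + ?d / s k)"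
      by (intro sum_mono) auto
    also have "\<dots> = (1 - s k) * err k \<omega> + n * ?d / s k"
      by (simp add: sum.distrib err_def sum_distrib_left)
    finally have "?S + (\<Sum>i<n. ((1 - s k) * (P (Suc k) \<omega> i - g (X (Suc k) \<omega>) i))\<^sup>2) \<le>
        (?S + real n * ?d / s k) + (1 - s k) * err k \<omega>" by simp
    moreover have "0 \<le> ?S + real n * ?d / s k" using s by simp
    ultimately show "ennreal (?S + (\<Sum>i<n. ((1 - s k) * (P (Suc k) \<omega> i - g (X (Suc k) \<omega>) i))\<^sup>2)) \<le>
        ennreal (?S + real n * ?d / s k) + ennreal (1 - s k) * ennreal (err k \<omega>)"
      using s err_nonneg[of k \<omega>] by (simp add: ennreal_leI flip: ennreal_plus ennreal_mult)
  qed
  also have "\<dots> = ennreal (?S + real n * ?d / s k) + ennreal (1 - s k) * (\<integral>\<^sup>+\<omega>. ennreal (err k \<omega>) \<partial>M)"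
    by (subst nn_integral_add) (auto simp: nn_integral_cmult M.emeasure_space_1)
  finally show ?thesis .
qed

section \<open>Descent and telescoping\<close>

lemma descent:
  assumes \<omega>: "\<omega> \<in> space M"
  defines "fb \<equiv> gauss_smooth n b mean"
  shows "s1 k * L2_set (g (X k \<omega>)) {..<n} \<le> fb (X k \<omega>) - fb (X (Suc k) \<omega>)
    + s1 k * (2 * (\<Sum>i<n. \<bar>P (Suc k) \<omega> i - g (X k \<omega>) i\<bar>))
    + L0 * sqrt n / b * (n * (s1 k)\<^sup>2) * exp (n * (s1 k)\<^sup>2 / (2 * b\<^sup>2))"
proof -
  let ?p = "P (Suc k) \<omega>" and ?g = "g (X k \<omega>)"
  let ?\<Delta> = "\<lambda>i. - s1 k * sgn (?p i)"
  let ?s = "\<Sum>i<n. (?\<Delta> i)\<^sup>2"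
  have "(\<Sum>i<n. (?\<Delta> i)\<^sup>2) \<le> (\<Sum>i<n. (s1 k)\<^sup>2)"
    by (intro sum_mono) (auto simp: sgn_if)
  then have s: "?s \<le> n * (s1 k)\<^sup>2" by simp
  have "fb (X (Suc k) \<omega>) - fb (X k \<omega>) - (\<Sum>i<n. ?\<Delta> i * ?g i) \<le> L0 * sqrt n / b * ?s * exp (?s / (2 * b\<^sup>2))"
    using gauss_smooth_second_order[OF X_in_space[OF \<omega>, of k], of ?\<Delta>]
    unfolding fb_def X_Suc by linarith
  \<comment> \<open>The remainder increases with the squared step length, so \<open>?s\<close> may
    be replaced by its bound.\<close>
  also have "\<dots> \<le> L0 * sqrt n / b * (n * (s1 k)\<^sup>2) * exp (n * (s1 k)\<^sup>2 / (2 * b\<^sup>2))"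
    using s L0_pos b_gt_0 by (intro mult_mono) (auto intro!: divide_right_mono sum_nonneg mult_nonneg_nonneg)
  finally have 1: "fb (X (Suc k) \<omega>) - fb (X k \<omega>) - (\<Sum>i<n. ?\<Delta> i * ?g i) \<le>
      L0 * sqrt n / b * (n * (s1 k)\<^sup>2) * exp (n * (s1 k)\<^sup>2 / (2 * b\<^sup>2))" .
  have "L2_set ?g {..<n} \<le> (\<Sum>i<n. \<bar>?g i\<bar>)" by (rule L2_set_le_sum_abs)
  \<comment> \<open>If the signs agree, already the first summand equals
    \<open>\<bar>?g i\<bar>\<close>. If they differ, or the momentum is 0, then
    \<open>\<bar>?g i\<bar> \<le> \<bar>?p i - ?g i\<bar>\<close>, and the factor 2 makes up for the
    wrong sign.\<close>
  also have "\<dots> \<le> (\<Sum>i<n. sgn (?p i) * ?g i + 2 * \<bar>?p i - ?g i\<bar>)"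
    by (intro sum_mono) (auto simp: sgn_if abs_if)
  finally have "s1 k * L2_set ?g {..<n} \<le> s1 k * (\<Sum>i<n. sgn (?p i) * ?g i + 2 * \<bar>?p i - ?g i\<bar>)"
    using s1_nonneg by (rule mult_left_mono)
  also have "\<dots> = - (\<Sum>i<n. ?\<Delta> i * ?g i) + s1 k * (2 * (\<Sum>i<n. \<bar>?p i - ?g i\<bar>))"
    by (simp add: sum.distrib distrib_left sum_distrib_left sum_negf[symmetric] mult_ac)
  finally show ?thesis using 1 by linarith
qed

lemma integrable_norm_g: "integrable M (\<lambda>\<omega>. L2_set (g (X k \<omega>)) {..<n})"
proof (rule M.integrable_const_bound)
  show "AE \<omega> in M. norm (L2_set (g (X k \<omega>)) {..<n}) \<le> (\<Sum>i<n. L0 * n)"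
  proof (rule AE_I2)
    fix \<omega> assume \<omega>: "\<omega> \<in> space M"
    have "L2_set (g (X k \<omega>)) {..<n} \<le> (\<Sum>i<n. \<bar>g (X k \<omega>) i\<bar>)" by (rule L2_set_le_sum_abs)
    also have "\<dots> \<le> (\<Sum>i<n. L0 * n)"
      by (intro sum_mono smooth_grad_bounded X_in_space \<omega>) auto
    finally show "norm (L2_set (g (X k \<omega>)) {..<n}) \<le> (\<Sum>i<n. L0 * n)" by simp
  qed
qed measurable

text \<open>The descent inequality is summed along each path before it is integrated: the smoothed
  objective telescopes to a difference that is almost surely at most \<open>D\<close>, and its
  values never have to be integrated. The weight \<open>\<theta>\<close> of the arithmetic-geometric
  mean inequality stays free until the rates are balanced.\<close>

lemma weighted_sum_le:
  fixes C K :: nat and D :: real and v \<theta> :: "nat \<Rightarrow> real"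
  defines "fb \<equiv> gauss_smooth n b mean"
  assumes CK: "C \<le> K" and bdd: "bdd_below (fb ` space (Rvec n))"
    and D: "AE \<omega> in M. fb (X C \<omega>) - (INF y\<in>space (Rvec n). fb y) \<le> D"
    and v: "\<And>k. (\<integral>\<^sup>+\<omega>. ennreal (err k \<omega>) \<partial>M) \<le> ennreal (v k)" "\<And>k. 0 \<le> v k"
    and \<theta>: "\<And>k. 0 < \<theta> k"
  shows "(\<Sum>k=C..K. s1 k * (\<integral>\<omega>. L2_set (g (X k \<omega>)) {..<n} \<partial>M)) \<le>
    D + (\<Sum>k=C..K. s1 k * (\<theta> k * v k + n / \<theta> k)
      + L0 * sqrt n / b * (n * (s1 k)\<^sup>2) * exp (n * (s1 k)\<^sup>2 / (2 * b\<^sup>2)))"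
proof -
  let ?Q = "\<lambda>k. L0 * sqrt n / b * (n * (s1 k)\<^sup>2) * exp (n * (s1 k)\<^sup>2 / (2 * b\<^sup>2))"
  let ?h = "\<lambda>k \<omega>. L2_set (g (X k \<omega>)) {..<n}"
  have err_int: "integrable M (err k)" and err_le: "(\<integral>\<omega>. err k \<omega> \<partial>M) \<le> v k" for k
  proof -
    \<comment> \<open>The finite bound on the nonnegative integral is what yields
      integrability.\<close>
    show *: "integrable M (err k)"
      using v(1)[of k] by (intro integrableI_nonneg) (auto simp: err_nonneg top_unique less_top[symmetric])
    show "(\<integral>\<omega>. err k \<omega> \<partial>M) \<le> v k"
      using v[of k] nn_integral_eq_integral[OF *] by (simp add: err_nonneg)
  qed
  have AM_GM: "2 * (\<Sum>i<n. \<bar>P (Suc k) \<omega> i - g (X k \<omega>) i\<bar>) \<le> \<theta> k * err k \<omega> + n / \<theta> k" for k \<omega>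
  proof -
    have "2 * \<bar>e\<bar> \<le> \<theta> k * e\<^sup>2 + 1 / \<theta> k" for e
    proof -
      have "0 \<le> (\<theta> k * \<bar>e\<bar> - 1)\<^sup>2 / \<theta> k" using \<theta>[of k] by simp
      also have "\<dots> = \<theta> k * e\<^sup>2 + 1 / \<theta> k - 2 * \<bar>e\<bar>"
        using \<theta>[of k] by (simp add: power2_eq_square field_simps)
      finally show ?thesis by simp
    qed
    then have "(\<Sum>i<n. 2 * \<bar>P (Suc k) \<omega> i - g (X k \<omega>) i\<bar>) \<le>
        (\<Sum>i<n. \<theta> k * (P (Suc k) \<omega> i - g (X k \<omega>) i)\<^sup>2 + 1 / \<theta> k)"
      by (intro sum_mono)
    then show ?thesis by (simp add: err_def sum.distrib sum_distrib_left)
  qed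
  have path: "(\<Sum>k=C..K. s1 k * ?h k \<omega>) \<le> D + (\<Sum>k=C..K. s1 k * (\<theta> k * err k \<omega> + n / \<theta> k) + ?Q k)"
    if \<omega>: "\<omega> \<in> space M" and Dw: "fb (X C \<omega>) - (INF y\<in>space (Rvec n). fb y) \<le> D" for \<omega>
  proof -
    have "s1 k * ?h k \<omega> \<le> fb (X k \<omega>) - fb (X (Suc k) \<omega>) + (s1 k * (\<theta> k * err k \<omega> + n / \<theta> k) + ?Q k)" for k
      using descent[OF \<omega>, of k] mult_left_mono[OF AM_GM[of k \<omega>] s1_nonneg[of k]]
      unfolding fb_def by linarith
    then have "(\<Sum>k=C..K. s1 k * ?h k \<omega>) \<le>
        (\<Sum>k=C..K. fb (X k \<omega>) - fb (X (Suc k) \<omega>) + (s1 k * (\<theta> k * err k \<omega> + n / \<theta> k) + ?Q k))"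
      by (rule sum_mono)
    also have "\<dots> = (\<Sum>k=C..K. fb (X k \<omega>) - fb (X (Suc k) \<omega>)) + (\<Sum>k=C..K. s1 k * (\<theta> k * err k \<omega> + n / \<theta> k) + ?Q k)"
      by (rule sum.distrib)
    also have "(\<Sum>k=C..K. fb (X k \<omega>) - fb (X (Suc k) \<omega>)) = fb (X C \<omega>) - fb (X (Suc K) \<omega>)"
      using sum_Suc_diff[of C K "\<lambda>k. - fb (X k \<omega>)"] CK by simp
    finally show ?thesis
      using Dw cINF_lower[OF bdd X_in_space[OF \<omega>, of "Suc K"]] by linarith
  qed
  have h_int: "integrable M (?h k)" for k by (rule integrable_norm_g)
  have "(\<Sum>k=C..K. s1 k * (\<integral>\<omega>. ?h k \<omega> \<partial>M)) = (\<integral>\<omega>. (\<Sum>k=C..K. s1 k * ?h k \<omega>) \<partial>M)"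
    using h_int by simp
  also have "\<dots> \<le> (\<integral>\<omega>. D + (\<Sum>k=C..K. s1 k * (\<theta> k * err k \<omega> + n / \<theta> k) + ?Q k) \<partial>M)"
  proof (rule integral_mono_AE)
    show "integrable M (\<lambda>\<omega>. \<Sum>k=C..K. s1 k * ?h k \<omega>)"
      by (intro Bochner_Integration.integrable_sum integrable_mult_right h_int)
    show "integrable M (\<lambda>\<omega>. D + (\<Sum>k=C..K. s1 k * (\<theta> k * err k \<omega> + n / \<theta> k) + ?Q k))"
      by (intro Bochner_Integration.integrable_sum Bochner_Integration.integrable_add integrable_mult_right
          err_int M.integrable_const)
    show "AE \<omega> in M. (\<Sum>k=C..K. s1 k * ?h k \<omega>) \<le> D + (\<Sum>k=C..K. s1 k * (\<theta> k * err k \<omega> + n / \<theta> k) + ?Q k)"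
      using D AE_space by eventually_elim (rule path)
  qed
  also have "\<dots> = D + (\<Sum>k=C..K. s1 k * (\<theta> k * (\<integral>\<omega>. err k \<omega> \<partial>M) + n / \<theta> k) + ?Q k)"
    using err_int M.prob_space by simp
  also have "\<dots> \<le> D + (\<Sum>k=C..K. s1 k * (\<theta> k * v k + n / \<theta> k) + ?Q k)"
    using \<theta> s1_nonneg err_le by (intro add_left_mono sum_mono add_right_mono mult_left_mono) (auto intro: less_imp_le)
  finally show ?thesis .
qed

end

section \<open>Rates\<close>

text \<open>The random index is independent of the samples at the level of generated sigma-algebras;
  this passes to functions measurable for them.\<close>

lemma (in prob_space) indep_var_of_indep_set:
  assumes indep: "indep_set (sets A) (sets B)" and sp: "space A = space M" "space B = space M"
    and f: "f \<in> A \<rightarrow>\<^sub>M N" and h: "h \<in> B \<rightarrow>\<^sub>M N'"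
  shows "indep_var N f N' h"
proof -
  have ev: "sets A \<subseteq> events" "sets B \<subseteq> events"
    using indep by (auto simp: indep_sets2_eq)
  have "f \<in> M \<rightarrow>\<^sub>M N" "h \<in> M \<rightarrow>\<^sub>M N'"
    using f h ev sp by (auto simp: measurable_def)
  moreover have "sigma_sets (space M) {f -` S \<inter> space M |S. S \<in> sets N} \<subseteq> sets A"
    using measurable_sets[OF f] unfolding sp(1)[symmetric] by (intro sets.sigma_sets_subset) auto
  moreover have "sigma_sets (space M) {h -` S \<inter> space M |S. S \<in> sets N'} \<subseteq> sets B"
    using measurable_sets[OF h] unfolding sp(2)[symmetric] by (intro sets.sigma_sets_subset) auto
  ultimately show ?thesis
    using indep unfolding indep_var_eq indep_sets2_eq by blast
qed

text \<open>Each term is at most the increment of \<open>ln\<close> from \<open>k\<close> to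
  \<open>k + 1\<close>, and the increments telescope; \<open>1 \<le> C\<close> keeps the argument of
  \<open>ln\<close> positive.\<close>

lemma sum_inverse_Suc_le_ln:
  assumes "1 \<le> C" "C \<le> K"
  shows "(\<Sum>k=C..K. 1 / (real k + 1)) \<le> ln (real K + 1)"
proof -
  have "1 / (real k + 1) \<le> ln (real (Suc k)) - ln (real k)" if "k \<in> {C..K}" for k
  proof -
    have k: "0 < real k" using that assms by auto
    then have "ln (real k / (real k + 1)) \<le> real k / (real k + 1) - 1"
      by (intro ln_le_minus_one) auto
    also have "\<dots> = - (1 / (real k + 1))" using k by (simp add: field_simps)
    finally show ?thesis using k by (simp add: ln_div add.commute)
  qed
  then have "(\<Sum>k=C..K. 1 / (real k + 1)) \<le> (\<Sum>k=C..K. ln (real (Suc k)) - ln (real k))"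
    by (rule sum_mono)
  also have "\<dots> = ln (real (Suc K)) - ln (real C)"
    using assms by (intro sum_Suc_diff) auto
  also have "\<dots> \<le> ln (real K + 1)" using assms by (simp add: add.commute)
  finally show ?thesis .
qed

text \<open>As long as \<open>sqrt (k + 2) \<le> 2 * \<kappa>\<close> the contraction is too weak to beat the decay of the
  claimed bound, and summing the increments is good enough.\<close>

lemma momentum_recursion:
  fixes V :: "nat \<Rightarrow> ennreal" and B W \<kappa> \<sigma> :: real
  assumes V_0: "V 0 \<le> ennreal W"
    and V_Suc: "\<And>k. V (Suc k) \<le> ennreal (B / (real k + 2)) + ennreal (1 - \<sigma> / sqrt (real k + 2)) * V k"
    and pos: "0 \<le> W" "0 \<le> B" "1 \<le> \<kappa>" and \<sigma>_ge: "1 / \<kappa> \<le> \<sigma>" and \<sigma>_less: "\<sigma> < 1"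
  shows "V k \<le> ennreal ((2 * \<kappa> * (W + 4 * \<kappa>\<^sup>2 * B) + 2 * \<kappa> * B) / sqrt (real k + 1))"
proof -
  \<comment> \<open>The first summand serves the early phase, where \<open>V\<close> has grown at
    most linearly to \<open>W + 4 * \<kappa>\<^sup>2 * B\<close> and the root is at most
    \<open>2 * \<kappa>\<close>. The second gives \<open>B \<le> A / (2 * \<kappa>)\<close> for the
    late phase.\<close>
  define A where "A = 2 * \<kappa> * (W + 4 * \<kappa>\<^sup>2 * B) + 2 * \<kappa> * B"
  have "0 < 1 / \<kappa>" using pos by simp
  with \<sigma>_ge have \<sigma>: "0 < \<sigma>" by linarith
  have A: "0 \<le> A"
    unfolding A_def using pos by (intro add_nonneg_nonneg mult_nonneg_nonneg) auto
  have c: "0 \<le> 1 - \<sigma> / sqrt (real k + 2)" for k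
  proof -
    have "1 \<le> sqrt (real k + 2)" by simp
    then have "\<sigma> \<le> sqrt (real k + 2)" using \<sigma>_less by linarith
    then show ?thesis by (simp add: divide_le_eq)
  qed
  have step: "V (Suc k) \<le> ennreal (B / (real k + 2) + (1 - \<sigma> / sqrt (real k + 2)) * r)"
    if "V k \<le> ennreal r" "0 \<le> r" for k r
  proof -
    have "ennreal (1 - \<sigma> / sqrt (real k + 2)) * V k \<le> ennreal (1 - \<sigma> / sqrt (real k + 2)) * ennreal r"
      using that by (intro mult_left_mono) auto
    then have "V (Suc k) \<le> ennreal (B / (real k + 2)) + ennreal (1 - \<sigma> / sqrt (real k + 2)) * ennreal r"
      using V_Suc[of k] by (meson add_left_mono order_trans)
    also have "\<dots> = ennreal (B / (real k + 2) + (1 - \<sigma> / sqrt (real k + 2)) * r)"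
      using that pos c[of k] by (simp add: ennreal_mult[symmetric] ennreal_plus[symmetric] del: ennreal_plus)
    finally show ?thesis .
  qed
  have linear: "V k \<le> ennreal (W + k * B)" for k
  proof (induction k)
    case (Suc k)
    have "B / (real k + 2) + (1 - \<sigma> / sqrt (real k + 2)) * (W + k * B) \<le> B + 1 * (W + k * B)"
      using pos \<sigma> by (intro add_mono mult_right_mono) (auto simp: divide_le_eq mult_le_cancel_left1)
    then have "ennreal (B / (real k + 2) + (1 - \<sigma> / sqrt (real k + 2)) * (W + k * B)) \<le> ennreal (W + Suc k * B)"
      by (intro ennreal_leI) (simp add: algebra_simps)
    moreover have "0 \<le> W + k * B" using pos by simp
    ultimately show ?case using step[OF Suc] by (meson order_trans)
  qed (use V_0 in simp)
  have "V k \<le> ennreal (A / sqrt (real k + 1))" for k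
  proof (induction k)
    case 0
    have "1 * W \<le> 2 * \<kappa> * W" using pos by (intro mult_right_mono) auto
    also have "\<dots> \<le> A" using pos by (simp add: A_def algebra_simps)
    finally show ?case using V_0 by (auto intro: order_trans ennreal_leI)
  next
    case (Suc k)
    define r where "r = sqrt (real k + 2)"
    define p where "p = sqrt (real k + 1)"
    have rp: "0 < p" "p \<le> r" "r\<^sup>2 = real k + 2" "p\<^sup>2 = real k + 1" "0 < r"
      by (simp_all add: r_def p_def)
    have r': "sqrt (real (Suc k) + 1) = r" by (simp add: r_def add.commute)
    show ?case
    proof (cases "r \<le> 2 * \<kappa>")
      case True
      have "r\<^sup>2 \<le> (2 * \<kappa>)\<^sup>2" using True rp by (intro power_mono) auto
      then have "real (Suc k) \<le> 4 * \<kappa>\<^sup>2" using rp by (simp add: power_mult_distrib)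
      then have "W + Suc k * B \<le> W + 4 * \<kappa>\<^sup>2 * B"
        using pos by (intro add_left_mono mult_right_mono) auto
      then have "(W + Suc k * B) * r \<le> (W + 4 * \<kappa>\<^sup>2 * B) * (2 * \<kappa>)"
        using True pos rp by (intro mult_mono) auto
      also have "\<dots> \<le> A" using pos by (simp add: A_def algebra_simps)
      finally have "W + Suc k * B \<le> A / r" using rp by (simp add: le_divide_eq)
      then show ?thesis unfolding r' by (rule order_trans[OF linear ennreal_leI])
    next
      case False
      \<comment> \<open>Multiplied by \<open>r\<^sup>2 * p\<close>, the induction step reads
        \<open>B * p + r * (r - \<sigma>) * A \<le> A * r * p\<close>. The decay of the bound costs
        \<open>r - p\<close>, here at most half of \<open>1 / \<kappa>\<close>, so that at least
        \<open>1 / (2 * \<kappa>)\<close> of the contraction \<open>\<sigma>\<close> is left to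
        absorb \<open>B\<close>.\<close>
      have "(r - p) * (r + p) = 1" using rp by (simp add: algebra_simps power2_eq_square)
      then have "r - p = 1 / (r + p)" using rp by (simp add: field_simps)
      also have "\<dots> \<le> 1 / (2 * \<kappa>)" using False rp pos by (intro divide_left_mono) auto
      finally have "1 / (2 * \<kappa>) \<le> \<sigma> - (r - p)" using \<sigma>_ge by (simp add: field_simps)
      then have "A * r * (1 / (2 * \<kappa>)) \<le> A * r * (\<sigma> - (r - p))"
        using A rp by (intro mult_left_mono) auto
      moreover have "B * p \<le> A * r * (1 / (2 * \<kappa>))"
      proof -
        have "B * p \<le> B * r" using pos rp by (intro mult_left_mono) auto
        also have "B \<le> A / (2 * \<kappa>)" using pos by (simp add: A_def field_simps)
        then have "B * r \<le> A / (2 * \<kappa>) * r" using rp by (intro mult_right_mono) auto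
        finally show ?thesis by (simp add: mult_ac)
      qed
      ultimately have "B * p + r * (r - \<sigma>) * A \<le> A * r * p" by (simp add: algebra_simps)
      then have "(B * p + r * (r - \<sigma>) * A) / (r\<^sup>2 * p) \<le> A * r * p / (r\<^sup>2 * p)"
        using rp by (intro divide_right_mono) auto
      moreover have "(B * p + r * (r - \<sigma>) * A) / (r\<^sup>2 * p) = B / r\<^sup>2 + (1 - \<sigma> / r) * (A / p)"
        using rp(1,5) by (simp add: field_simps power2_eq_square)
      moreover have "A * r * p / (r\<^sup>2 * p) = A / r"
        using rp(1,5) by (simp add: field_simps power2_eq_square)
      ultimately have "B / (real k + 2) + (1 - \<sigma> / r) * (A / p) \<le> A / r"
        using rp by simp
      moreover have "V (Suc k) \<le> ennreal (B / (real k + 2) + (1 - \<sigma> / r) * (A / p))"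
        using step[OF Suc] A unfolding r_def p_def by simp
      ultimately show ?thesis unfolding r' by (meson ennreal_leI order_trans)
    qed
  qed
  then show ?thesis by (simp add: A_def)
qed

text \<open>The \<open>sqrt n\<close> in the denominator is the gain of the initial step size; it
  cancels the \<open>sqrt n\<close> in the remainder of the smoothing expansion.\<close>

lemma square_signum_step:
  assumes "1 \<le> n"
  shows "real n * (step_size (1 / real n powr (3/4)) (3/4) k)\<^sup>2 = 1 / (sqrt n * ((real k + 1) * sqrt (real k + 1)))"
proof -
  have p: "(t powr (3/4))\<^sup>2 = t * sqrt t" if "0 < t" for t :: real
  proof -
    have "(t powr (3/4))\<^sup>2 = t powr (1 + 1/2)" using that by (simp add: power2_eq_square flip: powr_add)
    also have "\<dots> = t * sqrt t" using that by (simp only: powr_add powr_one powr_half_sqrt less_imp_le)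
    finally show ?thesis .
  qed
  show ?thesis
    using assms p[of "real n"] p[of "real k + 1"] by (simp add: step_size_def power_divide power_mult_distrib)
qed

section \<open>Assembly of the rate\<close>

context zo_run
begin

text \<open>State \<open>k\<close> is measurable for the sigma-algebra generated by all samples, of
  which \<open>R\<close> is independent.\<close>

lemma integral_uniform_index:
  assumes R: "independent_uniform_index M n m q U Z I R" and I: "finite I" "I \<noteq> {}"
  shows "(\<integral>\<omega>. L2_set (g (X (R \<omega>) \<omega>)) {..<n} \<partial>M) =
    (\<Sum>k\<in>I. \<integral>\<omega>. L2_set (g (X k \<omega>)) {..<n} \<partial>M) / card I"
proof (rule M.integral_indep_index[OF I])
  let ?A = "vimage_algebra (space M) R (count_space UNIV)"
  let ?J = "UNIV \<times> {1..q}"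
  let ?N = "\<lambda>_::nat \<times> nat. Rvec n \<Otimes>\<^sub>M Rvec m"
  let ?S = "\<lambda>\<omega>. \<lambda>i\<in>?J. W i \<omega>"
  let ?B = "vimage_algebra (space M) ?S (PiM ?J ?N)"
  have "(\<lambda>\<omega>. \<lambda>(k, j)\<in>?J. (U k j \<omega>, Z k j \<omega>)) = ?S"
    by (auto simp: fun_eq_iff restrict_def)
  then have indep: "M.indep_set (sets ?A) (sets ?B)"
    and distr: "distr M (count_space UNIV) R = measure_pmf (pmf_of_set I)"
    using R by (simp_all add: independent_uniform_index_def)
  show "distr M (count_space UNIV) R = measure_pmf (pmf_of_set I)" by fact
  have RA: "R \<in> ?A \<rightarrow>\<^sub>M count_space UNIV"
    by (rule measurable_vimage_algebra1) auto
  have "sets ?A \<subseteq> sets M" using indep by (simp add: M.indep_sets2_eq)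
  with RA show "R \<in> M \<rightarrow>\<^sub>M count_space UNIV"
    by (auto simp: measurable_def)
  have "?S \<in> M \<rightarrow>\<^sub>M PiM ?J ?N"
    using indep_W by (intro measurable_restrict) (auto simp: M.indep_vars_def)
  then have SB: "?S \<in> ?B \<rightarrow>\<^sub>M PiM ?J ?N"
    by (intro measurable_vimage_algebra1) (auto dest: measurable_space)
  fix k
  have "(\<lambda>\<omega>. fst (run (\<lambda>l j. fst (?S \<omega> (l, j))) (\<lambda>l j. snd (?S \<omega> (l, j))) k)) \<in> ?B \<rightarrow>\<^sub>M Rvec n"
    by (rule measurable_compose[OF measurable_compose[OF SB measurable_run_family] measurable_fst]) auto
  moreover have "fst (run (\<lambda>l j. fst (?S \<omega> (l, j))) (\<lambda>l j. snd (?S \<omega> (l, j))) k) = X k \<omega>" for \<omega>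
    by (subst state_eq) auto
  ultimately have "X k \<in> ?B \<rightarrow>\<^sub>M Rvec n" by simp
  then have h: "(\<lambda>\<omega>. L2_set (g (X k \<omega>)) {..<n}) \<in> borel_measurable ?B"
    by (intro measurable_L2_set measurable_compose[OF _ measurable_g])
  have r: "(\<lambda>\<omega>. indicator {k} (R \<omega>)) \<in> borel_measurable ?A"
    by (rule measurable_compose[OF RA]) auto
  show "M.indep_var borel (\<lambda>\<omega>. indicator {k} (R \<omega>)) borel (\<lambda>\<omega>. L2_set (g (X k \<omega>)) {..<n})"
    by (rule M.indep_var_of_indep_set[OF indep _ _ r h]) auto
  show "integrable M (\<lambda>\<omega>. L2_set (g (X k \<omega>)) {..<n})" by (rule integrable_norm_g)
qed

text \<open>In \<open>B\<close> the summand \<open>3 * L0\<^sup>2\<close> is the sampling noise, and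
  \<open>\<kappa> ^ 3\<close> in the drift collects \<open>1 / b\<^sup>2\<close> and
  \<open>1 / \<sigma>\<close>. The bound of \<open>momentum_recursion\<close> is linear in its two
  data, so \<open>(real n)\<^sup>2\<close> can be pulled out.\<close>

lemma nn_integral_err_decay:
  fixes \<kappa> \<sigma> :: real
  defines "B \<equiv> 3 * L0\<^sup>2 * (1 + \<kappa> ^ 3)"
  assumes n: "1 \<le> n" and \<kappa>: "1 \<le> \<kappa>" "1 / \<kappa> \<le> b" "1 / \<kappa> \<le> \<sigma>" "\<sigma> < 1"
    and s1: "s1 = step_size (1 / real n powr (3/4)) (3/4)" and s2: "s2 = step_size \<sigma> (1/2)"
  shows "(\<integral>\<^sup>+\<omega>. ennreal (err k \<omega>) \<partial>M) \<le>
    ennreal ((real n)\<^sup>2 * (2 * \<kappa> * (6 * L0\<^sup>2 + 4 * \<kappa>\<^sup>2 * B) + 2 * \<kappa> * B) / sqrt (real k + 1))"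
proof -
  have s2': "s2 (Suc k) = \<sigma> / sqrt (real k + 2)" for k
    by (simp add: s2 step_size_def powr_half_sqrt add.commute)
  have "0 < 1 / \<kappa>" using \<kappa>(1) by simp
  with \<kappa>(3) have \<sigma>: "0 < \<sigma>" by linarith
  have B: "0 \<le> B" using \<kappa>(1) by (simp add: B_def)
  have step: "(s2 (Suc k))\<^sup>2 * (3 * L0\<^sup>2 * (real n)\<^sup>2) + real n * ((L0 / b)\<^sup>2 * (n * (s1 k)\<^sup>2)) / s2 (Suc k) \<le>
      (real n)\<^sup>2 * B / (real k + 2)" for k
  proof -
    have "\<sigma>\<^sup>2 \<le> 1" using \<sigma> \<kappa>(4) by (intro power_le_one) auto
    then have 1: "(s2 (Suc k))\<^sup>2 \<le> 1 / (real k + 2)"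
      by (simp add: s2' power_divide divide_right_mono)
    have "1 / s2 (Suc k) = sqrt (real k + 2) * (1 / \<sigma>)" by (simp add: s2')
    also have "1 / \<sigma> \<le> \<kappa>" using \<kappa>(1,3) \<sigma> by (simp add: field_simps)
    finally have 2: "1 / s2 (Suc k) \<le> sqrt (real k + 2) * \<kappa>" by (simp add: mult_left_mono)
    have "L0 / b \<le> L0 * \<kappa>"
      using \<kappa>(1,2) b_gt_0 L0_pos by (simp add: field_simps)
    then have 3: "(L0 / b)\<^sup>2 \<le> (L0 * \<kappa>)\<^sup>2"
      using b_gt_0 L0_pos by (intro power_mono) auto
    \<comment> \<open>Deliberately generous: it brings the drift to the order n^2 of the sampling
      noise, which dominates in \<open>n\<close> anyway.\<close>
    have 4: "n * (s1 k)\<^sup>2 \<le> real n / ((real k + 1) * sqrt (real k + 1))"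
    proof -
      have "1 \<le> real n * sqrt n" using n by (intro mult_ge1_I) auto
      then have "1 / sqrt n \<le> real n" using n by (simp add: divide_le_eq)
      then have "1 / sqrt n / ((real k + 1) * sqrt (real k + 1)) \<le> real n / ((real k + 1) * sqrt (real k + 1))"
        by (intro divide_right_mono) auto
      then show ?thesis unfolding s1 square_signum_step[OF n] by simp
    qed
    \<comment> \<open>The 3 is 3/2 times 2: \<open>k + 2\<close> is at most 9/4 of
      \<open>k + 1\<close> under the root and at most twice \<open>k + 1\<close> outside.\<close>
    have 5: "sqrt (real k + 2) / ((real k + 1) * sqrt (real k + 1)) \<le> 3 / (real k + 2)"
    proof -
      have "sqrt (real k + 2) \<le> sqrt ((3/2)\<^sup>2 * (real k + 1))"
        by (intro real_sqrt_le_mono) (simp add: power2_eq_square)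
      also have "\<dots> = 3/2 * sqrt (real k + 1)" by (simp add: real_sqrt_mult)
      finally have "sqrt (real k + 2) * (real k + 2) \<le> 3/2 * sqrt (real k + 1) * (2 * (real k + 1))"
        by (intro mult_mono) auto
      also have "\<dots> = 3 * ((real k + 1) * sqrt (real k + 1))" by simp
      finally have "sqrt (real k + 2) \<le> 3 * ((real k + 1) * sqrt (real k + 1)) / (real k + 2)"
        by (simp add: pos_le_divide_eq)
      then have "sqrt (real k + 2) \<le> 3 / (real k + 2) * ((real k + 1) * sqrt (real k + 1))" by simp
      then show ?thesis by (simp add: pos_divide_le_eq del: times_divide_eq_left)
    qed
    have "real n * ((L0 / b)\<^sup>2 * (n * (s1 k)\<^sup>2)) / s2 (Suc k) =
        real n * ((L0 / b)\<^sup>2 * (n * (s1 k)\<^sup>2)) * (1 / s2 (Suc k))" by simp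
    also have "\<dots> \<le> real n * ((L0 * \<kappa>)\<^sup>2 * (real n / ((real k + 1) * sqrt (real k + 1)))) * (sqrt (real k + 2) * \<kappa>)"
      using 2 3 4 s2_pos[of "Suc k"] by (intro mult_mono) auto
    also have "\<dots> = (real n)\<^sup>2 * L0\<^sup>2 * \<kappa> ^ 3 * (sqrt (real k + 2) / ((real k + 1) * sqrt (real k + 1)))"
      by (simp add: power_mult_distrib power2_eq_square power3_eq_cube)
    also have "\<dots> \<le> (real n)\<^sup>2 * L0\<^sup>2 * \<kappa> ^ 3 * (3 / (real k + 2))"
      using 5 \<kappa>(1) by (intro mult_left_mono) auto
    finally have 6: "real n * ((L0 / b)\<^sup>2 * (n * (s1 k)\<^sup>2)) / s2 (Suc k) \<le>
        (real n)\<^sup>2 * L0\<^sup>2 * \<kappa> ^ 3 * (3 / (real k + 2))" .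
    have "(s2 (Suc k))\<^sup>2 * (3 * L0\<^sup>2 * (real n)\<^sup>2) \<le> 1 / (real k + 2) * (3 * L0\<^sup>2 * (real n)\<^sup>2)"
      using 1 by (intro mult_right_mono) auto
    with 6 have "(s2 (Suc k))\<^sup>2 * (3 * L0\<^sup>2 * (real n)\<^sup>2) + real n * ((L0 / b)\<^sup>2 * (n * (s1 k)\<^sup>2)) / s2 (Suc k) \<le>
        1 / (real k + 2) * (3 * L0\<^sup>2 * (real n)\<^sup>2) + (real n)\<^sup>2 * L0\<^sup>2 * \<kappa> ^ 3 * (3 / (real k + 2))"
      by (rule add_mono[rotated])
    also have "\<dots> = (real n)\<^sup>2 * B / (real k + 2)"
      by (simp add: B_def add_divide_distrib[symmetric] algebra_simps)
    finally show ?thesis .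
  qed
  have "(\<integral>\<^sup>+\<omega>. ennreal (err k \<omega>) \<partial>M) \<le> ennreal ((2 * \<kappa> * ((real n)\<^sup>2 * (6 * L0\<^sup>2) + 4 * \<kappa>\<^sup>2 * ((real n)\<^sup>2 * B))
      + 2 * \<kappa> * ((real n)\<^sup>2 * B)) / sqrt (real k + 1))"
  proof (rule momentum_recursion[where \<sigma> = \<sigma>])
    show "(\<integral>\<^sup>+\<omega>. ennreal (err 0 \<omega>) \<partial>M) \<le> ennreal ((real n)\<^sup>2 * (6 * L0\<^sup>2))"
      using nn_integral_err_0 by (simp add: mult_ac)
    fix k
    show "(\<integral>\<^sup>+\<omega>. ennreal (err (Suc k) \<omega>) \<partial>M) \<le> ennreal ((real n)\<^sup>2 * B / (real k + 2)) +
        ennreal (1 - \<sigma> / sqrt (real k + 2)) * (\<integral>\<^sup>+\<omega>. ennreal (err k \<omega>) \<partial>M)"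
      using nn_integral_err_Suc[of k] ennreal_leI[OF step[of k]]
      unfolding s2'[of k, symmetric] by (meson add_right_mono order_trans)
  qed (use B \<kappa> in auto)
  also have "(2 * \<kappa> * ((real n)\<^sup>2 * (6 * L0\<^sup>2) + 4 * \<kappa>\<^sup>2 * ((real n)\<^sup>2 * B)) + 2 * \<kappa> * ((real n)\<^sup>2 * B)) =
      (real n)\<^sup>2 * (2 * \<kappa> * (6 * L0\<^sup>2 + 4 * \<kappa>\<^sup>2 * B) + 2 * \<kappa> * B)"
    by (simp add: algebra_simps)
  finally show ?thesis .
qed

lemma uniform_index_bound:
  fixes \<kappa> \<sigma> D :: real and C K :: nat
  defines "fb \<equiv> gauss_smooth n b mean"
  defines "B \<equiv> 3 * L0\<^sup>2 * (1 + \<kappa> ^ 3)"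
  defines "A \<equiv> 2 * \<kappa> * (6 * L0\<^sup>2 + 4 * \<kappa>\<^sup>2 * B) + 2 * \<kappa> * B"
  defines "T \<equiv> A + 1 + L0 * \<kappa> * exp (\<kappa>\<^sup>2 / 2)"
  assumes n: "1 \<le> n" and \<kappa>: "1 \<le> \<kappa>" "1 / \<kappa> \<le> b" "1 / \<kappa> \<le> \<sigma>" "\<sigma> < 1"
    and s1: "s1 = step_size (1 / real n powr (3/4)) (3/4)" and s2: "s2 = step_size \<sigma> (1/2)"
    and CK: "1 \<le> C" "C < K" and bdd: "bdd_below (fb ` space (Rvec n))"
    and D: "AE \<omega> in M. fb (X C \<omega>) - (INF y\<in>space (Rvec n). fb y) \<le> D"
    and R: "independent_uniform_index M n m q U Z {C..K} R"
  shows "(\<integral>\<omega>. L2_set (g (X (R \<omega>) \<omega>)) {..<n} \<partial>M) \<le>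
    (real C + 1) * (\<bar>D\<bar> / ln 2 + 2 * T) * (real n powr (3/2) / real K powr (1/4) * ln (real K))"
proof -
  let ?h = "\<lambda>k. \<integral>\<omega>. L2_set (g (X k \<omega>)) {..<n} \<partial>M"
  define N where "N = real n powr (3/4)"
  have N: "1 \<le> N" "0 < N" using n by (auto simp: N_def ge_one_powr_ge_zero)
  have s1': "s1 k = 1 / (N * (real k + 1) powr (3/4))" for k
    by (simp add: s1 step_size_def N_def)
  have B: "0 \<le> B" and A: "0 \<le> A"
    using \<kappa>(1) by (auto simp: B_def A_def intro!: add_nonneg_nonneg mult_nonneg_nonneg)
  have T: "0 \<le> T" using A \<kappa>(1) L0_pos by (simp add: T_def)
  \<comment> \<open>The balancing weight: it makes \<open>\<theta> k * v k\<close> equal to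
    \<open>A * (n / \<theta> k)\<close>.\<close>
  define \<theta> where "\<theta> = (\<lambda>k. (real k + 1) powr (1/4) / sqrt n)"
  define v where "v = (\<lambda>k. (real n)\<^sup>2 * A / sqrt (real k + 1))"
  let ?Q = "\<lambda>k. L0 * sqrt n / b * (n * (s1 k)\<^sup>2) * exp (n * (s1 k)\<^sup>2 / (2 * b\<^sup>2))"
  have main: "(\<Sum>k=C..K. s1 k * ?h k) \<le> D + (\<Sum>k=C..K. s1 k * (\<theta> k * v k + n / \<theta> k) + ?Q k)"
  proof (rule weighted_sum_le)
    show "(\<integral>\<^sup>+\<omega>. ennreal (err k \<omega>) \<partial>M) \<le> ennreal (v k)" for k
      unfolding v_def A_def B_def by (rule nn_integral_err_decay[OF n \<kappa> s1 s2])
  qed (use CK bdd D A n in \<open>auto simp: fb_def v_def \<theta>_def\<close>)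
  have summand_le: "s1 k * (\<theta> k * v k + n / \<theta> k) + ?Q k \<le> N * T * (1 / (real k + 1))" for k
  proof -
    let ?r = "real k + 1"
    have "s1 k * (\<theta> k * v k + n / \<theta> k) = N * (A + 1) * (1 / ?r)"
    proof -
      \<comment> \<open>Fourth roots of \<open>k + 1\<close> and \<open>n\<close> turn all exponents
        into integers, so that the identity becomes one of rational functions.\<close>
      define y where "y = ?r powr (1/4)"
      have y: "0 < y" by (simp add: y_def)
      have y4: "?r = y ^ 4" "sqrt ?r = y\<^sup>2" "?r powr (3/4) = y ^ 3"
        by (simp_all add: y_def powr_power powr_half_sqrt[symmetric])
      define x where "x = real n powr (1/4)"
      have x: "0 < x" using n by (simp add: x_def)
      have x4: "real n = x ^ 4" "sqrt n = x\<^sup>2" "N = x ^ 3"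
        using n by (simp_all add: x_def N_def powr_power powr_half_sqrt[symmetric])
      have "s1 k * (\<theta> k * v k + n / \<theta> k) =
          1 / (x ^ 3 * y ^ 3) * (y / x\<^sup>2 * ((real n)\<^sup>2 * A / y\<^sup>2) + real n / (y / x\<^sup>2))"
        unfolding s1' \<theta>_def v_def by (simp only: y4(2,3) x4(2,3) y_def[symmetric])
      also have "\<dots> = 1 / (x ^ 3 * y ^ 3) * (y / x\<^sup>2 * ((x ^ 4)\<^sup>2 * A / y\<^sup>2) + x ^ 4 / (y / x\<^sup>2))"
        by (simp only: x4(1))
      also have "\<dots> = x ^ 3 * (A + 1) * (1 / y ^ 4)"
        using x y by (simp add: field_simps eval_nat_numeral)
      also have "\<dots> = N * (A + 1) * (1 / ?r)"
        by (simp only: x4(3) y4(1))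
      finally show ?thesis .
    qed
    moreover have "?Q k \<le> N * (L0 * \<kappa> * exp (\<kappa>\<^sup>2 / 2)) * (1 / ?r)"
    proof -
      have sq: "n * (s1 k)\<^sup>2 = 1 / (sqrt n * (?r * sqrt ?r))"
        unfolding s1 by (rule square_signum_step[OF n])
      have bk: "1 / b \<le> \<kappa>" using \<kappa>(1,2) b_gt_0 by (simp add: field_simps)
      have "1 \<le> sqrt n * (?r * sqrt ?r)"
        using n by (intro mult_ge1_I) auto
      then have "n * (s1 k)\<^sup>2 \<le> 1" unfolding sq by simp
      then have "n * (s1 k)\<^sup>2 / (2 * b\<^sup>2) \<le> 1 / (2 * b\<^sup>2)" by (rule divide_right_mono) simp
      also have "\<dots> = (1 / b)\<^sup>2 / 2" by (simp add: power_divide)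
      also have "\<dots> \<le> \<kappa>\<^sup>2 / 2" using bk b_gt_0 by (intro divide_right_mono power_mono) auto
      finally have e: "exp (n * (s1 k)\<^sup>2 / (2 * b\<^sup>2)) \<le> exp (\<kappa>\<^sup>2 / 2)" by simp
      \<comment> \<open>The two roots of \<open>n\<close> cancel, so this term is bounded in
        \<open>n\<close>; the factor \<open>N \<ge> 1\<close> is put in afterwards only to match the
        other term.\<close>
      have "L0 * sqrt n / b * (n * (s1 k)\<^sup>2) = L0 * (1 / b) * (1 / (?r * sqrt ?r))"
        unfolding sq using n by simp
      also have "\<dots> \<le> L0 * \<kappa> * (1 / ?r)"
        using bk b_gt_0 L0_pos \<kappa>(1) by (intro mult_mono divide_left_mono) auto
      finally have "L0 * sqrt n / b * (n * (s1 k)\<^sup>2) \<le> L0 * \<kappa> * (1 / ?r)" .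
      from mult_mono[OF this e] have "?Q k \<le> L0 * \<kappa> * (1 / ?r) * exp (\<kappa>\<^sup>2 / 2)"
        using L0_pos \<kappa>(1) by simp
      also have "\<dots> = 1 * (L0 * \<kappa> * exp (\<kappa>\<^sup>2 / 2) * (1 / ?r))" by simp
      also have "\<dots> \<le> N * (L0 * \<kappa> * exp (\<kappa>\<^sup>2 / 2) * (1 / ?r))"
        using N L0_pos \<kappa>(1) by (intro mult_right_mono) auto
      finally show ?thesis by (simp add: mult.assoc)
    qed
    ultimately show ?thesis by (simp add: T_def distrib_left distrib_right add_divide_distrib)
  qed
  \<comment> \<open>\<open>1 \<le> C < K\<close> forces K >= 2, hence K + 1 <= K^2, and the shift
    inside the logarithm costs a factor 2.\<close>
  have lnK: "ln 2 \<le> ln (real K)" "0 < ln (real K)" "ln (real K + 1) \<le> 2 * ln (real K)"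
  proof -
    have K: "2 \<le> real K" using CK by simp
    then show "ln 2 \<le> ln (real K)" by simp
    show "0 < ln (real K)" using K by (intro ln_gt_zero) auto
    have "2 * real K \<le> real K * real K" using K by (intro mult_right_mono) auto
    then have "real K + 1 \<le> real K * real K" using K by linarith
    then have "ln (real K + 1) \<le> ln (real K * real K)" by simp
    then show "ln (real K + 1) \<le> 2 * ln (real K)" using K by (simp add: ln_mult)
  qed
  have "(\<Sum>k=C..K. s1 k * ?h k) \<le> \<bar>D\<bar> + (\<Sum>k=C..K. N * T * (1 / (real k + 1)))"
  proof -
    have "(\<Sum>k=C..K. s1 k * (\<theta> k * v k + n / \<theta> k) + ?Q k) \<le> (\<Sum>k=C..K. N * T * (1 / (real k + 1)))"
      by (rule sum_mono) (rule summand_le)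
    then show ?thesis using main by linarith
  qed
  also have "(\<Sum>k=C..K. N * T * (1 / (real k + 1))) = N * T * (\<Sum>k=C..K. 1 / (real k + 1))"
    by (rule sum_distrib_left[symmetric])
  also have "\<dots> \<le> N * T * (2 * ln (real K))"
    using sum_inverse_Suc_le_ln[of C K] CK lnK N T by (intro mult_left_mono) auto
  \<comment> \<open>Since \<open>ln K \<ge> ln 2\<close>, a constant can be absorbed into the
    logarithm; the absolute value covers a negative \<open>D\<close>.\<close>
  also have "\<bar>D\<bar> \<le> N * (\<bar>D\<bar> / ln 2 * ln (real K))"
  proof -
    have "\<bar>D\<bar> = \<bar>D\<bar> / ln 2 * ln 2" by simp
    also have "\<dots> \<le> \<bar>D\<bar> / ln 2 * ln (real K)" using lnK by (intro mult_left_mono) auto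
    also have "\<dots> = 1 * (\<bar>D\<bar> / ln 2 * ln (real K))" by simp
    also have "\<dots> \<le> N * (\<bar>D\<bar> / ln 2 * ln (real K))" using N lnK by (intro mult_right_mono) auto
    finally show ?thesis .
  qed
  finally have "(\<Sum>k=C..K. s1 k * ?h k) \<le> N * (\<bar>D\<bar> / ln 2 + 2 * T) * ln (real K)"
    by (simp add: algebra_simps)
  moreover have "s1 K * (\<Sum>k=C..K. ?h k) \<le> (\<Sum>k=C..K. s1 k * ?h k)"
    unfolding sum_distrib_left
  proof (rule sum_mono)
    fix k assume "k \<in> {C..K}"
    then have "s1 K \<le> s1 k"
      unfolding s1' using N by (intro divide_left_mono mult_left_mono powr_mono2) auto
    then show "s1 K * ?h k \<le> s1 k * ?h k"
      by (rule mult_right_mono) simp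
  qed
  ultimately have "s1 K * (\<Sum>k=C..K. ?h k) \<le> N * (\<bar>D\<bar> / ln 2 + 2 * T) * ln (real K)" by linarith
  then have sum_le: "(\<Sum>k=C..K. ?h k) \<le> N * N * (real K + 1) powr (3/4) * ((\<bar>D\<bar> / ln 2 + 2 * T) * ln (real K))"
    unfolding s1' using N by (simp add: field_simps)
  have "(\<integral>\<omega>. L2_set (g (X (R \<omega>) \<omega>)) {..<n} \<partial>M) = (\<Sum>k=C..K. ?h k) / card {C..K}"
    using CK by (intro integral_uniform_index[OF R]) auto
  also have "\<dots> \<le> N * N * (real K + 1) powr (3/4) * ((\<bar>D\<bar> / ln 2 + 2 * T) * ln (real K)) / card {C..K}"
    by (intro divide_right_mono sum_le) auto
  also have "\<dots> \<le> N * N * (real K + 1) powr (3/4) * ((\<bar>D\<bar> / ln 2 + 2 * T) * ln (real K)) / ((real K + 1) / (real C + 1))"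
  proof (rule divide_left_mono)
    \<comment> \<open>There are \<open>K - C + 1\<close> indices, and
      \<open>(K - C + 1) * (C + 1) \<ge> K + 1\<close> amounts to \<open>C * C \<le> C * K\<close>.
      This is where the constant picks up the factor \<open>C + 1\<close>.\<close>
    have "real C * real C \<le> real C * real K" using CK by (intro mult_left_mono) auto
    then show "(real K + 1) / (real C + 1) \<le> real (card {C..K})"
      using CK by (simp add: of_nat_diff field_simps)
  qed (use CK N T lnK in auto)
  also have "\<dots> = (real C + 1) * (\<bar>D\<bar> / ln 2 + 2 * T) * (N * N * ((real K + 1) powr (3/4) / (real K + 1)) * ln (real K))"
    by simp
  also have "(real K + 1) powr (3/4) / (real K + 1) \<le> 1 / real K powr (1/4)"
  proof -
    have "(real K + 1) powr (3/4) / (real K + 1) = (real K + 1) powr (3/4 - 1)"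
      by (simp only: powr_diff) simp
    also have "\<dots> = 1 / (real K + 1) powr (1/4)" by (simp add: powr_minus_divide)
    also have "\<dots> \<le> 1 / real K powr (1/4)"
      using CK by (intro divide_left_mono powr_mono2) auto
    finally show ?thesis .
  qed
  also have "N * N = real n powr (3/2)" by (simp add: N_def flip: powr_add)
  finally show ?thesis
    using N T lnK by (simp add: mult_left_mono mult_right_mono)
qed

end

text \<open>The constant is chosen before the dimension, the batch size, \<open>K\<close> and all
  random objects, which is the uniformity meant by the O notation; \<open>\<kappa>\<close> makes
  precise that \<open>\<beta>\<close> and the initial momentum weight are of order 1.\<close>

theorem corollary4p10:
  fixes L0 D \<kappa> :: real and C :: nat
  assumes "L0 > 0" and "\<kappa> \<ge> 1" and "C \<ge> 1"
  shows "\<exists>c::real. \<forall>(n::nat) (m::nat) (q::nat) (K::nat) (\<beta>::real) (s20::real)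
      (\<Omega> :: 'w measure) (\<xi> :: 'w \<Rightarrow> nat \<Rightarrow> real)
      (F :: (nat \<Rightarrow> real) \<Rightarrow> (nat \<Rightarrow> real) \<Rightarrow> real) (x0 :: nat \<Rightarrow> real)
      (M :: 'a measure) (U :: nat \<Rightarrow> nat \<Rightarrow> 'a \<Rightarrow> nat \<Rightarrow> real)
      (Z :: nat \<Rightarrow> nat \<Rightarrow> 'a \<Rightarrow> nat \<Rightarrow> real) (R :: 'a \<Rightarrow> nat).
    let \<alpha>1 = 3/4; \<alpha>2 = 1/2;
        s10 = 1 / real n powr (3/4);
        f\<beta> = gauss_smooth n \<beta> (mean_objective \<Omega> \<xi> F);
        x = (\<lambda>k \<omega>. fst (zo_signum n q F \<beta> (step_size s10 \<alpha>1) (step_size s20 \<alpha>2) x0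
               (\<lambda>l j. U l j \<omega>) (\<lambda>l j. Z l j \<omega>) k))
    in
      n \<ge> 1 \<and> q \<ge> 1 \<and> K > C \<and>
      1/\<kappa> \<le> \<beta> \<and> \<beta> \<le> \<kappa> \<and> 1/\<kappa> \<le> s20 \<and> s20 < 1 \<and>
      burn_in_index s20 \<alpha>1 \<alpha>2 C \<and>
      stochastic_lipschitz_objective n m \<Omega> \<xi> F L0 \<and>
      x0 \<in> space (Rvec n) \<and>
      fresh_samples M n m q \<Omega> \<xi> U Z \<and>
      bdd_below (f\<beta> ` space (Rvec n)) \<and>
      (AE \<omega> in M. f\<beta> (x C \<omega>) - (INF y\<in>space (Rvec n). f\<beta> y) \<le> D) \<and>
      independent_uniform_index M n m q U Z {C..K} R
      \<longrightarrow>
      (\<integral>\<omega>. L2_set (grad n f\<beta> (x (R \<omega>) \<omega>)) {..<n} \<partial>M)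
        \<le> c * (real n powr (3/2) / real K powr (1/4) * ln (real K))"
proof -
  define B where "B = 3 * L0\<^sup>2 * (1 + \<kappa> ^ 3)"
  define A where "A = 2 * \<kappa> * (6 * L0\<^sup>2 + 4 * \<kappa>\<^sup>2 * B) + 2 * \<kappa> * B"
  define T where "T = A + 1 + L0 * \<kappa> * exp (\<kappa>\<^sup>2 / 2)"
  show ?thesis
    unfolding Let_def
  proof (intro exI[of _ "(real C + 1) * (\<bar>D\<bar> / ln 2 + 2 * T)"] allI impI, elim conjE)
    fix n m q K :: nat and \<beta> s20 :: real and \<Omega> :: "'w measure" and \<xi> :: "'w \<Rightarrow> nat \<Rightarrow> real"
      and F :: "(nat \<Rightarrow> real) \<Rightarrow> (nat \<Rightarrow> real) \<Rightarrow> real" and x0 :: "nat \<Rightarrow> real"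
      and M :: "'a measure" and U Z :: "nat \<Rightarrow> nat \<Rightarrow> 'a \<Rightarrow> nat \<Rightarrow> real" and R :: "'a \<Rightarrow> nat"
    let ?s1 = "step_size (1 / real n powr (3/4)) (3/4)" and ?s2 = "step_size s20 (1/2)"
    let ?f = "gauss_smooth n \<beta> (mean_objective \<Omega> \<xi> F)"
    let ?x = "\<lambda>k \<omega>. fst (zo_signum n q F \<beta> ?s1 ?s2 x0 (\<lambda>l j. U l j \<omega>) (\<lambda>l j. Z l j \<omega>) k)"
    assume n: "1 \<le> n" and q: "1 \<le> q" and K: "C < K"
      and \<beta>: "1 / \<kappa> \<le> \<beta>" and s20: "1 / \<kappa> \<le> s20" "s20 < 1"
      and obj: "stochastic_lipschitz_objective n m \<Omega> \<xi> F L0"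
      and x0: "x0 \<in> space (Rvec n)" and samples: "fresh_samples M n m q \<Omega> \<xi> U Z"
      and bdd: "bdd_below (?f ` space (Rvec n))"
      and D: "AE \<omega> in M. ?f (?x C \<omega>) - (INF y\<in>space (Rvec n). ?f y) \<le> D"
      and R: "independent_uniform_index M n m q U Z {C..K} R"
    have "0 < 1 / \<kappa>" using assms(2) by simp
    then have pos: "0 < \<beta>" "0 < s20" using \<beta> s20 by linarith+
    have s2_less: "?s2 k < 1" for k
    proof -
      have "1 \<le> (real k + 1) powr (1/2)" by (intro ge_one_powr_ge_zero) auto
      then show ?thesis using s20 pos by (simp add: step_size_def divide_less_eq)
    qed
    interpret zo_run n m q \<Omega> \<xi> F L0 \<beta> M U Z x0 ?s1 ?s2
      by unfold_locales
        (use obj pos q samples x0 s2_less in \<open>auto simp: step_size_def\<close>)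
    have x: "?x k \<omega> = X k \<omega>" for k \<omega> by (simp add: X_def)
    \<comment> \<open>The derivative of the smoothed objective is replaced by its integral formula
      pointwise in \<open>\<omega>\<close>, which is possible because every iterate is an
      extensional vector.\<close>
    have "(\<integral>\<omega>. L2_set (grad n ?f (?x (R \<omega>) \<omega>)) {..<n} \<partial>M) = (\<integral>\<omega>. L2_set (g (X (R \<omega>) \<omega>)) {..<n} \<partial>M)"
      unfolding x by (intro Bochner_Integration.integral_cong refl) (simp add: grad_gauss_smooth X_in_space)
    also have "\<dots> \<le> (real C + 1) * (\<bar>D\<bar> / ln 2 + 2 * T) * (real n powr (3/2) / real K powr (1/4) * ln (real K))"
      unfolding T_def A_def B_def
      using D unfolding x
      by (intro uniform_index_bound[OF n assms(2) \<beta> s20 refl refl assms(3) K bdd _ R])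
    finally show "(\<integral>\<omega>. L2_set (grad n ?f (?x (R \<omega>) \<omega>)) {..<n} \<partial>M) \<le>
        (real C + 1) * (\<bar>D\<bar> / ln 2 + 2 * T) * (real n powr (3/2) / real K powr (1/4) * ln (real K))" .
  qed
qed

end
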